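(* Let $R$ be a real closed field. An $R$-algebra $A$ has an $R$-algebra morphism into a special extension of $R$ if and only if $-1$ is not a sum of squares in $A$. In particular, the special field extensions of $R$ are exactly its real field extensions.
   Context: All algebras are commutative and unital. A field is real if $-1$ is not a sum of squares in it, and real closed if it is real and has no proper real algebraic extension. For a field $k$, the homogeneous signature $\mathcal H$ of $k$ is the set of all non-zero homogeneous polynomials $P(\bar X,Y)$ over $k$ in finitely many variables $\bar X=(X_1,\ldots,X_n)$ and a distinguished variable $Y$ such that for all $\bar a\in k^n$ and $b\in k$, $P(\bar a,b)=0$ implies $b=0$. A $k$-algebra $A$ is special if for all $P(\bar X,Y)\in\mathcal H$ and all $\bar a,b$ from $A$ with $P(\bar a,b)=0$, we have $b=0$. A special extension of $k$ is a field extension of $k$ which is special as a $k$-algebra. Here these notions are taken with $k=R$. *)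

theory Defs
  imports "HOL-Algebra.Algebra"
begin

definition sum_of_squares :: "('a, 'p) ring_scheme \<Rightarrow> 'a \<Rightarrow> bool"
  where "sum_of_squares A c \<longleftrightarrow>
    (\<exists>(n::nat) x. x \<in> {..<n} \<rightarrow> carrier A \<and> c = (\<Oplus>\<^bsub>A\<^esub>i\<in>{..<n}. x i [^]\<^bsub>A\<^esub> (2::nat)))"

definition real_field :: "('a, 'p) ring_scheme \<Rightarrow> bool"
  where "real_field F \<longleftrightarrow> field F \<and> \<not> sum_of_squares F (\<ominus>\<^bsub>F\<^esub> \<one>\<^bsub>F\<^esub>)"

text \<open>Commutative unital algebras are those of the library locale \<^locale>\<open>algebra\<close>. The base ring
  need not be a subset of the algebra, so it enters through the structure map.\<close>

definition structure_map :: "('k, 'a, 'q) module_scheme \<Rightarrow> 'k \<Rightarrow> 'a"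
  where "structure_map A c = c \<odot>\<^bsub>A\<^esub> \<one>\<^bsub>A\<^esub>"

definition algebra_hom ::
    "('k, 'p) ring_scheme \<Rightarrow> ('k, 'a, 'q) module_scheme \<Rightarrow> ('k, 'b, 's) module_scheme \<Rightarrow> ('a \<Rightarrow> 'b) set"
  where "algebra_hom k A B =
    {h \<in> ring_hom A B. \<forall>c\<in>carrier k. \<forall>x\<in>carrier A. h (c \<odot>\<^bsub>A\<^esub> x) = c \<odot>\<^bsub>B\<^esub> h x}"

definition field_extension :: "('k, 'p) ring_scheme \<Rightarrow> ('k, 'a, 'q) module_scheme \<Rightarrow> bool"
  where "field_extension k K \<longleftrightarrow> field k \<and> field K \<and> algebra k K"

definition algebraic_extension :: "('k, 'p) ring_scheme \<Rightarrow> ('k, 'a, 'q) module_scheme \<Rightarrow> bool"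
  where "algebraic_extension k K \<longleftrightarrow> field_extension k K \<and>
    (\<forall>x\<in>carrier K. (ring.algebraic K over (structure_map K ` carrier k)) x)"

text \<open>A definition cannot quantify over types, so the algebraic extensions are taken with carrier
  in the type of sets of lists over the type of the base field. This is no restriction: a
  real field is infinite, so an algebraic extension of it has at most as many elements
  as its polynomial ring, and hence has an isomorphic copy inside this type.\<close>

definition real_closed_field :: "('k, 'p) ring_scheme \<Rightarrow> bool"
  where "real_closed_field k \<longleftrightarrow> real_field k \<and>
    (\<forall>K :: ('k, 'k list set) module. algebraic_extension k K \<and> real_field K \<longrightarrow>
       structure_map K ` carrier k = carrier K)"

text \<open>Polynomials are the indexed polynomials of the library: functions from monomials
  (multisets of variable indices) to coefficients. The variable with index \<open>0\<close> is the distinguished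
  variable \<open>Y\<close>, those with index \<open>1, \<dots>, n\<close> are \<open>X\<^sub>1, \<dots>, X\<^sub>n\<close>. The map \<open>\<phi>\<close> sends the
  coefficients into the ring in which the polynomial is evaluated.\<close>

definition poly_value ::
    "('k, 'p) ring_scheme \<Rightarrow> ('a, 'q) ring_scheme \<Rightarrow> ('k \<Rightarrow> 'a) \<Rightarrow> (nat multiset \<Rightarrow> 'k) \<Rightarrow> (nat \<Rightarrow> 'a) \<Rightarrow> 'a \<Rightarrow> 'a"
  where "poly_value k A \<phi> P a b =
    (\<Oplus>\<^bsub>A\<^esub>m\<in>{m. P m \<noteq> \<zero>\<^bsub>k\<^esub>}. \<phi> (P m) \<otimes>\<^bsub>A\<^esub> (\<Otimes>\<^bsub>A\<^esub>i\<in>set_mset m. (a(0 := b)) i [^]\<^bsub>A\<^esub> count m i))"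

definition homogeneous_poly :: "('k, 'p) ring_scheme \<Rightarrow> (nat multiset \<Rightarrow> 'k) \<Rightarrow> bool"
  where "homogeneous_poly k P \<longleftrightarrow> (\<exists>d. \<forall>m. P m \<noteq> \<zero>\<^bsub>k\<^esub> \<longrightarrow> size m = d)"

text \<open>The members of the homogeneous signature in the variables \<open>X\<^sub>1, \<dots>, X\<^sub>n, Y\<close>; the signature
  is the union over all \<open>n\<close>.\<close>

definition homogeneous_signature :: "('k, 'p) ring_scheme \<Rightarrow> nat \<Rightarrow> (nat multiset \<Rightarrow> 'k) set"
  where "homogeneous_signature k n =
    {P \<in> ring.indexed_pset k {0..n} (carrier k).
       P \<noteq> (\<lambda>_. \<zero>\<^bsub>k\<^esub>) \<and> homogeneous_poly k P \<and>
       (\<forall>a \<in> {1..n} \<rightarrow> carrier k. \<forall>b\<in>carrier k.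
          poly_value k k (\<lambda>c. c) P a b = \<zero>\<^bsub>k\<^esub> \<longrightarrow> b = \<zero>\<^bsub>k\<^esub>)}"

definition special_algebra :: "('k, 'p) ring_scheme \<Rightarrow> ('k, 'a, 'q) module_scheme \<Rightarrow> bool"
  where "special_algebra k A \<longleftrightarrow> algebra k A \<and>
    (\<forall>n. \<forall>P \<in> homogeneous_signature k n. \<forall>a \<in> {1..n} \<rightarrow> carrier A. \<forall>b\<in>carrier A.
       poly_value k A (structure_map A) P a b = \<zero>\<^bsub>A\<^esub> \<longrightarrow> b = \<zero>\<^bsub>A\<^esub>)"

definition special_extension :: "('k, 'p) ring_scheme \<Rightarrow> ('k, 'a, 'q) module_scheme \<Rightarrow> bool"
  where "special_extension k K \<longleftrightarrow> field_extension k K \<and> special_algebra k K"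

end

(* The form Y^2 + X_1^2 + ... + X_n^2 belongs to the signature of a real field, so special extensions are
  real. Conversely, let L be a real field over the real closed field R and suppose P(a, b) = 0 with a, b
  from L. In the algebraic closure of L, choose a maximal real subfield F that contains L. It is ordered by
  its squares, has the intermediate value property for polynomials, and R is algebraically closed in it. Then sign
  conditions on polynomials over R that hold at a point of F also hold at a point over R: as in the
  quantifier elimination of Cohen and Hoermander, the sign diagrams of two families of polynomials in one
  variable agree when the families are closed under derivatives and remainders and have the same leading
  signs. So P(a', b') = 0 for some a', b' from R, where b' has the same sign as b, and b' = 0 yields b = 0.

  If -1 is not a sum of squares in A, invert all 1 + s, s a sum of squares. The residue field at a maximal
  ideal of this localisation is real, hence special. *)

theory Submission
  imports Defs
begin

section \<open>Polynomial functions\<close>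

text \<open>Maximality of F is used in one form: for t algebraic over F and outside it, -1 is a sum
  of squares in F(t). For a square root t of a this makes a or -a a sum of squares in F; for a root
  t of a polynomial it yields a factor that cannot change its sign, whence intermediate values by
  induction on the degree.

  The obstacle to the transfer is that coefficients depend on the other variables. When one variable
  is eliminated, the coefficients at the given point c over F are compared with those at any e that
  satisfies finitely many sign conditions of c. Both specialisations live in F, and leading
  coefficients, derivatives and remainders behave alike at c and e. In a sign diagram the derivative
  makes a polynomial monotone between neighbouring known roots, and the remainder modulo a
  polynomial with a known root gives the sign at this root. The field R enters when coordinates are
  moved into it: the zeros in F of nonzero polynomials over R lie in R, and each gap between them
  contains a point of R.\<close>

definition (in ring) pval :: "(nat \<Rightarrow> 'a) \<Rightarrow> nat \<Rightarrow> 'a \<Rightarrow> 'a"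
  where "pval a n x = eval (map a (rev [0..<n])) x"

definition (in ring) pder :: "(nat \<Rightarrow> 'a) \<Rightarrow> nat \<Rightarrow> 'a"
  where "pder a i = [Suc i] \<cdot> a (Suc i)"

context cring
begin

lemma pval_0 [simp]: "pval a 0 x = \<zero>"
  by (simp add: pval_def)

text \<open>So \<open>pval a n x\<close> is the sum of a_i x^i over i < n. The number
  \<open>n\<close> counts coefficients, one more than the formal degree, and the top one may be
  zero. A function as coefficient sequence can be shifted, differentiated and specialised without
  normalising; \<open>rev\<close> is there because \<open>eval\<close> reads the leading coefficient
  first.\<close>

lemma pval_Suc: "pval a (Suc n) x = a n \<otimes> x [^] n \<oplus> pval a n x"
  by (simp add: pval_def)

lemma pval_closed [simp]:
  assumes "\<And>i. a i \<in> carrier R" "x \<in> carrier R"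
  shows "pval a n x \<in> carrier R"
  unfolding pval_def using assms by (intro eval_in_carrier) auto

lemma pval_cong: "(\<And>i. i < n \<Longrightarrow> a i = b i) \<Longrightarrow> pval a n x = pval b n x"
  by (induction n) (auto simp: pval_Suc)

lemma pval_shift:
  assumes "\<And>i. a i \<in> carrier R" "x \<in> carrier R"
  shows "pval a (Suc n) x = a 0 \<oplus> x \<otimes> pval (\<lambda>i. a (Suc i)) n x"
proof (induction n)
  case 0
  show ?case using assms by (simp add: pval_Suc)
next
  case (Suc n)
  define u where "u = a (Suc n)"
  define v where "v = x [^] n"
  define w where "w = pval (\<lambda>i. a (Suc i)) n x"
  have cl: "u \<in> carrier R" "v \<in> carrier R" "w \<in> carrier R" "a 0 \<in> carrier R"
    using assms by (auto simp: u_def v_def w_def)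
  have "pval a (Suc (Suc n)) x = u \<otimes> (v \<otimes> x) \<oplus> (a 0 \<oplus> x \<otimes> w)"
    unfolding pval_Suc[of a "Suc n"] Suc u_def v_def w_def by simp
  also have "\<dots> = a 0 \<oplus> x \<otimes> (u \<otimes> v \<oplus> w)"
    using cl assms(2) by algebra
  finally show ?case by (simp add: pval_Suc u_def v_def w_def)
qed

lemma pval_add:
  assumes "\<And>i. a i \<in> carrier R" "\<And>i. b i \<in> carrier R" "x \<in> carrier R"
  shows "pval (\<lambda>i. a i \<oplus> b i) n x = pval a n x \<oplus> pval b n x"
proof (induction n)
  case (Suc n)
  have cl: "a n \<in> carrier R" "b n \<in> carrier R" "x [^] n \<in> carrier R"
    "pval a n x \<in> carrier R" "pval b n x \<in> carrier R"
    using assms by auto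
  show ?case unfolding pval_Suc Suc using cl by algebra
qed simp

lemma pval_smult:
  assumes "\<And>i. a i \<in> carrier R" "c \<in> carrier R" "x \<in> carrier R"
  shows "pval (\<lambda>i. c \<otimes> a i) n x = c \<otimes> pval a n x"
proof (induction n)
  case (Suc n)
  have cl: "a n \<in> carrier R" "x [^] n \<in> carrier R" "pval a n x \<in> carrier R"
    using assms by auto
  show ?case unfolding pval_Suc Suc using cl assms(2) by algebra
qed (use assms in simp)

lemma pval_raise:
  assumes "\<And>i. a i \<in> carrier R" "x \<in> carrier R"
  shows "pval (\<lambda>i. if i < d then \<zero> else a (i - d)) (d + n) x = x [^] d \<otimes> pval a n x"
proof (induction d)
  case 0
  show ?case using assms by simp
next
  case (Suc d)
  let ?b = "\<lambda>i. if i < Suc d then \<zero> else a (i - Suc d)"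
  have "pval ?b (Suc (d + n)) x = \<zero> \<oplus> x \<otimes> pval (\<lambda>i. if i < d then \<zero> else a (i - d)) (d + n) x"
    using assms by (subst pval_shift) (auto cong: if_cong)
  also have "\<dots> = x [^] Suc d \<otimes> pval a n x"
  proof -
    have cl: "x [^] d \<in> carrier R" "pval a n x \<in> carrier R" using assms by auto
    show ?thesis unfolding Suc nat_pow_Suc using cl assms(2) by algebra
  qed
  finally show ?case by simp
qed

text \<open>With \<open>c\<close> negated, this turns the search for a point of value
  \<open>c\<close> into the search for a zero.\<close>

lemma pval_const_add:
  assumes "\<And>i. a i \<in> carrier R" "c \<in> carrier R" "x \<in> carrier R" "n > 0"
  shows "pval (a(0 := a 0 \<oplus> c)) n x = pval a n x \<oplus> c"
proof -
  obtain m where n: "n = Suc m" using assms(4) by (cases n) auto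
  define w where "w = x \<otimes> pval (\<lambda>i. a (Suc i)) m x"
  have cl: "w \<in> carrier R" "a 0 \<in> carrier R" using assms by (auto simp: w_def)
  have "pval (a(0 := a 0 \<oplus> c)) n x = (a 0 \<oplus> c) \<oplus> w"
    unfolding n w_def using assms by (subst pval_shift) auto
  moreover have "pval a n x = a 0 \<oplus> w"
    unfolding n w_def using assms by (subst pval_shift) auto
  ultimately show ?thesis using cl assms(2) by algebra
qed

lemma pder_closed [simp]: "(\<And>i. a i \<in> carrier R) \<Longrightarrow> pder a i \<in> carrier R"
  by (simp add: pder_def)

text \<open>For p = a_0 + X q this is the product rule p' = q + X q'; as q has \<open>n\<close>
  coefficients, q' has \<open>n - 1\<close>.\<close>

lemma pval_pder_shift:
  assumes "\<And>i. a i \<in> carrier R" "x \<in> carrier R"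
  shows "pval (pder a) n x =
    pval (\<lambda>i. a (Suc i)) n x \<oplus> x \<otimes> pval (pder (\<lambda>i. a (Suc i))) (n - 1) x"
proof (cases n)
  case 0
  then show ?thesis using assms by simp
next
  case (Suc m)
  let ?q = "\<lambda>i. a (Suc i)"
  define u where "u = pval (pder ?q) m x"
  define v where "v = pval (\<lambda>i. ?q (Suc i)) m x"
  have cl: "u \<in> carrier R" "v \<in> carrier R" "?q 0 \<in> carrier R"
    using assms by (auto simp: u_def v_def)
  have "pval (pder a) (Suc m) x = pder a 0 \<oplus> x \<otimes> pval (\<lambda>i. pder a (Suc i)) m x"
    using assms by (subst pval_shift) auto
  also have "(\<lambda>i. pder a (Suc i)) = (\<lambda>i. pder ?q i \<oplus> ?q (Suc i))"
    using assms by (auto simp: pder_def add.nat_pow_Suc)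
  also have "pval \<dots> m x = u \<oplus> v"
    unfolding u_def v_def by (rule pval_add) (use assms in auto)
  also have "pder a 0 = ?q 0" using assms by (simp add: pder_def)
  also have "?q 0 \<oplus> x \<otimes> (u \<oplus> v) = (?q 0 \<oplus> x \<otimes> v) \<oplus> x \<otimes> u"
    using cl assms(2) by algebra
  also have "?q 0 \<oplus> x \<otimes> v = pval ?q (Suc m) x"
    unfolding v_def using assms by (subst pval_shift) auto
  finally show ?thesis by (simp add: Suc u_def)
qed

text \<open>\<open>g\<close> is the difference quotient at \<open>r\<close>, obtained by Horner's
  scheme: for p = a_0 + X q, p(x) - p(r) = (x - r) q(r) + x (q(x) - q(r)), so the quotient of p is
  q(r) + X times that of q. The same recursion holds for the derivative at \<open>r\<close>. The top
  coefficient is kept for inductions on the number of zeros.\<close>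

lemma pval_factor:
  assumes "\<And>i. a i \<in> carrier R" "r \<in> carrier R"
  obtains g where "\<And>i. g i \<in> carrier R"
    "\<And>x. x \<in> carrier R \<Longrightarrow> pval a (Suc n) x \<ominus> pval a (Suc n) r = (x \<ominus> r) \<otimes> pval g n x"
    "pval g n r = pval (pder a) n r"
    "n > 0 \<Longrightarrow> g (n - 1) = a n"
proof -
  have "\<exists>g. (\<forall>i. g i \<in> carrier R) \<and>
    (\<forall>x\<in>carrier R. pval a (Suc n) x \<ominus> pval a (Suc n) r = (x \<ominus> r) \<otimes> pval g n x) \<and>
    pval g n r = pval (pder a) n r \<and> (n > 0 \<longrightarrow> g (n - 1) = a n)"
    using assms(1)
  proof (induction n arbitrary: a)
    case 0
    then show ?case using assms(2)
      by (intro exI[of _ "\<lambda>_. \<zero>"]) (auto simp: pval_Suc a_minus_def r_neg)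
  next
    case (Suc n)
    let ?q = "\<lambda>i. a (Suc i)"
    obtain g where g: "\<And>i. g i \<in> carrier R"
      "\<And>x. x \<in> carrier R \<Longrightarrow> pval ?q (Suc n) x \<ominus> pval ?q (Suc n) r = (x \<ominus> r) \<otimes> pval g n x"
      "pval g n r = pval (pder ?q) n r" "n > 0 \<Longrightarrow> g (n - 1) = ?q n"
      using Suc.IH[of ?q] Suc.prems by blast
    define h where "h i = (case i of 0 \<Rightarrow> pval ?q (Suc n) r | Suc j \<Rightarrow> g j)" for i
    have qr: "pval ?q (Suc n) r \<in> carrier R" using Suc.prems assms(2) by simp
    have h: "h i \<in> carrier R" for i using g(1) qr by (auto simp: h_def split: nat.split)
    have hv: "pval h (Suc n) x = pval ?q (Suc n) r \<oplus> x \<otimes> pval g n x" if "x \<in> carrier R" for x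
      using h that by (subst pval_shift) (auto simp: h_def)
    have "pval a (Suc (Suc n)) x \<ominus> pval a (Suc (Suc n)) r = (x \<ominus> r) \<otimes> pval h (Suc n) x"
      if x: "x \<in> carrier R" for x
    proof -
      define u where "u = pval ?q (Suc n) x"
      define v where "v = pval ?q (Suc n) r"
      define w where "w = pval g n x"
      have cl: "u \<in> carrier R" "v \<in> carrier R" "w \<in> carrier R" "a 0 \<in> carrier R"
        using x g(1) Suc.prems assms(2) by (auto simp: u_def v_def w_def)
      have uv: "u \<ominus> v = (x \<ominus> r) \<otimes> w" using g(2)[OF x] by (simp add: u_def v_def w_def)
      have "pval a (Suc (Suc n)) x \<ominus> pval a (Suc (Suc n)) r = (a 0 \<oplus> x \<otimes> u) \<ominus> (a 0 \<oplus> r \<otimes> v)"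
        unfolding u_def v_def using x Suc.prems assms(2) by (simp only: pval_shift[of a _ "Suc n"])
      also have "\<dots> = x \<otimes> (u \<ominus> v) \<oplus> (x \<ominus> r) \<otimes> v"
        using cl x assms(2) by algebra
      also have "\<dots> = (x \<ominus> r) \<otimes> (v \<oplus> x \<otimes> w)"
        unfolding uv using cl x assms(2) by algebra
      also have "\<dots> = (x \<ominus> r) \<otimes> pval h (Suc n) x"
        unfolding hv[OF x] v_def w_def ..
      finally show ?thesis .
    qed
    moreover have "pval h (Suc n) r = pval (pder a) (Suc n) r"
      unfolding hv[OF assms(2)] g(3) using Suc.prems assms(2) by (simp add: pval_pder_shift[of a])
    moreover have "h n = a (Suc n)"
    proof (cases n)
      case 0
      then show ?thesis using Suc.prems assms(2) by (simp add: h_def pval_Suc)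
    next
      case (Suc m)
      then show ?thesis using g(4) by (simp add: h_def)
    qed
    ultimately show ?case using h by (intro exI[of _ h]) auto
  qed
  then show thesis using that by blast
qed

text \<open>Reduces the behaviour at minus infinity to that at infinity.\<close>

lemma pval_reflect:
  assumes "\<And>i. a i \<in> carrier R" "x \<in> carrier R"
  shows "pval a n (\<ominus> x) = pval (\<lambda>i. (\<ominus> \<one>) [^] i \<otimes> a i) n x"
proof (induction n)
  case (Suc n)
  have "\<ominus> x = (\<ominus> \<one>) \<otimes> x" using assms by (simp add: l_minus)
  then have "(\<ominus> x) [^] n = (\<ominus> \<one>) [^] n \<otimes> x [^] n"
    using assms by (metis nat_pow_distrib one_closed a_inv_closed)
  moreover have cl: "(\<ominus> \<one>) [^] n \<in> carrier R" "x [^] n \<in> carrier R" "a n \<in> carrier R"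
    using assms by auto
  ultimately have "a n \<otimes> (\<ominus> x) [^] n = (\<ominus> \<one>) [^] n \<otimes> a n \<otimes> x [^] n"
    by (simp add: m_ac)
  then show ?case unfolding pval_Suc Suc by simp
qed simp

end

lemma (in domain) finite_pval_zeros:
  assumes "\<And>i. a i \<in> carrier R" "n > 0" "a (n - 1) \<noteq> \<zero>"
  shows "finite {x \<in> carrier R. pval a n x = \<zero>}"
  using assms
proof (induction n arbitrary: a)
  case (Suc n)
  show ?case
  proof (cases "\<exists>r\<in>carrier R. pval a (Suc n) r = \<zero>")
    case True
    then obtain r where r: "r \<in> carrier R" "pval a (Suc n) r = \<zero>" by blast
    show ?thesis
    proof (cases "n = 0")
      case True
      then show ?thesis using Suc.prems by (simp add: pval_Suc)
    next
      case False
      obtain g where g: "\<And>i. g i \<in> carrier R"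
        "\<And>x. x \<in> carrier R \<Longrightarrow> pval a (Suc n) x \<ominus> pval a (Suc n) r = (x \<ominus> r) \<otimes> pval g n x"
        "n > 0 \<Longrightarrow> g (n - 1) = a n"
        using pval_factor[of a r n] Suc.prems r(1) by metis
      have "{x \<in> carrier R. pval a (Suc n) x = \<zero>} \<subseteq> insert r {x \<in> carrier R. pval g n x = \<zero>}"
      proof
        fix x assume "x \<in> {x \<in> carrier R. pval a (Suc n) x = \<zero>}"
        then have x: "x \<in> carrier R" "pval a (Suc n) x = \<zero>" by auto
        then have "(x \<ominus> r) \<otimes> pval g n x = \<zero>" using g(2)[OF x(1)] r by (simp add: a_minus_def)
        then have "x \<ominus> r = \<zero> \<or> pval g n x = \<zero>" using g(1) x r by (simp add: integral_iff)
        then show "x \<in> insert r {x \<in> carrier R. pval g n x = \<zero>}" using x r by auto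
      qed
      moreover have "finite {x \<in> carrier R. pval g n x = \<zero>}"
        using Suc.IH[of g] g False Suc.prems(3) by simp
      ultimately show ?thesis using finite_subset by blast
    qed
  next
    case False
    then have "{x \<in> carrier R. pval a (Suc n) x = \<zero>} = {}" by auto
    then show ?thesis by (simp only: finite.emptyI)
  qed
qed simp

section \<open>Sign functions and intermediate values\<close>

text \<open>An ordering given by its sign function, so that sign conditions are equations between
  integers; \<open>sg_mult\<close> and \<open>sg_add\<close> play the role of the axioms of a
  positive cone.\<close>

locale sign_field = field R for R (structure) +
  fixes sg :: "'a \<Rightarrow> int"
  assumes sg_range: "x \<in> carrier R \<Longrightarrow> sg x = 0 \<or> sg x = 1 \<or> sg x = - 1"
    and sg_0_iff: "x \<in> carrier R \<Longrightarrow> sg x = 0 \<longleftrightarrow> x = \<zero>"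
    and sg_mult: "\<lbrakk> x \<in> carrier R; y \<in> carrier R \<rbrakk> \<Longrightarrow> sg (x \<otimes> y) = sg x * sg y"
    and sg_add: "\<lbrakk> x \<in> carrier R; y \<in> carrier R; sg x = 1; sg y \<noteq> - 1 \<rbrakk> \<Longrightarrow> sg (x \<oplus> y) = 1"
begin

lemma sg_zero [simp]: "sg \<zero> = 0"
  by (simp add: sg_0_iff)

lemma sg_one [simp]: "sg \<one> = 1"
proof -
  have "sg \<one> = sg \<one> * sg \<one>" using sg_mult[of \<one> \<one>] by simp
  moreover have "sg \<one> \<noteq> 0" by (simp add: sg_0_iff)
  ultimately show ?thesis by simp
qed

lemma sg_m1: "sg (\<ominus> \<one>) = - 1"
proof -
  have "sg (\<ominus> \<one>) \<noteq> 0" by (simp add: sg_0_iff)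
  moreover have "sg (\<ominus> \<one>) \<noteq> 1" using sg_add[of "\<ominus> \<one>" \<one>] by (auto simp: l_neg)
  ultimately show ?thesis using sg_range[of "\<ominus> \<one>"] by auto
qed

lemma sg_minus [simp]: "x \<in> carrier R \<Longrightarrow> sg (\<ominus> x) = - sg x"
  using sg_mult[of "\<ominus> \<one>" x] by (simp add: l_minus sg_m1)

lemma sg_diff_swap: "\<lbrakk> x \<in> carrier R; y \<in> carrier R \<rbrakk> \<Longrightarrow> sg (x \<ominus> y) = - sg (y \<ominus> x)"
  by (metis sg_minus a_minus_def minus_add minus_minus add.m_comm minus_closed a_inv_closed)

lemma sg_diff_0_iff: "\<lbrakk> x \<in> carrier R; y \<in> carrier R \<rbrakk> \<Longrightarrow> sg (x \<ominus> y) = 0 \<longleftrightarrow> x = y"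
  by (simp add: sg_0_iff)

lemma sg_diff_trans:
  assumes "x \<in> carrier R" "y \<in> carrier R" "z \<in> carrier R"
    and "sg (y \<ominus> x) = 1" "sg (z \<ominus> y) \<noteq> - 1"
  shows "sg (z \<ominus> x) = 1"
proof -
  have "z \<ominus> x = (y \<ominus> x) \<oplus> (z \<ominus> y)" using assms(1-3) by algebra
  then show ?thesis using sg_add assms by simp
qed

lemma sg_pow: "x \<in> carrier R \<Longrightarrow> sg (x [^] (n::nat)) = sg x ^ n"
  by (induction n) (auto simp: sg_mult)

lemma sg_add_same:
  assumes "x \<in> carrier R" "y \<in> carrier R" "sg x = s" "sg y = s \<or> sg y = 0"
  shows "sg (x \<oplus> y) = s"
proof -
  consider "s = 0" | "s = 1" | "s = - 1" using sg_range[OF assms(1)] assms(3) by auto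
  then show ?thesis
  proof cases
    case 1 then show ?thesis using assms by (auto simp: sg_0_iff)
  next
    case 2 then show ?thesis using assms sg_add by auto
  next
    case 3
    then have "sg (\<ominus> x \<oplus> \<ominus> y) = 1" using assms sg_add[of "\<ominus> x" "\<ominus> y"] by auto
    then have "sg (\<ominus> (x \<oplus> y)) = 1" using assms by (simp add: minus_add)
    then show ?thesis using assms 3 by simp
  qed
qed

lemma sg_add_pow: "x \<in> carrier R \<Longrightarrow> sg (add_pow R (Suc n) x) = sg x"
proof (induction n)
  case (Suc n)
  then have "add_pow R (Suc n) x \<in> carrier R" "add_pow R (Suc (Suc n)) x = add_pow R (Suc n) x \<oplus> x" by auto
  then show ?case using sg_add_same[of "add_pow R (Suc n) x" x "sg x"] Suc by simp
qed simp

lemma sg_inv: "x \<in> carrier R \<Longrightarrow> x \<noteq> \<zero> \<Longrightarrow> sg (inv x) = sg x"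
proof -
  assume x: "x \<in> carrier R" "x \<noteq> \<zero>"
  then have u: "x \<in> Units R" by (simp add: field_Units)
  then have "sg x * sg (inv x) = 1" using sg_mult[of x "inv x"] x by simp
  then show ?thesis using sg_range[OF x(1)] by auto
qed

lemma two_pos: "sg (\<one> \<oplus> \<one>) = 1"
  by (intro sg_add) auto

definition half :: 'a where "half = inv (\<one> \<oplus> \<one>)"

lemma half: "half \<in> carrier R" "sg half = 1" "half \<oplus> half = \<one>"
proof -
  have nz: "\<one> \<oplus> \<one> \<noteq> \<zero>" using two_pos by auto
  then have u: "\<one> \<oplus> \<one> \<in> Units R" by (simp add: field_Units)
  then show h: "half \<in> carrier R" by (simp add: half_def)
  show "sg half = 1" unfolding half_def using sg_inv[OF _ nz] two_pos by simp
  have "half \<oplus> half = half \<otimes> (\<one> \<oplus> \<one>)" using h by algebra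
  also have "\<dots> = \<one>" unfolding half_def using u by simp
  finally show "half \<oplus> half = \<one>" .
qed

lemma midpoint:
  assumes "x \<in> carrier R" "y \<in> carrier R" "sg (y \<ominus> x) = 1"
  shows "sg (half \<otimes> (x \<oplus> y) \<ominus> x) = 1" "sg (y \<ominus> half \<otimes> (x \<oplus> y)) = 1"
proof -
  have h: "half \<in> carrier R" "half \<oplus> half = \<one>" using half by auto
  have "(half \<otimes> (x \<oplus> y)) \<ominus> x = half \<otimes> (x \<oplus> y) \<ominus> (half \<oplus> half) \<otimes> x" using assms h(2) by simp
  also have "\<dots> = half \<otimes> (y \<ominus> x)" using assms h(1) by algebra
  finally show "sg (half \<otimes> (x \<oplus> y) \<ominus> x) = 1" using assms half by (simp add: sg_mult)
  have "y \<ominus> half \<otimes> (x \<oplus> y) = (half \<oplus> half) \<otimes> y \<ominus> half \<otimes> (x \<oplus> y)" using assms h(2) by simp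
  also have "\<dots> = half \<otimes> (y \<ominus> x)" using assms h(1) by algebra
  finally show "sg (y \<ominus> half \<otimes> (x \<oplus> y)) = 1" using assms half by (simp add: sg_mult)
qed

lemma half_in_subfield:
  assumes "subfield K R"
  shows "half \<in> K"
proof -
  have "\<one> \<oplus> \<one> \<in> K - {\<zero>}"
    using two_pos subringE(3,7)[OF subfieldE(1)[OF assms]] by auto
  then show ?thesis unfolding half_def using subfield_m_inv(1)[OF assms] by blast
qed

lemma sg_succ: "x \<in> carrier R \<Longrightarrow> sg ((x \<oplus> \<one>) \<ominus> x) = 1" "x \<in> carrier R \<Longrightarrow> sg (x \<ominus> (x \<ominus> \<one>)) = 1"
proof -
  assume x: "x \<in> carrier R"
  have "(x \<oplus> \<one>) \<ominus> x = \<one>" "x \<ominus> (x \<ominus> \<one>) = \<one>" using x by algebra+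
  then show "sg ((x \<oplus> \<one>) \<ominus> x) = 1" "sg (x \<ominus> (x \<ominus> \<one>)) = 1" by auto
qed

section \<open>Finite subsets of an ordered field\<close>

lemma finite_has_max:
  assumes "finite V" "V \<noteq> {}" "V \<subseteq> carrier R"
  obtains m where "m \<in> V" "\<And>x. x \<in> V \<Longrightarrow> x \<noteq> m \<Longrightarrow> sg (m \<ominus> x) = 1"
proof -
  have "\<exists>m\<in>V. \<forall>x\<in>V. x \<noteq> m \<longrightarrow> sg (m \<ominus> x) = 1"
    using assms
  proof (induction rule: finite_ne_induct)
    case (insert x V)
    then obtain m where m: "m \<in> V" "\<forall>y\<in>V. y \<noteq> m \<longrightarrow> sg (m \<ominus> y) = 1" by blast
    have cl: "x \<in> carrier R" "m \<in> carrier R" "V \<subseteq> carrier R" using insert m by auto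
    show ?case
    proof (cases "sg (x \<ominus> m) = 1")
      case True
      have "sg (x \<ominus> y) = 1" if "y \<in> V" for y
        using m(2) that True sg_diff_trans[of y m x] cl by (cases "y = m") auto
      then show ?thesis by auto
    next
      case False
      have "x \<noteq> m" using m insert by auto
      then have "sg (m \<ominus> x) = 1"
        using False sg_range[of "x \<ominus> m"] sg_diff_swap[of x m] sg_diff_0_iff cl by auto
      then show ?thesis using m by auto
    qed
  qed simp
  then show thesis using that by blast
qed

lemma finite_has_min:
  assumes "finite V" "V \<noteq> {}" "V \<subseteq> carrier R"
  obtains m where "m \<in> V" "\<And>x. x \<in> V \<Longrightarrow> x \<noteq> m \<Longrightarrow> sg (x \<ominus> m) = 1"
proof -
  have "finite ((\<lambda>x. \<ominus> x) ` V)" "(\<lambda>x. \<ominus> x) ` V \<noteq> {}" "(\<lambda>x. \<ominus> x) ` V \<subseteq> carrier R" using assms by auto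
  then obtain m where m: "m \<in> (\<lambda>x. \<ominus> x) ` V"
    "\<And>x. x \<in> (\<lambda>x. \<ominus> x) ` V \<Longrightarrow> x \<noteq> m \<Longrightarrow> sg (m \<ominus> x) = 1"
    using finite_has_max by metis
  then obtain n where n: "n \<in> V" "m = \<ominus> n" by auto
  have "sg (x \<ominus> n) = 1" if "x \<in> V" "x \<noteq> n" for x
  proof -
    have cl: "x \<in> carrier R" "n \<in> carrier R" using that n assms by auto
    have "sg (m \<ominus> (\<ominus> x)) = 1" using m(2)[of "\<ominus> x"] that n cl by (metis image_eqI minus_minus)
    moreover have "m \<ominus> (\<ominus> x) = x \<ominus> n" unfolding n(2) using cl by algebra
    ultimately show ?thesis by simp
  qed
  then show thesis using that n by blast
qed

text \<open>\<open>K\<close> is the whole field when diagrams are compared, and the smaller field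
  when a point is moved into it. The number 1/2 lies in every subfield, so one of max + 1, min - 1
  and the midpoint between max and min serves.\<close>

lemma finite_separate:
  assumes "subfield K R" "finite V" "finite Y" "V \<subseteq> K" "Y \<subseteq> K"
    and "\<And>x y. x \<in> V \<Longrightarrow> y \<in> Y \<Longrightarrow> sg (y \<ominus> x) = 1"
  shows "\<exists>z\<in>K. (\<forall>x\<in>V. sg (z \<ominus> x) = 1) \<and> (\<forall>y\<in>Y. sg (y \<ominus> z) = 1)"
proof -
  note K = subringE[OF subfieldE(1)[OF assms(1)]]
  have XY: "V \<subseteq> carrier R" "Y \<subseteq> carrier R" using assms(4,5) K(1) by auto
  show ?thesis
  proof (cases "V = {}"; cases "Y = {}")
    assume "V = {}" "Y = {}"
    then show ?thesis using K by auto
  next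
    assume "V = {}" "Y \<noteq> {}"
    then obtain m where m: "m \<in> Y" "\<And>x. x \<in> Y \<Longrightarrow> x \<noteq> m \<Longrightarrow> sg (x \<ominus> m) = 1"
      using finite_has_min[of Y] assms(3) XY by blast
    have cl: "m \<in> carrier R" using m XY by auto
    have "m \<ominus> \<one> \<in> K" using m assms(5) K by (auto simp: a_minus_def)
    moreover have "sg (y \<ominus> (m \<ominus> \<one>)) = 1" if "y \<in> Y" for y
      using m(2)[of y] that sg_succ(2)[OF cl] sg_diff_trans[of "m \<ominus> \<one>" m y] XY cl by (cases "y = m") auto
    ultimately show ?thesis using \<open>V = {}\<close> by auto
  next
    assume "V \<noteq> {}" "Y = {}"
    then obtain m where m: "m \<in> V" "\<And>x. x \<in> V \<Longrightarrow> x \<noteq> m \<Longrightarrow> sg (m \<ominus> x) = 1"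
      using finite_has_max[of V] assms(2) XY by blast
    have cl: "m \<in> carrier R" using m XY by auto
    have "m \<oplus> \<one> \<in> K" using m assms(4) K by auto
    moreover have "sg ((m \<oplus> \<one>) \<ominus> y) = 1" if "y \<in> V" for y
      using m(2)[of y] that sg_succ(1)[OF cl] sg_diff_trans[of y m "m \<oplus> \<one>"] XY cl by (cases "y = m") auto
    ultimately show ?thesis using \<open>Y = {}\<close> by auto
  next
    assume "V \<noteq> {}" "Y \<noteq> {}"
    then obtain m where m: "m \<in> V" "\<And>x. x \<in> V \<Longrightarrow> x \<noteq> m \<Longrightarrow> sg (m \<ominus> x) = 1"
      using finite_has_max[of V] assms(2) XY by blast
    obtain n where n: "n \<in> Y" "\<And>x. x \<in> Y \<Longrightarrow> x \<noteq> n \<Longrightarrow> sg (x \<ominus> n) = 1"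
      using finite_has_min[of Y] assms(3) XY \<open>Y \<noteq> {}\<close> by blast
    have cl: "m \<in> carrier R" "n \<in> carrier R" using m n XY by auto
    define z where "z = half \<otimes> (m \<oplus> n)"
    have zK: "z \<in> K" unfolding z_def
      using half_in_subfield[OF assms(1)] m(1) n(1) assms(4,5) by (intro K(6,7)) auto
    then have zc: "z \<in> carrier R" using K by auto
    have z: "sg (z \<ominus> m) = 1" "sg (n \<ominus> z) = 1"
      unfolding z_def using midpoint[OF cl] assms(6)[OF m(1) n(1)] by auto
    have "sg (z \<ominus> y) = 1" if "y \<in> V" for y
      using m(2)[of y] that z(1) sg_diff_trans[of y m z] XY cl zc by (cases "y = m") auto
    moreover have "sg (y \<ominus> z) = 1" if "y \<in> Y" for y
      using n(2)[of y] that z(2) sg_diff_trans[of z n y] XY cl zc by (cases "y = n") auto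
    ultimately show ?thesis using zK by auto
  qed
qed

text \<open>Mere positivity does not survive the step from q to a_0 + X q, since x q(x) has to
  outweigh a_0. Hence the induction proves a lower bound: with l the leading coefficient, l p(x) is
  at least some c > 0 beyond some \<open>N\<close>.\<close>

lemma sign_at_infinity:
  assumes "\<And>i. a i \<in> carrier R" "n > 0" "a (n - 1) \<noteq> \<zero>"
  obtains N where "N \<in> carrier R"
    "\<And>x. x \<in> carrier R \<Longrightarrow> sg (x \<ominus> N) = 1 \<Longrightarrow> sg (pval a n x) = sg (a (n - 1))"
proof -
  have "\<exists>c\<in>carrier R. \<exists>N\<in>carrier R. sg c = 1 \<and>
    (\<forall>x\<in>carrier R. sg (x \<ominus> N) = 1 \<longrightarrow> sg (a (n - 1) \<otimes> pval a n x \<ominus> c) \<noteq> - 1)"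
    using assms
  proof (induction n arbitrary: a)
    case (Suc n)
    show ?case
    proof (cases "n = 0")
      case True
      have "sg (a 0 \<otimes> a 0) = 1"
        using Suc.prems True sg_range[of "a 0"] sg_0_iff[of "a 0"] by (auto simp: sg_mult)
      then show ?thesis using Suc.prems(1)[of 0] True
        by (intro bexI[of _ "a 0 \<otimes> a 0"] bexI[of _ \<zero>]) (auto simp: pval_Suc a_minus_def r_neg)
    next
      case False
      let ?q = "\<lambda>i. a (Suc i)"
      define l where "l = a n"
      have "?q (n - 1) = l" using False by (simp add: l_def)
      then obtain c N where c: "c \<in> carrier R" "N \<in> carrier R" "sg c = 1"
        "\<And>x. x \<in> carrier R \<Longrightarrow> sg (x \<ominus> N) = 1 \<Longrightarrow> sg (l \<otimes> pval ?q n x \<ominus> c) \<noteq> - 1"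
        using Suc.IH[of ?q] Suc.prems False by (force simp: l_def)
      have cl: "a 0 \<in> carrier R" "l \<in> carrier R" using Suc.prems by (auto simp: l_def)
      have cu: "c \<in> Units R" using c by (auto simp: field_Units)
      \<comment> \<open>The new bound is 1: with this \<open>b\<close>, l p(x) - 1 = c (x - b) + x
        (l q(x) - c), where beyond \<open>b\<close>, \<open>N\<close> and 0 the first summand is
        positive and the second not negative.\<close>
      define b where "b = inv c \<otimes> (\<one> \<ominus> l \<otimes> a 0)"
      have b: "b \<in> carrier R" "c \<otimes> b = \<one> \<ominus> l \<otimes> a 0"
        using cl c cu by (auto simp: b_def m_assoc[symmetric])
      have "\<exists>M\<in>carrier R. (\<forall>x\<in>{b, N, \<zero>}. sg (M \<ominus> x) = 1) \<and> (\<forall>y\<in>{}. sg (y \<ominus> M) = 1)"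
        using b c by (intro finite_separate carrier_is_subfield) auto
      then obtain M where M: "M \<in> carrier R" "\<And>x. x \<in> {b, N, \<zero>} \<Longrightarrow> sg (M \<ominus> x) = 1"
        by blast
      have "sg (l \<otimes> pval a (Suc n) x \<ominus> \<one>) \<noteq> - 1" if x: "x \<in> carrier R" "sg (x \<ominus> M) = 1" for x
      proof -
        have gt: "sg (x \<ominus> y) = 1" if "y \<in> {b, N, \<zero>}" for y
          using sg_diff_trans[of y M x] M that x b c by auto
        define w where "w = pval ?q n x"
        have w: "w \<in> carrier R" using Suc.prems x by (simp add: w_def)
        have e: "pval a (Suc n) x = a 0 \<oplus> x \<otimes> w"
          unfolding w_def using Suc.prems x by (simp add: pval_shift)
        have "l \<otimes> (a 0 \<oplus> x \<otimes> w) \<ominus> \<one> = c \<otimes> x \<ominus> (\<one> \<ominus> l \<otimes> a 0) \<oplus> x \<otimes> (l \<otimes> w \<ominus> c)"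
          using cl x(1) w c(1) by algebra
        also have "\<dots> = c \<otimes> (x \<ominus> b) \<oplus> x \<otimes> (l \<otimes> w \<ominus> c)"
          unfolding b(2)[symmetric] using cl x(1) w c(1) b(1) by algebra
        finally have eq: "l \<otimes> pval a (Suc n) x \<ominus> \<one> = c \<otimes> (x \<ominus> b) \<oplus> x \<otimes> (l \<otimes> w \<ominus> c)"
          using e by simp
        have "sg (x \<ominus> \<zero>) = 1" "sg (x \<ominus> b) = 1" "sg (x \<ominus> N) = 1" using gt by auto
        then have "sg x = 1" "sg (c \<otimes> (x \<ominus> b)) = 1" "sg (l \<otimes> w \<ominus> c) \<noteq> - 1"
          using x c b unfolding w_def by (auto simp: a_minus_def sg_mult)
        then have "sg (c \<otimes> (x \<ominus> b) \<oplus> x \<otimes> (l \<otimes> w \<ominus> c)) = 1"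
          using cl x w c b by (intro sg_add) (auto simp: sg_mult)
        then show ?thesis unfolding eq by simp
      qed
      then show ?thesis using M(1) by (intro bexI[of _ \<one>] bexI[of _ M]) (auto simp: l_def)
    qed
  qed simp
  then obtain c N where c: "c \<in> carrier R" "N \<in> carrier R" "sg c = 1"
    "\<And>x. x \<in> carrier R \<Longrightarrow> sg (x \<ominus> N) = 1 \<Longrightarrow> sg (a (n - 1) \<otimes> pval a n x \<ominus> c) \<noteq> - 1"
    by blast
  have "sg (pval a n x) = sg (a (n - 1))" if x: "x \<in> carrier R" "sg (x \<ominus> N) = 1" for x
  proof -
    define w where "w = a (n - 1) \<otimes> pval a n x"
    have w: "w \<in> carrier R" using assms(1) x by (simp add: w_def)
    have "w = c \<oplus> (w \<ominus> c)" using w c(1) by algebra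
    then have "sg w = 1" using sg_add[of c "w \<ominus> c"] c(4)[OF x] w c unfolding w_def by auto
    then show ?thesis unfolding w_def using assms(1) x sg_range[of "pval a n x"] sg_range[of "a (n - 1)"]
      by (auto simp: sg_mult)
  qed
  then show thesis using that c by blast
qed

lemma sign_at_minus_infinity:
  assumes "\<And>i. a i \<in> carrier R" "n > 0" "a (n - 1) \<noteq> \<zero>"
  obtains N where "N \<in> carrier R"
    "\<And>x. x \<in> carrier R \<Longrightarrow> sg (N \<ominus> x) = 1 \<Longrightarrow> sg (pval a n x) = (- 1) ^ (n - 1) * sg (a (n - 1))"
proof -
  let ?b = "\<lambda>i. (\<ominus> \<one>) [^] i \<otimes> a i"
  have "sg (?b (n - 1)) = (- 1) ^ (n - 1) * sg (a (n - 1))"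
    using assms(1) by (simp add: sg_mult sg_pow sg_m1)
  moreover have "?b (n - 1) \<noteq> \<zero>" using calculation assms sg_0_iff[of "a (n - 1)"]
    by (metis power_eq_0_iff mult_eq_0_iff sg_zero neg_equal_0_iff_equal zero_neq_one)
  ultimately obtain N where N: "N \<in> carrier R" "\<And>x. x \<in> carrier R \<Longrightarrow> sg (x \<ominus> N) = 1 \<Longrightarrow>
      sg (pval ?b n x) = (- 1) ^ (n - 1) * sg (a (n - 1))"
    using sign_at_infinity[of ?b n] assms by (metis (no_types, lifting) a_inv_closed m_closed nat_pow_closed one_closed)
  have "sg (pval a n x) = (- 1) ^ (n - 1) * sg (a (n - 1))"
    if x: "x \<in> carrier R" "sg ((\<ominus> N) \<ominus> x) = 1" for x
  proof -
    have "(\<ominus> N) \<ominus> x = (\<ominus> x) \<ominus> N" using N(1) x(1) by algebra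
    then have "sg (pval ?b n (\<ominus> x)) = (- 1) ^ (n - 1) * sg (a (n - 1))" using N(2)[of "\<ominus> x"] x by auto
    moreover have "pval ?b n (\<ominus> x) = pval a n x"
      using pval_reflect[of a "\<ominus> x" n] assms(1) x(1) by simp
    ultimately show ?thesis by simp
  qed
  then show thesis using that[of "\<ominus> N"] N(1) by blast
qed

section \<open>The strict order of the sign function\<close>

abbreviation prec :: "'a \<Rightarrow> 'a \<Rightarrow> bool" (infix \<open>\<ll>\<close> 50)
  where "x \<ll> y \<equiv> sg (y \<ominus> x) = 1"

lemma prec_trans: "\<lbrakk> x \<in> carrier R; y \<in> carrier R; z \<in> carrier R; x \<ll> y; y \<ll> z \<rbrakk> \<Longrightarrow> x \<ll> z"
  using sg_diff_trans[of x y z] by simp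

lemma prec_irrefl [simp]: "x \<in> carrier R \<Longrightarrow> \<not> x \<ll> x"
  by (simp add: a_minus_def r_neg)

lemma prec_asym: "\<lbrakk> x \<in> carrier R; y \<in> carrier R; x \<ll> y \<rbrakk> \<Longrightarrow> \<not> y \<ll> x"
  using sg_diff_swap[of x y] by simp

lemma prec_cases:
  assumes "x \<in> carrier R" "y \<in> carrier R"
  obtains "x \<ll> y" | "x = y" | "y \<ll> x"
proof -
  consider "sg (y \<ominus> x) = 0" | "sg (y \<ominus> x) = 1" | "sg (y \<ominus> x) = - 1"
    using sg_range[of "y \<ominus> x"] assms by auto
  then show thesis
  proof cases
    case 1 then show thesis using that(2) sg_diff_0_iff assms by simp
  next
    case 2 then show thesis using that(1) by simp
  next
    case 3 then show thesis using that(3) sg_diff_swap[of x y] assms by simp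
  qed
qed

lemma prec_dense:
  assumes "x \<in> carrier R" "y \<in> carrier R" "x \<ll> y"
  obtains z where "z \<in> carrier R" "x \<ll> z" "z \<ll> y"
  using that[of "half \<otimes> (x \<oplus> y)"] midpoint[of x y] assms half(1) by simp

text \<open>By density a nonempty open interval has no greatest element, so it cannot consist of the
  finitely many zeros.\<close>

lemma pval_sign_nonzero_between:
  assumes "\<And>i. a i \<in> carrier R" "n > 0" "a (n - 1) \<noteq> \<zero>"
    and "u \<in> carrier R" "v \<in> carrier R" "u \<ll> v"
  shows "\<exists>x\<in>carrier R. u \<ll> x \<and> x \<ll> v \<and> pval a n x \<noteq> \<zero>"
proof (rule ccontr)
  assume "\<not> ?thesis"
  then have z: "pval a n x = \<zero>" if "x \<in> carrier R" "u \<ll> x" "x \<ll> v" for x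
    using that by blast
  let ?V = "{x \<in> carrier R. u \<ll> x \<and> x \<ll> v}"
  have fin: "finite ?V"
    by (rule finite_subset[OF _ finite_pval_zeros[of a n]]) (use assms z in auto)
  obtain w where w: "w \<in> ?V" using prec_dense[of u v] assms by blast
  then obtain m where m: "m \<in> ?V" "\<And>x. x \<in> ?V \<Longrightarrow> x \<noteq> m \<Longrightarrow> x \<ll> m"
    using finite_has_max[of ?V] fin by blast
  obtain t where t: "t \<in> carrier R" "m \<ll> t" "t \<ll> v" using prec_dense[of m v] m assms by blast
  have "t \<in> ?V" using t m prec_trans[of u m t] assms by auto
  then have "t \<ll> m" using m(2)[of t] t m(1) by auto
  then show False using t m prec_asym[of m t] by auto
qed

end

section \<open>Consequences of the intermediate value property\<close>

locale ivt_field = sign_field +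
  assumes ivt: "\<lbrakk> \<And>i. a i \<in> carrier R; x \<in> carrier R; y \<in> carrier R; x \<ll> y;
      sg (pval a n x) * sg (pval a n y) = - 1 \<rbrakk> \<Longrightarrow>
    \<exists>z\<in>carrier R. x \<ll> z \<and> z \<ll> y \<and> pval a n z = \<zero>"
begin

lemma pval_sign_constant:
  assumes "\<And>i. a i \<in> carrier R" "x \<in> carrier R" "y \<in> carrier R" "x \<ll> y"
    and "\<And>z. \<lbrakk> z \<in> carrier R; x \<ll> z; z \<ll> y \<rbrakk> \<Longrightarrow> pval a n z \<noteq> \<zero>"
    and "sg (pval a n x) = s" "s = 1 \<or> s = - 1" "pval a n y \<noteq> \<zero>"
  shows "sg (pval a n y) = s"
  using ivt[of a x y n] assms sg_range[of "pval a n y"] sg_0_iff[of "pval a n y"] by fastforce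

text \<open>Let \<open>z\<close> be the first zero after \<open>b\<close> of the difference quotient at \<open>b\<close>, so \<open>p z = p b\<close>.
  Between \<open>b\<close> and \<open>z\<close> the difference quotients at \<open>b\<close> and at \<open>z\<close> both keep the sign of the derivative,
  hence \<open>p m - p b = p m - p z\<close> would have opposite signs.\<close>

lemma strict_mono_between:
  assumes a: "\<And>i. a i \<in> carrier R" and s: "s = 1 \<or> s = - 1"
    and uv: "u \<in> carrier R" "v \<in> carrier R"
    and der: "\<And>x. \<lbrakk> x \<in> carrier R; u \<ll> x; x \<ll> v \<rbrakk> \<Longrightarrow> sg (pval (pder a) n x) = s"
    and bc: "b \<in> carrier R" "c \<in> carrier R" "u \<ll> b" "b \<ll> c" "c \<ll> v"
  shows "sg (pval a (Suc n) c \<ominus> pval a (Suc n) b) = s"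
proof (rule ccontr)
  let ?p = "pval a (Suc n)"
  assume neg: "sg (?p c \<ominus> ?p b) \<noteq> s"
  have bv: "b \<ll> v" using prec_trans bc uv by blast
  obtain g where g: "\<And>i. g i \<in> carrier R"
    "\<And>x. x \<in> carrier R \<Longrightarrow> ?p x \<ominus> ?p b = (x \<ominus> b) \<otimes> pval g n x"
    "pval g n b = pval (pder a) n b"
    using pval_factor[of a b n] a bc(1) by metis
  have gb: "sg (pval g n b) = s" using g(3) der bc bv by simp
  \<comment> \<open>The zeros of the difference quotient in (b, c]. At \<open>b\<close> the quotient
    has the sign \<open>s\<close>, at \<open>c\<close> by assumption it has not, so
    \<open>ivt\<close> finds a zero unless \<open>c\<close> is one itself.\<close>
  let ?V = "{x \<in> carrier R. b \<ll> x \<and> (x \<ll> c \<or> x = c) \<and> pval g n x = \<zero>}"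
  have "?V \<noteq> {}"
  proof (cases "pval g n c = \<zero>")
    case True
    then show ?thesis using bc by auto
  next
    case False
    have "sg (pval g n c) \<noteq> s" using neg g(2)[OF bc(2)] g(1) bc by (simp add: sg_mult)
    then have "sg (pval g n b) * sg (pval g n c) = - 1"
      using gb s False g(1) bc sg_range[of "pval g n c"] sg_0_iff[of "pval g n c"] by auto
    then show ?thesis using ivt[of g b c n] g(1) bc by blast
  qed
  moreover have "finite ?V"
  proof -
    have "finite {x \<in> carrier R. pval g n x = \<zero>}"
    proof -
      \<comment> \<open>Vanishing top coefficients are cut off, as the finiteness of the zeros asks
        for a nonzero one. The quotient does not vanish at \<open>b\<close>, so some coefficient
        remains.\<close>
      have "\<exists>m\<le>n. m > 0 \<and> g (m - 1) \<noteq> \<zero> \<and> (\<forall>x\<in>carrier R. pval g n x = pval g m x)"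
        if "pval g n b \<noteq> \<zero>"
        using that
      proof (induction n)
        case (Suc k)
        show ?case
        proof (cases "g k = \<zero>")
          case True
          then have "pval g (Suc k) x = pval g k x" if "x \<in> carrier R" for x
            using that g(1) by (simp add: pval_Suc)
          then show ?thesis using Suc bc(1) by (metis le_SucI)
        qed auto
      qed simp
      moreover have "pval g n b \<noteq> \<zero>" using gb s by auto
      ultimately obtain m where "m > 0" "g (m - 1) \<noteq> \<zero>" "\<forall>x\<in>carrier R. pval g n x = pval g m x" by blast
      then show ?thesis using finite_pval_zeros[of g m] g(1) by (simp cong: conj_cong)
    qed
    then show ?thesis by (rule rev_finite_subset) auto
  qed
  ultimately obtain z where z: "z \<in> ?V" "\<And>x. x \<in> ?V \<Longrightarrow> x \<noteq> z \<Longrightarrow> z \<ll> x"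
    using finite_has_min[of ?V] by blast
  have zc: "z \<in> carrier R" "b \<ll> z" "pval g n z = \<zero>" "z \<ll> c \<or> z = c" using z(1) by blast+
  then have uzv: "u \<ll> z" "z \<ll> v" using prec_trans[of u b z] prec_trans[of z c v] bc uv by metis+
  have gnz: "pval g n x \<noteq> \<zero>" if "x \<in> carrier R" "b \<ll> x" "x \<ll> z" for x
  proof
    assume "pval g n x = \<zero>"
    moreover have "x \<ll> c" using z(1) that prec_trans[of x z c] bc by auto
    ultimately have "x \<in> ?V" using that by auto
    moreover have "x \<noteq> z" using that by auto
    ultimately have "z \<ll> x" using z(2) by blast
    then show False using that prec_asym[of x z] zc by blast
  qed
  have pz: "?p z = ?p b"
  proof -
    have "?p z \<ominus> ?p b = \<zero>" using g(2)[OF zc(1)] zc(1,3) bc(1) by simp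
    then show ?thesis using a zc(1) bc(1) by (simp add: r_right_minus_eq)
  qed
  obtain m where m: "m \<in> carrier R" "b \<ll> m" "m \<ll> z" using prec_dense[of b z] zc bc by blast
  have "sg (pval g n m) = s"
    by (rule pval_sign_constant[of g b m n]) (use g m gb s gnz bc zc prec_trans[of _ m z] in auto)
  then have m1: "sg (?p m \<ominus> ?p b) = s" using g(1) g(2)[OF m(1)] m bc by (simp add: sg_mult)
  obtain k where k: "\<And>i. k i \<in> carrier R"
    "\<And>x. x \<in> carrier R \<Longrightarrow> ?p x \<ominus> ?p z = (x \<ominus> z) \<otimes> pval k n x"
    "pval k n z = pval (pder a) n z"
    using pval_factor[of a z n] a zc(1) by metis
  have kz: "sg (pval k n z) = s" using k(3) der[OF zc(1) uzv] by simp
  have knz: "pval k n x \<noteq> \<zero>" if "x \<in> carrier R" "b \<ll> x" "x \<ll> z" for x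
  proof
    assume "pval k n x = \<zero>"
    then have "?p x \<ominus> ?p b = \<zero>" using k(2)[OF that(1)] that zc unfolding pz by simp
    then have "(x \<ominus> b) \<otimes> pval g n x = \<zero>" using g(2)[OF that(1)] by simp
    moreover have "x \<ominus> b \<noteq> \<zero>" using that by auto
    ultimately show False using gnz[OF that] that g(1) bc by (simp add: integral_iff)
  qed
  have "sg (pval k n m) = s"
  proof (rule ccontr)
    assume "sg (pval k n m) \<noteq> s"
    then have "sg (pval k n m) * sg (pval k n z) = - 1"
      using kz s knz[OF m] k(1) m sg_range[of "pval k n m"] sg_0_iff[of "pval k n m"] by auto
    then obtain t where "t \<in> carrier R" "m \<ll> t" "t \<ll> z" "pval k n t = \<zero>"
      using ivt[of k m z n] k(1) m zc by blast
    then show False using knz[of t] prec_trans[of b m t] m bc by blast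
  qed
  then have "sg (?p m \<ominus> ?p z) = - s"
    using k(1) k(2)[OF m(1)] m zc sg_diff_swap[of m z] by (simp add: sg_mult)
  then show False using m1 s unfolding pz by auto
qed

text \<open>Monotonicity is available strictly inside (u, v), and if p(u) = 0 there is no sign
  change at \<open>u\<close> to start from. So a level between 0 and p(t) is used: if the claim
  fails at \<open>w\<close>, p has the sign -s at some \<open>t\<close> before \<open>w\<close>, and
  \<open>ivt\<close> finds z < t with p(z) = c = p(t) / 2. Then p(t) - p(z) = c has the sign -s,
  against monotonicity.\<close>

lemma sign_right_of:
  assumes a: "\<And>i. a i \<in> carrier R" and s: "s = 1 \<or> s = - 1"
    and uv: "u \<in> carrier R" "v \<in> carrier R"
    and der: "\<And>x. \<lbrakk> x \<in> carrier R; u \<ll> x; x \<ll> v \<rbrakk> \<Longrightarrow> sg (pval (pder a) n x) = s"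
    and w: "w \<in> carrier R" "u \<ll> w" "w \<ll> v"
    and su: "sg (pval a (Suc n) u) \<noteq> - s"
  shows "sg (pval a (Suc n) w) = s"
proof (rule ccontr)
  let ?p = "pval a (Suc n)"
  assume neg: "sg (?p w) \<noteq> s"
  have p [simp]: "?p x \<in> carrier R" if "x \<in> carrier R" for x using a that by simp
  obtain t where t: "t \<in> carrier R" "u \<ll> t" "t \<ll> w" using prec_dense[of u w] w uv by blast
  have "sg (?p w \<ominus> ?p t) = s" by (rule strict_mono_between[OF a s uv der]) (use t w in auto)
  then have "sg (?p t \<ominus> ?p w) = - s" using sg_diff_swap[of "?p t" "?p w"] t w by simp
  moreover have "?p t = (?p t \<ominus> ?p w) \<oplus> ?p w" using p[OF t(1)] p[OF w(1)] by algebra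
  ultimately have pt: "sg (?p t) = - s"
    using sg_add_same[of "?p t \<ominus> ?p w" "?p w" "- s"] neg s sg_range[of "?p w"] t w by auto
  define c where "c = half \<otimes> ?p t"
  have c: "c \<in> carrier R" "sg c = - s" "c \<oplus> c = ?p t"
  proof -
    show "c \<in> carrier R" "sg c = - s" using half pt t by (auto simp: c_def sg_mult)
    have "c \<oplus> c = (half \<oplus> half) \<otimes> ?p t" unfolding c_def using half(1) p[OF t(1)] by algebra
    then show "c \<oplus> c = ?p t" using half t by simp
  qed
  let ?b = "a(0 := a 0 \<oplus> \<ominus> c)"
  have bcl: "?b i \<in> carrier R" for i using a c by auto
  have b: "pval ?b (Suc n) x = ?p x \<ominus> c" if "x \<in> carrier R" for x
    using pval_const_add[of a "\<ominus> c" x "Suc n"] a c that by (simp add: a_minus_def)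
  have "?p t \<ominus> c = c" unfolding c(3)[symmetric] using c(1) by algebra
  then have "sg (pval ?b (Suc n) t) = - s" using b t c by simp
  moreover have "sg (pval ?b (Suc n) u) = s"
  proof -
    have "?p u \<ominus> c = (\<ominus> c) \<oplus> ?p u" using c(1) p[OF uv(1)] by algebra
    moreover have "sg (?p u) = s \<or> sg (?p u) = 0" using su s sg_range[of "?p u"] uv by auto
    ultimately show ?thesis using sg_add_same[of "\<ominus> c" "?p u" s] c b uv by simp
  qed
  ultimately obtain z where z: "z \<in> carrier R" "u \<ll> z" "z \<ll> t" "pval ?b (Suc n) z = \<zero>"
    using ivt[of ?b u t "Suc n"] bcl t uv s by auto
  then have "?p z = c" using b[OF z(1)] c by simp
  moreover have "sg (?p t \<ominus> ?p z) = s"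
    by (rule strict_mono_between[OF a s uv der]) (use t z w prec_trans[of t w v] uv in auto)
  ultimately have "sg c = s" using \<open>?p t \<ominus> c = c\<close> by simp
  then show False using c s by auto
qed

text \<open>The mirror image of \<open>sign_right_of\<close>; the level is half of the value at a
  point \<open>t\<close> between \<open>w\<close> and \<open>v\<close>.\<close>

lemma sign_left_of:
  assumes a: "\<And>i. a i \<in> carrier R" and s: "s = 1 \<or> s = - 1"
    and uv: "u \<in> carrier R" "v \<in> carrier R"
    and der: "\<And>x. \<lbrakk> x \<in> carrier R; u \<ll> x; x \<ll> v \<rbrakk> \<Longrightarrow> sg (pval (pder a) n x) = s"
    and w: "w \<in> carrier R" "u \<ll> w" "w \<ll> v"
    and sv: "sg (pval a (Suc n) v) \<noteq> s"
  shows "sg (pval a (Suc n) w) = - s"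
proof (rule ccontr)
  let ?p = "pval a (Suc n)"
  assume neg: "sg (?p w) \<noteq> - s"
  have p [simp]: "?p x \<in> carrier R" if "x \<in> carrier R" for x using a that by simp
  obtain t where t: "t \<in> carrier R" "w \<ll> t" "t \<ll> v" using prec_dense[of w v] w uv by blast
  have "sg (?p t \<ominus> ?p w) = s" by (rule strict_mono_between[OF a s uv der]) (use t w in auto)
  moreover have "?p t = (?p t \<ominus> ?p w) \<oplus> ?p w" using p[OF t(1)] p[OF w(1)] by algebra
  ultimately have pt: "sg (?p t) = s"
    using sg_add_same[of "?p t \<ominus> ?p w" "?p w" s] neg s sg_range[of "?p w"] t w by auto
  define c where "c = half \<otimes> ?p t"
  have c: "c \<in> carrier R" "sg c = s" "c \<oplus> c = ?p t"
  proof -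
    show "c \<in> carrier R" "sg c = s" using half pt t by (auto simp: c_def sg_mult)
    have "c \<oplus> c = (half \<oplus> half) \<otimes> ?p t" unfolding c_def using half(1) p[OF t(1)] by algebra
    then show "c \<oplus> c = ?p t" using half t by simp
  qed
  let ?b = "a(0 := a 0 \<oplus> \<ominus> c)"
  have bcl: "?b i \<in> carrier R" for i using a c by auto
  have b: "pval ?b (Suc n) x = ?p x \<ominus> c" if "x \<in> carrier R" for x
    using pval_const_add[of a "\<ominus> c" x "Suc n"] a c that by (simp add: a_minus_def)
  have tc: "?p t \<ominus> c = c" unfolding c(3)[symmetric] using c(1) by algebra
  then have "sg (pval ?b (Suc n) t) = s" using b t c by simp
  moreover have "sg (pval ?b (Suc n) v) = - s"
  proof -
    have "?p v \<ominus> c = (\<ominus> c) \<oplus> ?p v" using c(1) p[OF uv(2)] by algebra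
    moreover have "sg (?p v) = - s \<or> sg (?p v) = 0" using sv s sg_range[of "?p v"] uv by auto
    ultimately show ?thesis using sg_add_same[of "\<ominus> c" "?p v" "- s"] c b uv by simp
  qed
  ultimately obtain z where z: "z \<in> carrier R" "t \<ll> z" "z \<ll> v" "pval ?b (Suc n) z = \<zero>"
    using ivt[of ?b t v "Suc n"] bcl t uv s by auto
  then have "?p z = c" using b[OF z(1)] c by simp
  moreover have "sg (?p z \<ominus> ?p t) = s"
    by (rule strict_mono_between[OF a s uv der]) (use t z w prec_trans[of u w t] uv in auto)
  moreover have "sg (?p z \<ominus> ?p t) = - sg (?p t \<ominus> ?p z)"
    by (rule sg_diff_swap) (use a z t in auto)
  ultimately have "sg c = - s" using tc by simp
  then show False using c s by auto
qed

end

section \<open>Matching sign diagrams\<close>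

context sign_field
begin

lemma common_sign_at_infinity:
  assumes "finite S" "\<And>j i. A j i \<in> carrier R" "\<And>j. \<lbrakk> j \<in> S; k j > 0 \<rbrakk> \<Longrightarrow> A j (k j - 1) \<noteq> \<zero>"
    and "finite V" "V \<subseteq> carrier R"
  shows "\<exists>u\<in>carrier R. (\<forall>v\<in>V. v \<ll> u) \<and>
    (\<forall>j\<in>S. sg (pval (A j) (k j) u) = (if k j = 0 then 0 else sg (A j (k j - 1))))"
proof -
  have "\<exists>N\<in>carrier R. \<forall>x\<in>carrier R. N \<ll> x \<longrightarrow>
      sg (pval (A j) (k j) x) = (if k j = 0 then 0 else sg (A j (k j - 1)))" if j: "j \<in> S" for j
  proof (cases "k j = 0")
    case False
    then obtain N where "N \<in> carrier R"
      "\<And>x. x \<in> carrier R \<Longrightarrow> N \<ll> x \<Longrightarrow> sg (pval (A j) (k j) x) = sg (A j (k j - 1))"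
      using sign_at_infinity[of "A j" "k j"] assms(2,3) j by blast
    then show ?thesis using False by auto
  qed auto
  then obtain N where N: "\<And>j. j \<in> S \<Longrightarrow> N j \<in> carrier R"
    "\<And>j x. \<lbrakk> j \<in> S; x \<in> carrier R; N j \<ll> x \<rbrakk> \<Longrightarrow>
      sg (pval (A j) (k j) x) = (if k j = 0 then 0 else sg (A j (k j - 1)))"
    by metis
  have fin: "finite (V \<union> N ` S)" "V \<union> N ` S \<subseteq> carrier R" using assms N(1) by auto
  have "\<exists>u\<in>carrier R. (\<forall>v\<in>V \<union> N ` S. v \<ll> u) \<and> (\<forall>v\<in>{}. u \<ll> v)"
    by (rule finite_separate[OF carrier_is_subfield fin(1) finite.emptyI fin(2) empty_subsetI]) auto
  then obtain u where "u \<in> carrier R" "\<And>v. v \<in> V \<union> N ` S \<Longrightarrow> v \<ll> u"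
    by blast
  then show ?thesis using N(2) by (intro bexI[of _ u]) auto
qed

lemma common_sign_at_minus_infinity:
  assumes "finite S" "\<And>j i. A j i \<in> carrier R" "\<And>j. \<lbrakk> j \<in> S; k j > 0 \<rbrakk> \<Longrightarrow> A j (k j - 1) \<noteq> \<zero>"
    and "finite V" "V \<subseteq> carrier R"
  shows "\<exists>u\<in>carrier R. (\<forall>v\<in>V. u \<ll> v) \<and>
    (\<forall>j\<in>S. sg (pval (A j) (k j) u) = (if k j = 0 then 0 else (- 1) ^ (k j - 1) * sg (A j (k j - 1))))"
proof -
  have "\<exists>N\<in>carrier R. \<forall>x\<in>carrier R. x \<ll> N \<longrightarrow>
      sg (pval (A j) (k j) x) = (if k j = 0 then 0 else (- 1) ^ (k j - 1) * sg (A j (k j - 1)))"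
    if j: "j \<in> S" for j
  proof (cases "k j = 0")
    case False
    then obtain N where "N \<in> carrier R"
      "\<And>x. x \<in> carrier R \<Longrightarrow> x \<ll> N \<Longrightarrow> sg (pval (A j) (k j) x) = (- 1) ^ (k j - 1) * sg (A j (k j - 1))"
      using sign_at_minus_infinity[of "A j" "k j"] assms(2,3) j by blast
    then show ?thesis using False by auto
  qed auto
  then obtain N where N: "\<And>j. j \<in> S \<Longrightarrow> N j \<in> carrier R"
    "\<And>j x. \<lbrakk> j \<in> S; x \<in> carrier R; x \<ll> N j \<rbrakk> \<Longrightarrow>
      sg (pval (A j) (k j) x) = (if k j = 0 then 0 else (- 1) ^ (k j - 1) * sg (A j (k j - 1)))"
    by metis
  have fin: "finite (V \<union> N ` S)" "V \<union> N ` S \<subseteq> carrier R" using assms N(1) by auto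
  have "\<exists>u\<in>carrier R. (\<forall>v\<in>{}. v \<ll> u) \<and> (\<forall>v\<in>V \<union> N ` S. u \<ll> v)"
    by (rule finite_separate[OF carrier_is_subfield finite.emptyI fin(1) empty_subsetI fin(2)]) auto
  then obtain u where "u \<in> carrier R" "\<And>v. v \<in> V \<union> N ` S \<Longrightarrow> u \<ll> v"
    by blast
  then show ?thesis using N(2) by (intro bexI[of _ u]) auto
qed

section \<open>Order isomorphisms between finite sets of points\<close>

text \<open>The pairs in \<open>Z\<close> match roots for one list of polynomials with roots for another one; \<open>x\<close> and \<open>y\<close> have to
  lie in the same position relative to these.\<close>

definition same_cut :: "('a \<times> 'a) set \<Rightarrow> 'a \<Rightarrow> 'a \<Rightarrow> bool"
  where "same_cut Z x y \<longleftrightarrow> (\<forall>(\<xi>, \<eta>)\<in>Z. sg (x \<ominus> \<xi>) = sg (y \<ominus> \<eta>))"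

text \<open>The graph of an order isomorphism between two finite sets: any two first components
  compare like the corresponding second ones, which also makes both projections injective.\<close>

definition partial_iso :: "('a \<times> 'a) set \<Rightarrow> bool"
  where "partial_iso Z \<longleftrightarrow> finite Z \<and> Z \<subseteq> carrier R \<times> carrier R \<and> (\<forall>(\<xi>, \<eta>)\<in>Z. same_cut Z \<xi> \<eta>)"

lemma same_cutD: "\<lbrakk> same_cut Z x y; (\<xi>, \<eta>) \<in> Z \<rbrakk> \<Longrightarrow> sg (x \<ominus> \<xi>) = sg (y \<ominus> \<eta>)"
  unfolding same_cut_def by auto

lemma same_cut_mono: "\<lbrakk> same_cut Z' x y; Z \<subseteq> Z' \<rbrakk> \<Longrightarrow> same_cut Z x y"
  unfolding same_cut_def by blast

lemma partial_isoD: "\<lbrakk> partial_iso Z; (\<xi>, \<eta>) \<in> Z \<rbrakk> \<Longrightarrow> \<xi> \<in> carrier R \<and> \<eta> \<in> carrier R \<and> same_cut Z \<xi> \<eta>"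
  unfolding partial_iso_def by auto

lemma same_cut_unique: "\<lbrakk> partial_iso Z; (x, \<eta>) \<in> Z; same_cut Z x y; y \<in> carrier R \<rbrakk> \<Longrightarrow> y = \<eta>"
  using same_cutD[of Z x y x \<eta>] partial_isoD[of Z x \<eta>] sg_diff_0_iff[of x x] sg_diff_0_iff[of y \<eta>] by auto

lemma same_cut_gt: "\<lbrakk> partial_iso Z; same_cut Z x y; (\<xi>, \<eta>) \<in> Z \<rbrakk> \<Longrightarrow> \<xi> \<ll> x \<longleftrightarrow> \<eta> \<ll> y"
  using same_cutD[of Z x y \<xi> \<eta>] by simp

lemma same_cut_lt:
  assumes "partial_iso Z" "same_cut Z x y" "(\<xi>, \<eta>) \<in> Z" "x \<in> carrier R" "y \<in> carrier R"
  shows "x \<ll> \<xi> \<longleftrightarrow> y \<ll> \<eta>"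
proof -
  have "sg (\<xi> \<ominus> x) = - sg (x \<ominus> \<xi>)" "sg (\<eta> \<ominus> y) = - sg (y \<ominus> \<eta>)"
    by (rule sg_diff_swap; use partial_isoD assms in blast)+
  then show ?thesis using same_cutD[OF assms(2,3)] by simp
qed

lemma partial_iso_insert:
  assumes "partial_iso Z" "same_cut Z x y" "x \<in> carrier R" "y \<in> carrier R"
  shows "partial_iso (insert (x, y) Z)"
proof -
  have "same_cut (insert (x, y) Z) \<xi> \<eta>" if "(\<xi>, \<eta>) \<in> insert (x, y) Z" for \<xi> \<eta>
  proof (cases "(\<xi>, \<eta>) \<in> Z")
    case True
    have "sg (\<xi> \<ominus> x) = - sg (x \<ominus> \<xi>)" "sg (\<eta> \<ominus> y) = - sg (y \<ominus> \<eta>)"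
      by (rule sg_diff_swap; use partial_isoD True assms in blast)+
    then have "sg (\<xi> \<ominus> x) = sg (\<eta> \<ominus> y)" using same_cutD[OF assms(2) True] by simp
    then show ?thesis using partial_isoD[OF assms(1) True] unfolding same_cut_def by auto
  next
    case False
    then have "\<xi> = x" "\<eta> = y" using that by auto
    moreover have "sg (x \<ominus> x) = sg (y \<ominus> y)" using assms by (simp add: a_minus_def r_neg)
    ultimately show ?thesis using assms(2) unfolding same_cut_def by auto
  qed
  then show ?thesis using assms unfolding partial_iso_def by auto
qed

text \<open>One step of a back-and-forth argument: the partners of the points below \<open>x\<close>
  lie below the partners of the points above \<open>x\<close>, and a finite cut can be
  filled.\<close>

lemma partial_iso_extend:
  assumes "partial_iso Z" "x \<in> carrier R"
  shows "\<exists>y\<in>carrier R. same_cut Z x y"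
proof (cases "\<exists>\<eta>. (x, \<eta>) \<in> Z")
  case True
  then show ?thesis using partial_isoD[OF assms(1)] by blast
next
  case False
  let ?V = "snd ` {p \<in> Z. fst p \<ll> x}" and ?W = "snd ` {p \<in> Z. x \<ll> fst p}"
  have fin: "finite Z" "?V \<subseteq> carrier R" "?W \<subseteq> carrier R" "finite ?V" "finite ?W" using assms unfolding partial_iso_def by auto
  have "\<eta> \<ll> \<eta>'" if "\<eta> \<in> ?V" "\<eta>' \<in> ?W" for \<eta> \<eta>'
  proof -
    obtain \<xi> \<xi>' where *: "(\<xi>, \<eta>) \<in> Z" "(\<xi>', \<eta>') \<in> Z" "\<xi> \<ll> x" "x \<ll> \<xi>'" using \<open>\<eta> \<in> ?V\<close> \<open>\<eta>' \<in> ?W\<close> by auto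
    then have "\<xi> \<ll> \<xi>'" using prec_trans[of \<xi> x \<xi>'] partial_isoD[OF assms(1)] assms(2) by blast
    then show ?thesis using same_cut_gt[OF assms(1), of \<xi>' \<eta>' \<xi> \<eta>] partial_isoD[OF assms(1) *(2)] *(1) by blast
  qed
  then have "\<exists>y\<in>carrier R. (\<forall>\<eta>\<in>?V. \<eta> \<ll> y) \<and> (\<forall>\<eta>\<in>?W. y \<ll> \<eta>)"
    by (intro finite_separate[OF carrier_is_subfield fin(4,5,2,3)])
  then obtain y where y: "y \<in> carrier R" "\<And>\<eta>. \<eta> \<in> ?V \<Longrightarrow> \<eta> \<ll> y" "\<And>\<eta>. \<eta> \<in> ?W \<Longrightarrow> y \<ll> \<eta>"
    by blast
  have "sg (x \<ominus> \<xi>) = sg (y \<ominus> \<eta>)" if z: "(\<xi>, \<eta>) \<in> Z" for \<xi> \<eta>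
  proof -
    have c: "\<xi> \<in> carrier R" "\<eta> \<in> carrier R" using partial_isoD[OF assms(1) z] by auto
    show ?thesis
    proof (cases rule: prec_cases[OF c(1) assms(2)])
      case 1
      then have "(\<xi>, \<eta>) \<in> {p \<in> Z. fst p \<ll> x}" using z by simp
      then have "\<eta> \<in> ?V" by (rule image_eqI[rotated]) simp
      then have "\<eta> \<ll> y" by (rule y(2))
      then show ?thesis using 1 by simp
    next
      case 2
      then show ?thesis using False z by auto
    next
      case 3
      then have "(\<xi>, \<eta>) \<in> {p \<in> Z. x \<ll> fst p}" using z by simp
      then have "\<eta> \<in> ?W" by (rule image_eqI[rotated]) simp
      then have "y \<ll> \<eta>" by (rule y(3))
      then show ?thesis using 3 sg_diff_swap[OF assms(2) c(1)] sg_diff_swap[OF y(1) c(2)] by simp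
    qed
  qed
  then show ?thesis using y(1) unfolding same_cut_def by auto
qed

text \<open>\<open>u\<close> and \<open>v\<close> are the neighbours of \<open>x\<close> among the
  first components. No point of \<open>Z\<close> lies in the open cells (u, v) and (u', v'), so any
  two points from them lie in the same cut. The conditions on \<open>l\<close> and \<open>r\<close>
  keep the cell inside [l, r].\<close>

lemma partial_iso_adjacent:
  assumes "partial_iso Z" "(l, l') \<in> Z" "(r, r') \<in> Z" "x \<in> carrier R" "l \<ll> x" "x \<ll> r" "x \<notin> fst ` Z"
  obtains u u' v v' where "(u, u') \<in> Z" "(v, v') \<in> Z" "u \<ll> x" "x \<ll> v"
    "\<not> u \<ll> l" "\<not> r \<ll> v"
    "\<And>y z. \<lbrakk> y \<in> carrier R; z \<in> carrier R; u \<ll> y; y \<ll> v; u' \<ll> z; z \<ll> v' \<rbrakk> \<Longrightarrow> same_cut Z y z"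
proof -
  have Z: "finite Z" "fst ` Z \<subseteq> carrier R" using assms(1) unfolding partial_iso_def by auto
  let ?V = "{\<xi> \<in> fst ` Z. \<xi> \<ll> x}" and ?W = "{\<xi> \<in> fst ` Z. x \<ll> \<xi>}"
  have VW: "finite ?V" "finite ?W" "?V \<subseteq> carrier R" "?W \<subseteq> carrier R" "l \<in> ?V" "r \<in> ?W"
    using Z assms by force+
  obtain u where u: "u \<in> ?V" "\<And>\<xi>. \<xi> \<in> ?V \<Longrightarrow> \<xi> \<noteq> u \<Longrightarrow> \<xi> \<ll> u"
    using finite_has_max[of ?V] VW by blast
  obtain v where v: "v \<in> ?W" "\<And>\<xi>. \<xi> \<in> ?W \<Longrightarrow> \<xi> \<noteq> v \<Longrightarrow> v \<ll> \<xi>"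
    using finite_has_min[of ?W] VW by blast
  obtain u' v' where uv: "(u, u') \<in> Z" "(v, v') \<in> Z" using u(1) v(1) by auto
  have c: "u \<in> carrier R" "v \<in> carrier R" "u' \<in> carrier R" "v' \<in> carrier R"
    "l \<in> carrier R" "r \<in> carrier R" using uv partial_isoD[OF assms(1)] assms(2,3) by blast+
  have "\<not> u \<ll> l" using u(2)[OF VW(5)] prec_asym[of l u] c by (cases "l = u") auto
  moreover have "\<not> r \<ll> v" using v(2)[OF VW(6)] prec_asym[of v r] c by (cases "r = v") auto
  moreover have "same_cut Z y z" if h: "y \<in> carrier R" "z \<in> carrier R" "u \<ll> y" "y \<ll> v" "u' \<ll> z" "z \<ll> v'" for y z
    unfolding same_cut_def
  proof clarify
    fix \<xi> \<eta> assume z: "(\<xi>, \<eta>) \<in> Z"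
    have c': "\<xi> \<in> carrier R" "\<eta> \<in> carrier R" and s: "same_cut Z \<xi> \<eta>" using partial_isoD[OF assms(1) z] by auto
    have "\<xi> \<in> fst ` Z" using z by (rule image_eqI[rotated]) simp
    moreover from this have "\<xi> \<noteq> x" using assms(7) by blast
    then have "\<xi> \<ll> x \<or> x \<ll> \<xi>" using prec_cases[OF c'(1) assms(4)] by blast
    ultimately consider "\<xi> \<in> ?V" | "\<xi> \<in> ?W" by blast
    then show "sg (y \<ominus> \<xi>) = sg (z \<ominus> \<eta>)"
    proof cases
      case 1
      have "\<xi> \<ll> y \<and> \<eta> \<ll> z"
      proof (cases "\<xi> = u")
        case True
        then have "\<eta> = u'" using same_cut_unique[OF assms(1) uv(1), of \<eta>] s c' by simp
        then show ?thesis using h True by simp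
      next
        case False
        then have "\<xi> \<ll> u" using u(2) 1 by blast
        moreover have "\<eta> \<ll> u'" using same_cut_lt[OF assms(1) s uv(1)] c' calculation by simp
        ultimately show ?thesis using prec_trans[of \<xi> u y] prec_trans[of \<eta> u' z] c c' h by blast
      qed
      then show ?thesis by simp
    next
      case 2
      have "y \<ll> \<xi> \<and> z \<ll> \<eta>"
      proof (cases "\<xi> = v")
        case True
        then have "\<eta> = v'" using same_cut_unique[OF assms(1) uv(2), of \<eta>] s c' by simp
        then show ?thesis using h True by simp
      next
        case False
        then have "v \<ll> \<xi>" using v(2) 2 by blast
        moreover have "v' \<ll> \<eta>" using same_cut_gt[OF assms(1) s uv(2)] calculation by simp
        ultimately show ?thesis using prec_trans[of y v \<xi>] prec_trans[of z v' \<eta>] c c' h by blast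
      qed
      then show ?thesis using sg_diff_swap[OF h(1) c'(1)] sg_diff_swap[OF h(2) c'(2)] by simp
    qed
  qed
  ultimately show thesis using that[OF uv] u(1) v(1) by blast
qed

end

section \<open>Sign diagrams of two families of polynomials\<close>

text \<open>In \<open>remainder\<close>, the polynomial \<open>r\<close> plays the role of the pseudo-remainder of \<open>i\<close> modulo \<open>j\<close>. As all
  degrees decrease, the signs on one diagram determine those on the other one by induction on the degree;
  \<open>k j\<close> is the number of coefficients, one more than the degree.\<close>

locale matched_polys = ivt_field +
  fixes S :: "'i set" and A B :: "'i \<Rightarrow> nat \<Rightarrow> 'a" and k :: "'i \<Rightarrow> nat"
  assumes finite_S: "finite S"
    and A_closed [simp]: "A j m \<in> carrier R" and B_closed [simp]: "B j m \<in> carrier R"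
    and lead: "\<lbrakk> j \<in> S; k j > 0 \<rbrakk> \<Longrightarrow> A j (k j - 1) \<noteq> \<zero> \<and> sg (B j (k j - 1)) = sg (A j (k j - 1))"
    and der: "\<lbrakk> j \<in> S; k j \<ge> 2 \<rbrakk> \<Longrightarrow> \<exists>i\<in>S. k i = k j - 1 \<and>
      (\<forall>x\<in>carrier R. pval (A i) (k i) x = pval (pder (A j)) (k j - 1) x) \<and>
      (\<forall>x\<in>carrier R. pval (B i) (k i) x = pval (pder (B j)) (k j - 1) x)"
    and remainder: "\<lbrakk> i \<in> S; j \<in> S; k j \<le> k i; k j \<ge> 2 \<rbrakk> \<Longrightarrow> \<exists>r\<in>S. k r < k j \<and>
      (\<forall>x\<in>carrier R. pval (A j) (k j) x = \<zero> \<longrightarrow> sg (pval (A r) (k r) x) = sg (pval (A i) (k i) x)) \<and>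
      (\<forall>x\<in>carrier R. pval (B j) (k j) x = \<zero> \<longrightarrow> sg (pval (B r) (k r) x) = sg (pval (B i) (k i) x))"
begin

abbreviation P where "P j \<equiv> pval (A j) (k j)"
abbreviation Q where "Q j \<equiv> pval (B j) (k j)"

lemma const_sign:
  assumes "j \<in> S" "k j \<le> 1"
  shows "sg (P j x) = sg (Q j y)"
proof (cases "k j = 0")
  case False
  then have "k j = Suc 0" using assms by simp
  then show ?thesis using lead[of j] assms by (simp add: pval_Suc)
qed simp

text \<open>\<open>Z\<close> carries a common sign diagram of the polynomials in \<open>T\<close> on
  [l, r]. Once \<open>Z\<close> contains pairs for \<open>l\<close> and \<open>r\<close>,
  \<open>same_cut\<close> confines \<open>y\<close> to the corresponding interval.\<close>

definition matched :: "'i set \<Rightarrow> 'a \<Rightarrow> 'a \<Rightarrow> ('a \<times> 'a) set \<Rightarrow> bool"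
  where "matched T l r Z \<longleftrightarrow> (\<forall>x\<in>carrier R. \<forall>y\<in>carrier R. \<forall>p\<in>T.
    \<not> x \<ll> l \<longrightarrow> \<not> r \<ll> x \<longrightarrow> same_cut Z x y \<longrightarrow> sg (P p x) = sg (Q p y))"

lemma matchedD:
  "\<lbrakk> matched T l r Z; p \<in> T; same_cut Z x y; x \<in> carrier R; y \<in> carrier R; \<not> x \<ll> l; \<not> r \<ll> x \<rbrakk> \<Longrightarrow>
    sg (P p x) = sg (Q p y)"
  unfolding matched_def by blast

lemma matched_mono: "\<lbrakk> matched T l r Z; Z \<subseteq> Z' \<rbrakk> \<Longrightarrow> matched T l r Z'"
  unfolding matched_def using same_cut_mono by blast

text \<open>Any two points of corresponding cells lie in the same cut, so each sign of
  \<open>P i\<close> on the one cell equals each sign of \<open>Q i\<close> on the other: both are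
  one and the same constant. It is not 0, as \<open>P i\<close> has finitely many zeros. In the
  application \<open>i\<close> is a derivative.\<close>

lemma derivative_sign:
  assumes Z: "partial_iso Z" "matched T l r Z" "i \<in> T" "i \<in> S" "k i \<ge> 1"
    and c: "u \<in> carrier R" "v \<in> carrier R" "u' \<in> carrier R" "v' \<in> carrier R"
      "l \<in> carrier R" "r \<in> carrier R"
    and lr: "\<not> u \<ll> l" "\<not> r \<ll> v" and x: "x \<in> carrier R" "u \<ll> x" "x \<ll> v" and u'v': "u' \<ll> v'"
    and s: "\<And>y z. \<lbrakk> y \<in> carrier R; z \<in> carrier R; u \<ll> y; y \<ll> v; u' \<ll> z; z \<ll> v' \<rbrakk> \<Longrightarrow> same_cut Z y z"
  shows "\<exists>e. (e = 1 \<or> e = - 1) \<and>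
    (\<forall>y\<in>carrier R. u \<ll> y \<longrightarrow> y \<ll> v \<longrightarrow> sg (P i y) = e) \<and>
    (\<forall>z\<in>carrier R. u' \<ll> z \<longrightarrow> z \<ll> v' \<longrightarrow> sg (Q i z) = e)"
proof -
  obtain w where w: "w \<in> carrier R" "u' \<ll> w" "w \<ll> v'" using prec_dense[of u' v'] c u'v' by blast
  have uv: "u \<ll> v" using prec_trans[of u x v] c x by blast
  have in_lr: "\<not> y \<ll> l" "\<not> r \<ll> y" if "y \<in> carrier R" "u \<ll> y" "y \<ll> v" for y
    using that lr prec_trans[of u y l] prec_trans[of r y v] c by blast+
  have eq: "sg (P i y) = sg (Q i z)"
    if "y \<in> carrier R" "z \<in> carrier R" "u \<ll> y" "y \<ll> v" "u' \<ll> z" "z \<ll> v'" for y z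
    using matchedD[OF Z(2,3) s[OF that] that(1,2)] in_lr that by blast
  define e where "e = sg (P i x)"
  have Qe: "sg (Q i z) = e" if "z \<in> carrier R" "u' \<ll> z" "z \<ll> v'" for z
    using eq[of x z] that x e_def by simp
  have Pe: "sg (P i y) = e" if "y \<in> carrier R" "u \<ll> y" "y \<ll> v" for y
    using eq[of y w] that w Qe[of w] by simp
  obtain t where t: "t \<in> carrier R" "u \<ll> t" "t \<ll> v" "P i t \<noteq> \<zero>"
    using pval_sign_nonzero_between[of "A i" "k i" u v] lead[OF Z(4)] Z(5) c uv by auto
  have "sg (P i t) = 1 \<or> sg (P i t) = - 1" using sg_range[of "P i t"] sg_0_iff[of "P i t"] t by auto
  then have "e = 1 \<or> e = - 1" using Pe[OF t(1-3)] by simp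
  then show ?thesis using Pe Qe by blast
qed

text \<open>No member of \<open>T\<close> has a larger degree than \<open>p\<close>, while the
  derivative of \<open>p\<close> and its remainders modulo members of \<open>T\<close> are in
  \<open>T\<close> already. The remainders give the signs of \<open>p\<close> at the points of
  \<open>Z\<close>, the derivative gives monotonicity on the cells; what is left is to add the roots
  of \<open>P p\<close> in between.\<close>

lemma extend_step:
  assumes T: "insert p T \<subseteq> S" "p \<notin> T" "\<And>q. \<lbrakk> q \<in> S; k q < k p \<rbrakk> \<Longrightarrow> q \<in> T"
      "\<And>q. q \<in> T \<Longrightarrow> k q \<le> k p"
    and lr: "l \<in> carrier R" "r \<in> carrier R" "l \<ll> r"
    and Z: "partial_iso Z" "(l, l') \<in> Z" "(r, r') \<in> Z" "matched T l r Z"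
      "\<And>\<xi> \<eta>. (\<xi>, \<eta>) \<in> Z \<Longrightarrow> \<not> \<xi> \<ll> l \<and> \<not> r \<ll> \<xi>"
      "\<And>\<xi> \<eta>. \<lbrakk> (\<xi>, \<eta>) \<in> Z; (\<xi>, \<eta>) \<noteq> (l, l'); (\<xi>, \<eta>) \<noteq> (r, r') \<rbrakk> \<Longrightarrow> \<exists>q\<in>T. k q \<ge> 2 \<and> P q \<xi> = \<zero>"
    and ends: "sg (P p l) = sg (Q p l')" "sg (P p r) = sg (Q p r')"
    and kp: "k p \<ge> 2"
  shows "\<exists>Z'. partial_iso Z' \<and> Z \<subseteq> Z' \<and> matched (insert p T) l r Z' \<and>
    (\<forall>\<xi> \<eta>. (\<xi>, \<eta>) \<in> Z' \<longrightarrow> (\<xi>, \<eta>) \<notin> Z \<longrightarrow> \<not> \<xi> \<ll> l \<and> \<not> r \<ll> \<xi> \<and> P p \<xi> = \<zero>)"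
proof -
  have pS: "p \<in> S" using T by simp
  obtain n where n: "k p = Suc n" using kp by (cases "k p") auto
  obtain i where i: "i \<in> S" "k i = n" "\<And>x. x \<in> carrier R \<Longrightarrow> pval (pder (A p)) n x = P i x"
    "\<And>x. x \<in> carrier R \<Longrightarrow> pval (pder (B p)) n x = Q i x"
    using der[OF pS kp] n by auto
  have Ac: "A p m \<in> carrier R" and Bc: "B p m \<in> carrier R" for m by simp_all
  have iT: "i \<in> T" using T(3)[OF i(1)] i(2) n by simp
  have ki: "k i \<ge> 1" using i(2) kp n by simp
  let ?rts = "{x \<in> carrier R. l \<ll> x \<and> x \<ll> r \<and> P p x = \<zero>}"
  have fin: "finite ?rts"
    by (rule finite_subset[OF _ finite_pval_zeros[of "A p" "k p"]]) (use lead[OF pS] kp in auto)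
  \<comment> \<open>A point of \<open>Z\<close> other than the two ends is a root of some
    \<open>q\<close> in \<open>T\<close>. There \<open>p\<close> has the sign of its remainder
    modulo \<open>q\<close>, and the signs of the remainder match.\<close>
  have match0: "sg (P p \<xi>) = sg (Q p \<eta>)" if z: "(\<xi>, \<eta>) \<in> Z" for \<xi> \<eta>
  proof (cases "(\<xi>, \<eta>) = (l, l') \<or> (\<xi>, \<eta>) = (r, r')")
    case False
    then obtain q where q: "q \<in> T" "k q \<ge> 2" "P q \<xi> = \<zero>" using Z(6)[OF z] by blast
    have c: "\<xi> \<in> carrier R" "\<eta> \<in> carrier R" "same_cut Z \<xi> \<eta>" using partial_isoD[OF Z(1) z] by auto
    have "sg (Q q \<eta>) = sg (P q \<xi>)" using matchedD[OF Z(4) q(1) c(3,1,2)] Z(5)[OF z] by simp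
    then have Qq: "Q q \<eta> = \<zero>" using q c sg_0_iff[of "Q q \<eta>"] by simp
    obtain w where w: "w \<in> S" "k w < k q"
      "\<forall>x\<in>carrier R. P q x = \<zero> \<longrightarrow> sg (P w x) = sg (P p x)"
      "\<forall>x\<in>carrier R. Q q x = \<zero> \<longrightarrow> sg (Q w x) = sg (Q p x)"
      using remainder[OF pS, of q] q T by blast
    have "w \<in> T" using T(3)[OF w(1)] w(2) T(4)[OF q(1)] by simp
    then have "sg (P w \<xi>) = sg (Q w \<eta>)" using matchedD[OF Z(4) _ c(3,1,2)] Z(5)[OF z] by simp
    then show ?thesis using w(3,4) q Qq c by simp
  qed (use ends in auto)
  \<comment> \<open>The roots of \<open>P p\<close> are added one at a time, each paired with a root
    of \<open>Q p\<close> in the corresponding cell.\<close>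
  have root: "\<exists>Z'. partial_iso Z' \<and> Z \<subseteq> Z' \<and> W \<subseteq> fst ` Z' \<and>
     (\<forall>\<xi> \<eta>. (\<xi>, \<eta>) \<in> Z' \<longrightarrow> (\<xi>, \<eta>) \<notin> Z \<longrightarrow> \<not> \<xi> \<ll> l \<and> \<not> r \<ll> \<xi> \<and> P p \<xi> = \<zero> \<and> Q p \<eta> = \<zero>)"
    if "finite W" "W \<subseteq> ?rts" for W
    using that
  proof (induction W)
    case empty
    show ?case by (intro exI[of _ Z]) (use Z in auto)
  next
    case (insert x W)
    then obtain Z' where Z': "partial_iso Z'" "Z \<subseteq> Z'" "W \<subseteq> fst ` Z'"
      "\<And>\<xi> \<eta>. \<lbrakk> (\<xi>, \<eta>) \<in> Z'; (\<xi>, \<eta>) \<notin> Z \<rbrakk> \<Longrightarrow> \<not> \<xi> \<ll> l \<and> \<not> r \<ll> \<xi> \<and> P p \<xi> = \<zero> \<and> Q p \<eta> = \<zero>"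
      by auto
    have x: "x \<in> carrier R" "l \<ll> x" "x \<ll> r" "P p x = \<zero>" using insert.prems by auto
    show ?case
    proof (cases "x \<in> fst ` Z'")
      case True
      then show ?thesis using Z' by (intro exI[of _ Z']) auto
    next
      case False
      have Zl: "(l, l') \<in> Z'" "(r, r') \<in> Z'" using Z Z' by auto
      obtain u u' v v' where uv: "(u, u') \<in> Z'" "(v, v') \<in> Z'" "u \<ll> x" "x \<ll> v" "\<not> u \<ll> l" "\<not> r \<ll> v"
        "\<And>y z. \<lbrakk> y \<in> carrier R; z \<in> carrier R; u \<ll> y; y \<ll> v; u' \<ll> z; z \<ll> v' \<rbrakk> \<Longrightarrow> same_cut Z' y z"
        using partial_iso_adjacent[OF Z'(1) Zl x(1-3) False] by blast
      have c: "u \<in> carrier R" "v \<in> carrier R" "u' \<in> carrier R" "v' \<in> carrier R" "same_cut Z' u u'"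
        using uv(1,2) partial_isoD[OF Z'(1)] by blast+
      have "u \<ll> v" using prec_trans[of u x v] c x uv by blast
      then have u'v': "u' \<ll> v'" using same_cut_lt[OF Z'(1) c(5) uv(2)] c by blast
      obtain e where e: "e = 1 \<or> e = - 1"
        "\<And>y. \<lbrakk> y \<in> carrier R; u \<ll> y; y \<ll> v \<rbrakk> \<Longrightarrow> sg (P i y) = e"
        "\<And>z. \<lbrakk> z \<in> carrier R; u' \<ll> z; z \<ll> v' \<rbrakk> \<Longrightarrow> sg (Q i z) = e"
        using derivative_sign[OF Z'(1) matched_mono[OF Z(4) Z'(2)] iT i(1) ki c(1-4) lr(1,2)
            uv(5,6) x(1) uv(3,4) u'v' uv(7)] by blast
      have mt: "sg (P p \<xi>) = sg (Q p \<eta>)" if "(\<xi>, \<eta>) \<in> Z'" for \<xi> \<eta>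
        using match0[of \<xi> \<eta>] Z'(4)[of \<xi> \<eta>] that by (cases "(\<xi>, \<eta>) \<in> Z") auto
      have x0: "sg (pval (A p) (Suc n) x) = 0" using x(4) n by simp
      \<comment> \<open>By monotonicity a root inside the cell forces the signs -e and e at its
        ends. \<open>Q p\<close> has the same signs at the partners of the ends, hence a root
        between them.\<close>
      have Pu: "sg (P p u) = - e"
      proof (rule ccontr)
        assume "sg (P p u) \<noteq> - e"
        then have "sg (pval (A p) (Suc n) x) = e"
          using sign_right_of[of "A p" e u v n x, OF Ac e(1) c(1,2) _ x(1) uv(3,4)] e(2) i(3) n by simp
        then show False using x0 e(1) by simp
      qed
      have Pv: "sg (P p v) = e"
      proof (rule ccontr)
        assume "sg (P p v) \<noteq> e"
        then have "sg (pval (A p) (Suc n) x) = - e"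
          using sign_left_of[of "A p" e u v n x, OF Ac e(1) c(1,2) _ x(1) uv(3,4)] e(2) i(3) n by simp
        then show False using x0 e(1) by simp
      qed
      have "sg (Q p u') * sg (Q p v') = - 1"
        using mt[OF uv(1)] mt[OF uv(2)] Pu Pv e(1) by auto
      then obtain y where y: "y \<in> carrier R" "u' \<ll> y" "y \<ll> v'" "Q p y = \<zero>"
        using ivt[of "B p" u' v' "k p", OF Bc c(3,4) u'v'] by blast
      have s: "same_cut Z' x y" using uv(7)[OF x(1) y(1) uv(3,4) y(2,3)] .
      have "\<not> x \<ll> l" "\<not> r \<ll> x" using x lr prec_asym by blast+
      then show ?thesis using partial_iso_insert[OF Z'(1) s x(1) y(1)] Z' x y
        by (intro exI[of _ "insert (x, y) Z'"]) auto
    qed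
  qed
  obtain Z' where Z': "partial_iso Z'" "Z \<subseteq> Z'" "?rts \<subseteq> fst ` Z'"
      "\<And>\<xi> \<eta>. \<lbrakk> (\<xi>, \<eta>) \<in> Z'; (\<xi>, \<eta>) \<notin> Z \<rbrakk> \<Longrightarrow> \<not> \<xi> \<ll> l \<and> \<not> r \<ll> \<xi> \<and> P p \<xi> = \<zero> \<and> Q p \<eta> = \<zero>"
    using root[OF fin subset_refl] by auto
  have mt: "sg (P p \<xi>) = sg (Q p \<eta>)" if "(\<xi>, \<eta>) \<in> Z'" for \<xi> \<eta>
    using match0[of \<xi> \<eta>] Z'(4)[of \<xi> \<eta>] that by (cases "(\<xi>, \<eta>) \<in> Z") auto
  have Zl: "(l, l') \<in> Z'" "(r, r') \<in> Z'" using Z Z' by auto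
  have mT: "matched T l r Z'" using matched_mono[OF Z(4) Z'(2)] .
  have "sg (P p x) = sg (Q p y)"
    if h: "x \<in> carrier R" "y \<in> carrier R" "\<not> x \<ll> l" "\<not> r \<ll> x" "same_cut Z' x y" for x y
  proof (cases "x \<in> fst ` Z'")
    case True
    then obtain \<eta> where \<eta>: "(x, \<eta>) \<in> Z'" by auto
    then have "y = \<eta>" using same_cut_unique[OF Z'(1) \<eta> h(5,2)] by simp
    then show ?thesis using mt \<eta> by simp
  next
    case False
    then have "x \<noteq> l" "x \<noteq> r" using Zl by force+
    then have x: "l \<ll> x" "x \<ll> r" using h prec_cases[OF h(1) lr(1)] prec_cases[OF h(1) lr(2)] by blast+
    obtain u u' v v' where uv: "(u, u') \<in> Z'" "(v, v') \<in> Z'" "u \<ll> x" "x \<ll> v" "\<not> u \<ll> l" "\<not> r \<ll> v"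
      "\<And>y z. \<lbrakk> y \<in> carrier R; z \<in> carrier R; u \<ll> y; y \<ll> v; u' \<ll> z; z \<ll> v' \<rbrakk> \<Longrightarrow> same_cut Z' y z"
      using partial_iso_adjacent[OF Z'(1) Zl h(1) x False] by blast
    have c: "u \<in> carrier R" "v \<in> carrier R" "u' \<in> carrier R" "v' \<in> carrier R"
      using uv(1,2) partial_isoD[OF Z'(1)] by blast+
    have y: "u' \<ll> y" "y \<ll> v'"
      using same_cut_gt[OF Z'(1) h(5) uv(1)] same_cut_lt[OF Z'(1) h(5) uv(2)] uv(3,4) h by blast+
    have u'v': "u' \<ll> v'" using prec_trans[of u' y v'] c y h by blast
    have uv': "u \<ll> v" using prec_trans[of u x v] c uv h by blast
    obtain e where e: "e = 1 \<or> e = - 1"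
      "\<And>y. \<lbrakk> y \<in> carrier R; u \<ll> y; y \<ll> v \<rbrakk> \<Longrightarrow> sg (P i y) = e"
      "\<And>z. \<lbrakk> z \<in> carrier R; u' \<ll> z; z \<ll> v' \<rbrakk> \<Longrightarrow> sg (Q i z) = e"
      using derivative_sign[OF Z'(1) mT iT i(1) ki c(1-4) lr(1,2)
          uv(5,6) h(1) uv(3,4) u'v' uv(7)] by blast
    \<comment> \<open>Otherwise \<open>P p\<close> has a root in the cell, and \<open>Z'\<close>
      matches this root with a single point \<open>\<zeta>\<close>. But every \<open>w\<close> in
      the other cell lies in the cut of the root, and there is more than one such
      \<open>w\<close>.\<close>
    have "sg (P p u) \<noteq> - e \<or> sg (P p v) \<noteq> e"
    proof (rule ccontr)
      assume "\<not> ?thesis"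
      then have "sg (P p u) * sg (P p v) = - 1" using e(1) by auto
      then obtain z where z: "z \<in> carrier R" "u \<ll> z" "z \<ll> v" "P p z = \<zero>"
        using ivt[of "A p" u v "k p", OF Ac c(1,2) uv'] by blast
      have "l \<ll> z" using z uv(5) c lr prec_cases[OF c(1) lr(1)] prec_trans[of l u z] by blast
      moreover have "z \<ll> r" using z uv(6) c lr prec_cases[OF c(2) lr(2)] prec_trans[of z v r] by blast
      ultimately have "z \<in> fst ` Z'" using Z'(3) z by blast
      then obtain \<zeta> where \<zeta>: "(z, \<zeta>) \<in> Z'" by auto
      obtain w where w: "w \<in> carrier R" "u' \<ll> w" "w \<ll> v'" "w \<noteq> \<zeta>"
      proof -
        obtain w1 where w1: "w1 \<in> carrier R" "u' \<ll> w1" "w1 \<ll> v'" using prec_dense[OF c(3,4) u'v'] by blast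
        obtain w2 where w2: "w2 \<in> carrier R" "u' \<ll> w2" "w2 \<ll> w1" using prec_dense[OF c(3) w1(1,2)] by blast
        have "w2 \<ll> v'" using prec_trans[of w2 w1 v'] w1 w2 c by blast
        moreover have "w1 \<noteq> w2" using w1 w2 by auto
        ultimately show thesis using that w1 w2 by metis
      qed
      then show False using same_cut_unique[OF Z'(1) \<zeta> uv(7)[OF z(1) w(1) z(2,3) w(2,3)] w(1)] by simp
    qed
    \<comment> \<open>As the signs at the ends of both cells match, the same lemma applies to
      \<open>P p\<close> and to \<open>Q p\<close>.\<close>
    then show ?thesis
    proof
      assume a: "sg (P p u) \<noteq> - e"
      then have "sg (pval (A p) (Suc n) x) = e"
        using sign_right_of[of "A p" e u v n x, OF Ac e(1) c(1,2) _ h(1) uv(3,4)] e(2) i(3) n by simp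
      moreover have "sg (pval (B p) (Suc n) y) = e"
        using sign_right_of[of "B p" e u' v' n y, OF Bc e(1) c(3,4) _ h(2) y] e(3) i(4) n a mt[OF uv(1)] by simp
      ultimately show ?thesis using n by simp
    next
      assume a: "sg (P p v) \<noteq> e"
      then have "sg (pval (A p) (Suc n) x) = - e"
        using sign_left_of[of "A p" e u v n x, OF Ac e(1) c(1,2) _ h(1) uv(3,4)] e(2) i(3) n by simp
      moreover have "sg (pval (B p) (Suc n) y) = - e"
        using sign_left_of[of "B p" e u' v' n y, OF Bc e(1) c(3,4) _ h(2) y] e(3) i(4) n a mt[OF uv(2)] by simp
      ultimately show ?thesis using n by simp
    qed
  qed
  then have "matched (insert p T) l r Z'" using mT unfolding matched_def by blast
  then show ?thesis using Z' by (intro exI[of _ Z']) auto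
qed

text \<open>A polynomial of maximal degree is taken off \<open>T\<close>, so that \<open>T\<close>
  stays closed under passing to smaller degrees in \<open>S\<close>. The diagram records that its
  inner points are roots of nonconstant members, because \<open>extend_step\<close> finds signs
  there by remainders.\<close>

lemma matching_exists:
  assumes lr: "l \<in> carrier R" "r \<in> carrier R" "l' \<in> carrier R" "r' \<in> carrier R" "l \<ll> r" "l' \<ll> r'"
    and ends: "\<And>j. j \<in> S \<Longrightarrow> sg (P j l) = sg (Q j l')" "\<And>j. j \<in> S \<Longrightarrow> sg (P j r) = sg (Q j r')"
    and T: "finite T" "T \<subseteq> S" "\<And>p q. \<lbrakk> p \<in> T; q \<in> S; k q < k p \<rbrakk> \<Longrightarrow> q \<in> T"
  shows "\<exists>Z. partial_iso Z \<and> (l, l') \<in> Z \<and> (r, r') \<in> Z \<and> matched T l r Z \<and>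
    (\<forall>\<xi> \<eta>. (\<xi>, \<eta>) \<in> Z \<longrightarrow> \<not> \<xi> \<ll> l \<and> \<not> r \<ll> \<xi> \<and>
      ((\<xi>, \<eta>) = (l, l') \<or> (\<xi>, \<eta>) = (r, r') \<or> (\<exists>q\<in>T. k q \<ge> 2 \<and> P q \<xi> = \<zero>)))"
  using T
proof (induction "card T" arbitrary: T)
  case 0
  then have "T = {}" by simp
  have sw: "sg (r \<ominus> l) = 1" "sg (r' \<ominus> l') = 1" "sg (l \<ominus> r) = - 1" "sg (l' \<ominus> r') = - 1"
    using lr sg_diff_swap[of l r] sg_diff_swap[of l' r'] by auto
  have z: "sg (l \<ominus> l) = 0" "sg (r \<ominus> r) = 0" "sg (l' \<ominus> l') = 0" "sg (r' \<ominus> r') = 0"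
    using lr by (auto simp: a_minus_def r_neg)
  show ?case using \<open>T = {}\<close> sw z lr
    by (intro exI[of _ "{(l, l'), (r, r')}"]) (auto simp: partial_iso_def same_cut_def matched_def)
next
  case (Suc n)
  then have ne: "T \<noteq> {}" by auto
  define m where "m = Max (k ` T)"
  have "m \<in> k ` T" unfolding m_def using Suc ne by (intro Max_in) auto
  then obtain p where p: "p \<in> T" "k p = m" by auto
  have pmax: "k q \<le> k p" if "q \<in> T" for q unfolding p m_def using Suc that by simp
  let ?T = "T - {p}"
  have card: "n = card ?T" "finite ?T" "?T \<subseteq> S" using Suc p by auto
  have down: "q \<in> ?T" if "p' \<in> ?T" "q \<in> S" "k q < k p'" for p' q
    using Suc.prems(3)[of p' q] that pmax[of p'] by auto
  obtain Z where ZZ: "partial_iso Z \<and> (l, l') \<in> Z \<and> (r, r') \<in> Z \<and> matched ?T l r Z \<and>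
    (\<forall>\<xi> \<eta>. (\<xi>, \<eta>) \<in> Z \<longrightarrow> \<not> \<xi> \<ll> l \<and> \<not> r \<ll> \<xi> \<and>
      ((\<xi>, \<eta>) = (l, l') \<or> (\<xi>, \<eta>) = (r, r') \<or> (\<exists>q\<in>?T. k q \<ge> 2 \<and> P q \<xi> = \<zero>)))"
    using Suc.hyps(1)[OF card down] ..
  then have Z: "partial_iso Z" "(l, l') \<in> Z" "(r, r') \<in> Z" "matched ?T l r Z" by blast+
  have Z5: "\<not> \<xi> \<ll> l \<and> \<not> r \<ll> \<xi> \<and>
      ((\<xi>, \<eta>) = (l, l') \<or> (\<xi>, \<eta>) = (r, r') \<or> (\<exists>q\<in>?T. k q \<ge> 2 \<and> P q \<xi> = \<zero>))"
    if "(\<xi>, \<eta>) \<in> Z" for \<xi> \<eta> using ZZ that by blast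
  have pS: "p \<in> S" using p Suc by auto
  have insT: "insert p ?T = T" using p by auto
  show ?case
  proof (cases "k p \<ge> 2")
    case False
    have "matched T l r Z"
      unfolding matched_def
    proof (intro ballI impI)
      fix x y q
      assume h: "x \<in> carrier R" "y \<in> carrier R" "q \<in> T" "\<not> x \<ll> l" "\<not> r \<ll> x" "same_cut Z x y"
      show "sg (P q x) = sg (Q q y)"
      proof (cases "q = p")
        case True
        then show ?thesis using const_sign[OF pS] False by simp
      next
        case False
        then show ?thesis using matchedD[OF Z(4) _ h(6,1,2,4,5)] h(3) by simp
      qed
    qed
    moreover have "(\<xi>, \<eta>) = (l, l') \<or> (\<xi>, \<eta>) = (r, r') \<or> (\<exists>q\<in>T. k q \<ge> 2 \<and> P q \<xi> = \<zero>)"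
      if "(\<xi>, \<eta>) \<in> Z" for \<xi> \<eta> using Z5[OF that] by blast
    ultimately show ?thesis using Z Z5 by (intro exI[of _ Z]) simp
  next
    case True
    have "\<exists>Z'. partial_iso Z' \<and> Z \<subseteq> Z' \<and> matched (insert p ?T) l r Z' \<and>
      (\<forall>\<xi> \<eta>. (\<xi>, \<eta>) \<in> Z' \<longrightarrow> (\<xi>, \<eta>) \<notin> Z \<longrightarrow> \<not> \<xi> \<ll> l \<and> \<not> r \<ll> \<xi> \<and> P p \<xi> = \<zero>)"
    proof (rule extend_step[OF _ _ _ _ lr(1,2,5) Z(1-4) _ _ ends(1)[OF pS] ends(2)[OF pS] True])
      show "insert p ?T \<subseteq> S" "p \<notin> ?T" using Suc.prems p by auto
      show "q \<in> ?T" if "q \<in> S" "k q < k p" for q using Suc.prems(3)[OF p(1)] that by auto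
      show "k q \<le> k p" if "q \<in> ?T" for q using pmax that by auto
      show "\<not> \<xi> \<ll> l \<and> \<not> r \<ll> \<xi>" if "(\<xi>, \<eta>) \<in> Z" for \<xi> \<eta> using Z5[OF that] by simp
      show "\<exists>q\<in>?T. k q \<ge> 2 \<and> P q \<xi> = \<zero>"
        if "(\<xi>, \<eta>) \<in> Z" "(\<xi>, \<eta>) \<noteq> (l, l')" "(\<xi>, \<eta>) \<noteq> (r, r')" for \<xi> \<eta>
        using Z5[OF that(1)] that(2,3) by blast
    qed
    then obtain Z' where Z': "partial_iso Z'" "Z \<subseteq> Z'" "matched T l r Z'"
      "\<forall>\<xi> \<eta>. (\<xi>, \<eta>) \<in> Z' \<longrightarrow> (\<xi>, \<eta>) \<notin> Z \<longrightarrow> \<not> \<xi> \<ll> l \<and> \<not> r \<ll> \<xi> \<and> P p \<xi> = \<zero>"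
      unfolding insT by (elim exE conjE)
    have new: "\<not> \<xi> \<ll> l \<and> \<not> r \<ll> \<xi> \<and>
        ((\<xi>, \<eta>) = (l, l') \<or> (\<xi>, \<eta>) = (r, r') \<or> (\<exists>q\<in>T. k q \<ge> 2 \<and> P q \<xi> = \<zero>))"
      if "(\<xi>, \<eta>) \<in> Z'" for \<xi> \<eta>
    proof (cases "(\<xi>, \<eta>) \<in> Z")
      case True
      then show ?thesis using Z5[OF True] by blast
    next
      case False
      then show ?thesis using Z'(4) that \<open>k p \<ge> 2\<close> p(1) by blast
    qed
    then show ?thesis using Z Z' by (intro exI[of _ Z'] conjI allI impI) blast+
  qed
qed

text \<open>The ends \<open>l\<close> and \<open>r\<close> enclose \<open>x\<close> and lie so far
  out that leading signs and numbers of coefficients, common to both families, determine all signs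
  there.\<close>

theorem sign_transfer:
  assumes "x \<in> carrier R"
  shows "\<exists>y\<in>carrier R. \<forall>j\<in>S. sg (P j x) = sg (Q j y)"
proof -
  have Bnz: "\<And>j. \<lbrakk> j \<in> S; k j > 0 \<rbrakk> \<Longrightarrow> B j (k j - 1) \<noteq> \<zero>"
    using lead sg_0_iff by (metis A_closed sg_zero)
  obtain r where r: "r \<in> carrier R" "x \<ll> r"
    "\<And>j. j \<in> S \<Longrightarrow> sg (P j r) = (if k j = 0 then 0 else sg (A j (k j - 1)))"
    using common_sign_at_infinity[of S A k "{x}"] finite_S lead assms by auto
  obtain l where l: "l \<in> carrier R" "l \<ll> x"
    "\<And>j. j \<in> S \<Longrightarrow> sg (P j l) = (if k j = 0 then 0 else (- 1) ^ (k j - 1) * sg (A j (k j - 1)))"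
    using common_sign_at_minus_infinity[of S A k "{x}"] finite_S lead assms by auto
  obtain r' where r': "r' \<in> carrier R"
    "\<And>j. j \<in> S \<Longrightarrow> sg (Q j r') = (if k j = 0 then 0 else sg (B j (k j - 1)))"
    using common_sign_at_infinity[of S B k "{}"] finite_S Bnz by auto
  obtain l' where l': "l' \<in> carrier R" "l' \<ll> r'"
    "\<And>j. j \<in> S \<Longrightarrow> sg (Q j l') = (if k j = 0 then 0 else (- 1) ^ (k j - 1) * sg (B j (k j - 1)))"
    using common_sign_at_minus_infinity[of S B k "{r'}"] finite_S Bnz r' by auto
  have "l \<ll> r" using prec_trans[of l x r] l r assms by blast
  moreover have "sg (P j l) = sg (Q j l')" "sg (P j r) = sg (Q j r')" if "j \<in> S" for j
    using l(3)[OF that] l'(3)[OF that] r(3)[OF that] r'(2)[OF that] lead[OF that] by auto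
  ultimately obtain Z where Z: "partial_iso Z" "matched S l r Z"
    using matching_exists[of l r l' r' S] l r l' r' finite_S by blast
  obtain y where y: "y \<in> carrier R" "same_cut Z x y" using partial_iso_extend[OF Z(1) assms] by blast
  have "\<not> x \<ll> l" "\<not> r \<ll> x" using prec_asym l r assms by blast+
  then show ?thesis using matchedD[OF Z(2) _ y(2) assms y(1)] y(1) by blast
qed

end

section \<open>Transfer to a relatively algebraically closed subfield\<close>

text \<open>Works down the degrees: after j rounds the set is closed under \<open>D p\<close> for
  deg p > d - j and under \<open>M p q\<close> for deg q > d - j, and the next round adds elements
  of degree below d - j. These do not reopen a degree already settled, because \<open>M p q\<close>
  is demanded for deg q \<le> deg p.\<close>

lemma finite_descending_closure:
  fixes N :: "'i set" and deg :: "'i \<Rightarrow> nat" and D :: "'i \<Rightarrow> 'i" and M :: "'i \<Rightarrow> 'i \<Rightarrow> 'i"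
  assumes "finite S" "S \<subseteq> N"
    and D: "\<And>p. \<lbrakk> p \<in> N; deg p \<ge> 2 \<rbrakk> \<Longrightarrow> D p \<in> N \<and> deg (D p) < deg p"
    and M: "\<And>p q. \<lbrakk> p \<in> N; q \<in> N; deg q \<le> deg p; deg q \<ge> 2 \<rbrakk> \<Longrightarrow> M p q \<in> N \<and> deg (M p q) < deg q"
  shows "\<exists>T. finite T \<and> S \<subseteq> T \<and> T \<subseteq> N \<and> (\<forall>p\<in>T. deg p \<ge> 2 \<longrightarrow> D p \<in> T) \<and>
    (\<forall>p\<in>T. \<forall>q\<in>T. deg q \<le> deg p \<longrightarrow> deg q \<ge> 2 \<longrightarrow> M p q \<in> T)"
proof -
  define d where "d = Max (insert 0 (deg ` S))"
  have d: "deg p \<le> d" if "p \<in> S" for p unfolding d_def using assms(1) that by (intro Max_ge) auto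
  have "\<exists>T. finite T \<and> S \<subseteq> T \<and> T \<subseteq> N \<and> (\<forall>p\<in>T. deg p \<le> d) \<and>
      (\<forall>p\<in>T. deg p \<ge> 2 \<longrightarrow> d < deg p + j \<longrightarrow> D p \<in> T) \<and>
      (\<forall>p\<in>T. \<forall>q\<in>T. deg q \<le> deg p \<longrightarrow> deg q \<ge> 2 \<longrightarrow> d < deg q + j \<longrightarrow> M p q \<in> T)" for j
  proof (induction j)
    case 0
    then show ?case using assms(1,2) by (intro exI[of _ S]) (auto simp: d leD)
  next
    case (Suc j)
    then obtain T where T: "finite T" "S \<subseteq> T" "T \<subseteq> N" "\<And>p. p \<in> T \<Longrightarrow> deg p \<le> d"
      "\<And>p. \<lbrakk> p \<in> T; deg p \<ge> 2; d < deg p + j \<rbrakk> \<Longrightarrow> D p \<in> T"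
      "\<And>p q. \<lbrakk> p \<in> T; q \<in> T; deg q \<le> deg p; deg q \<ge> 2; d < deg q + j \<rbrakk> \<Longrightarrow> M p q \<in> T"
      by metis
    define D' where "D' = D ` {p \<in> T. deg p \<ge> 2 \<and> d = deg p + j}"
    define C where "C = {(p, q) \<in> T \<times> T. deg q \<le> deg p \<and> deg q \<ge> 2 \<and> d = deg q + j}"
    define M' where "M' = (\<lambda>(p, q). M p q) ` C"
    define T' where "T' = T \<union> (D' \<union> M')"
    have "C \<subseteq> T \<times> T" unfolding C_def by blast
    then have "finite C" using T(1) finite_subset by blast
    then have fin: "finite T'" using T(1) unfolding T'_def D'_def M'_def by simp
    have new: "p \<in> N \<and> deg p + j < d" if "p \<in> D' \<union> M'" for p
      using that
    proof
      assume "p \<in> D'"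
      then obtain q where q: "p = D q" "q \<in> T" "deg q \<ge> 2" "d = deg q + j" unfolding D'_def by blast
      then show ?thesis using D[of q] T(3) by auto
    next
      assume "p \<in> M'"
      then obtain q q' where q: "p = M q q'" "q \<in> T" "q' \<in> T" "deg q' \<le> deg q" "deg q' \<ge> 2" "d = deg q' + j"
        unfolding M'_def C_def by auto
      then show ?thesis using M[of q q'] T(3) by auto
    qed
    have "p \<in> N \<and> deg p \<le> d" if "p \<in> T'" for p
    proof (cases "p \<in> T")
      case False
      then show ?thesis using new[of p] that unfolding T'_def by simp
    qed (use T(3,4) in blast)
    then have N: "T' \<subseteq> N" "\<And>p. p \<in> T' \<Longrightarrow> deg p \<le> d" by blast+
    have old: "p \<in> T" if "p \<in> T'" "d < deg p + Suc j" for p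
    proof (rule ccontr)
      assume "p \<notin> T"
      then show False using that new[of p] unfolding T'_def by simp
    qed
    have "D p \<in> T'" if p: "p \<in> T'" "deg p \<ge> 2" "d < deg p + Suc j" for p
    proof (cases "d < deg p + j")
      case True
      then show ?thesis using T(5)[OF old[OF p(1,3)] p(2)] by (simp add: T'_def)
    next
      case False
      then have "d = deg p + j" using p by simp
      then show ?thesis using old[OF p(1,3)] p(2) by (simp add: T'_def D'_def)
    qed
    moreover have "M p q \<in> T'"
      if p: "p \<in> T'" "q \<in> T'" "deg q \<le> deg p" "deg q \<ge> 2" "d < deg q + Suc j" for p q
    proof -
      have pq: "p \<in> T" "q \<in> T" using old p by auto
      show ?thesis
      proof (cases "d < deg q + j")
        case True
        then show ?thesis using T(6)[OF pq p(3,4)] by (simp add: T'_def)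
      next
        case False
        then have "(p, q) \<in> C" using p pq by (simp add: C_def)
        then show ?thesis unfolding T'_def M'_def by (intro UnI2 image_eqI[of _ _ "(p, q)"]) auto
      qed
    qed
    moreover have "S \<subseteq> T'" using T(2) by (auto simp: T'_def)
    ultimately show ?case using fin N by (intro exI[of _ T'] conjI ballI impI) simp_all
  qed
  from this[of "Suc d"] show ?thesis
    by (elim exE, rename_tac T, rule_tac x = T in exI) auto
qed

section \<open>Polynomial functions over a relatively algebraically closed subfield\<close>

lemma (in cring) pval_pad:
  assumes "\<And>i. a i \<in> carrier R" "x \<in> carrier R"
  shows "pval (\<lambda>i. if i < k then a i else \<zero>) (k + m) x = pval a k x"
proof (induction m)
  case 0
  show ?case unfolding add_0_right by (rule pval_cong) simp
next
  case (Suc m)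
  then show ?case using assms by (simp add: pval_Suc)
qed

text \<open>\<open>K_closed\<close> says that \<open>K\<close> is algebraically closed in the
  ambient ordered field. In the application \<open>K\<close> is the image of the real closed base
  field.\<close>

locale ivt_pair = ivt_field +
  fixes K :: "'a set"
  assumes K_subfield: "subfield K R"
    and K_closed: "\<lbrakk> \<And>i. a i \<in> K; n > 0; a (n - 1) \<noteq> \<zero>; x \<in> carrier R; pval a n x = \<zero> \<rbrakk> \<Longrightarrow> x \<in> K"
begin

lemmas K_subring = subringE[OF subfieldE(1)[OF K_subfield]]

lemma K_carrier: "x \<in> K \<Longrightarrow> x \<in> carrier R"
  using K_subring(1) by blast

text \<open>Polynomials over \<open>K\<close> in \<open>n\<close> variables, taken as functions of
  an assignment \<open>e\<close>. Structural induction is what splits off the last variable in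
  \<open>polyfun_Suc_rep\<close>.\<close>

inductive_set polyfun :: "nat \<Rightarrow> ((nat \<Rightarrow> 'a) \<Rightarrow> 'a) set" for n :: nat where
  polyfun_const: "c \<in> K \<Longrightarrow> (\<lambda>e. c) \<in> polyfun n"
| polyfun_var: "i < n \<Longrightarrow> (\<lambda>e. e i) \<in> polyfun n"
| polyfun_add: "\<lbrakk> f \<in> polyfun n; g \<in> polyfun n \<rbrakk> \<Longrightarrow> (\<lambda>e. f e \<oplus> g e) \<in> polyfun n"
| polyfun_mult: "\<lbrakk> f \<in> polyfun n; g \<in> polyfun n \<rbrakk> \<Longrightarrow> (\<lambda>e. f e \<otimes> g e) \<in> polyfun n"

lemma polyfun_closed: "\<lbrakk> f \<in> polyfun n; range e \<subseteq> carrier R \<rbrakk> \<Longrightarrow> f e \<in> carrier R"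
  by (induction rule: polyfun.induct) (auto simp: K_carrier)

lemma polyfun_in_K: "\<lbrakk> f \<in> polyfun n; range e \<subseteq> K \<rbrakk> \<Longrightarrow> f e \<in> K"
  by (induction rule: polyfun.induct) (auto intro: K_subring(6,7))

lemma polyfun_independent: "\<lbrakk> f \<in> polyfun n; \<And>i. i < n \<Longrightarrow> e i = e' i \<rbrakk> \<Longrightarrow> f e = f e'"
  by (induction rule: polyfun.induct) auto

lemma polyfun_zero: "(\<lambda>e. \<zero>) \<in> polyfun n" and polyfun_one: "(\<lambda>e. \<one>) \<in> polyfun n" and polyfun_m1: "(\<lambda>e. \<ominus> \<one>) \<in> polyfun n"
  using K_subring by (auto intro!: polyfun_const)

lemma polyfun_add_pow: "f \<in> polyfun n \<Longrightarrow> (\<lambda>e. add_pow R (m::nat) (f e)) \<in> polyfun n"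
  by (induction m) (auto intro: polyfun_zero polyfun_add)

lemma polyfun_pow: "f \<in> polyfun n \<Longrightarrow> (\<lambda>e. f e [^] (m::nat)) \<in> polyfun n"
  by (induction m) (auto intro: polyfun_one polyfun_mult)

text \<open>The shape K[X_0, ..., X_(n-1)][X_n], with equality for arguments from the carrier. The
  closure properties that follow bring every polynomial function of \<open>Suc n\<close> variables
  into it.\<close>

definition uni_polyfun :: "nat \<Rightarrow> ((nat \<Rightarrow> 'a) \<Rightarrow> 'a \<Rightarrow> 'a) \<Rightarrow> bool"
  where "uni_polyfun n G \<longleftrightarrow> (\<exists>a k. (\<forall>i. a i \<in> polyfun n) \<and>
    (\<forall>e x. range e \<subseteq> carrier R \<longrightarrow> x \<in> carrier R \<longrightarrow> G e x = pval (\<lambda>i. a i e) k x))"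

lemma uni_polyfunI:
  assumes "\<And>i. a i \<in> polyfun n"
    "\<And>e x. \<lbrakk> range e \<subseteq> carrier R; x \<in> carrier R \<rbrakk> \<Longrightarrow> G e x = pval (\<lambda>i. a i e) k x"
  shows "uni_polyfun n G"
  using assms unfolding uni_polyfun_def by blast

lemma uni_polyfunE:
  assumes "uni_polyfun n G"
  obtains a k where "\<And>i. a i \<in> polyfun n"
    "\<And>e x. \<lbrakk> range e \<subseteq> carrier R; x \<in> carrier R \<rbrakk> \<Longrightarrow> G e x = pval (\<lambda>i. a i e) k x"
  using assms unfolding uni_polyfun_def by blast

lemma uni_polyfun_cong:
  assumes "uni_polyfun n G" "\<And>e x. \<lbrakk> range e \<subseteq> carrier R; x \<in> carrier R \<rbrakk> \<Longrightarrow> G e x = H e x"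
  shows "uni_polyfun n H"
  using assms unfolding uni_polyfun_def by metis

lemma uni_polyfun_coeff: "f \<in> polyfun n \<Longrightarrow> uni_polyfun n (\<lambda>e x. f e)"
  by (rule uni_polyfunI[of "\<lambda>i. f" n _ 1]) (auto simp: pval_Suc polyfun_closed)

lemma uni_polyfun_add:
  assumes "uni_polyfun n G" "uni_polyfun n H"
  shows "uni_polyfun n (\<lambda>e x. G e x \<oplus> H e x)"
proof -
  obtain a k where a: "\<And>i. a i \<in> polyfun n"
    "\<And>e x. \<lbrakk> range e \<subseteq> carrier R; x \<in> carrier R \<rbrakk> \<Longrightarrow> G e x = pval (\<lambda>i. a i e) k x"
    using uni_polyfunE[OF assms(1)] by blast
  obtain b l where b: "\<And>i. b i \<in> polyfun n"
    "\<And>e x. \<lbrakk> range e \<subseteq> carrier R; x \<in> carrier R \<rbrakk> \<Longrightarrow> H e x = pval (\<lambda>i. b i e) l x"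
    using uni_polyfunE[OF assms(2)] by blast
  let ?c = "\<lambda>i e. (if i < k then a i e else \<zero>) \<oplus> (if i < l then b i e else \<zero>)"
  show ?thesis
  proof (rule uni_polyfunI[of ?c n _ "k + l"])
    show "?c i \<in> polyfun n" for i
      using a(1) b(1) by (cases "i < k"; cases "i < l") (auto intro!: polyfun_add polyfun_zero)
    fix e :: "nat \<Rightarrow> 'a" and x assume e: "range e \<subseteq> carrier R" "x \<in> carrier R"
    have cl: "a i e \<in> carrier R" "b i e \<in> carrier R" for i using a(1) b(1) e polyfun_closed by blast+
    have "pval (\<lambda>i. ?c i e) (k + l) x =
        pval (\<lambda>i. if i < k then a i e else \<zero>) (k + l) x \<oplus> pval (\<lambda>i. if i < l then b i e else \<zero>) (l + k) x"
      using pval_add[of "\<lambda>i. if i < k then a i e else \<zero>" "\<lambda>i. if i < l then b i e else \<zero>" x "k + l"] cl e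
      by (simp add: add.commute)
    also have "\<dots> = pval (\<lambda>i. a i e) k x \<oplus> pval (\<lambda>i. b i e) l x"
      using pval_pad[of "\<lambda>i. a i e" x k l] pval_pad[of "\<lambda>i. b i e" x l k] cl e by simp
    finally show "G e x \<oplus> H e x = pval (\<lambda>i. ?c i e) (k + l) x" using a(2) b(2) e by simp
  qed
qed

lemma uni_polyfun_coeff_mult:
  assumes "f \<in> polyfun n" "uni_polyfun n G"
  shows "uni_polyfun n (\<lambda>e x. f e \<otimes> G e x)"
proof -
  obtain a k where a: "\<And>i. a i \<in> polyfun n"
    "\<And>e x. \<lbrakk> range e \<subseteq> carrier R; x \<in> carrier R \<rbrakk> \<Longrightarrow> G e x = pval (\<lambda>i. a i e) k x"
    using uni_polyfunE[OF assms(2)] by blast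
  show ?thesis
  proof (rule uni_polyfunI[of "\<lambda>i e. f e \<otimes> a i e" n _ k])
    show "(\<lambda>e. f e \<otimes> a i e) \<in> polyfun n" for i using assms(1) a(1) by (rule polyfun_mult)
    fix e :: "nat \<Rightarrow> 'a" and x assume e: "range e \<subseteq> carrier R" "x \<in> carrier R"
    have cl: "f e \<in> carrier R" "a i e \<in> carrier R" for i using assms(1) a(1) e polyfun_closed by blast+
    show "f e \<otimes> G e x = pval (\<lambda>i. f e \<otimes> a i e) k x"
      using pval_smult[of "\<lambda>i. a i e" "f e" x k] cl e a(2) by simp
  qed
qed

lemma uni_polyfun_var_mult:
  assumes "uni_polyfun n G"
  shows "uni_polyfun n (\<lambda>e x. x \<otimes> G e x)"
proof -
  obtain a k where a: "\<And>i. a i \<in> polyfun n"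
    "\<And>e x. \<lbrakk> range e \<subseteq> carrier R; x \<in> carrier R \<rbrakk> \<Longrightarrow> G e x = pval (\<lambda>i. a i e) k x"
    using uni_polyfunE[OF assms] by blast
  let ?b = "\<lambda>i. case i of 0 \<Rightarrow> (\<lambda>e. \<zero>) | Suc j \<Rightarrow> a j"
  show ?thesis
  proof (rule uni_polyfunI[of ?b n _ "Suc k"])
    show b: "?b i \<in> polyfun n" for i using a(1) polyfun_zero by (cases i) auto
    fix e :: "nat \<Rightarrow> 'a" and x assume e: "range e \<subseteq> carrier R" "x \<in> carrier R"
    have cl: "a i e \<in> carrier R" for i using a(1) e polyfun_closed by blast
    have "pval (\<lambda>i. ?b i e) (Suc k) x = \<zero> \<oplus> x \<otimes> pval (\<lambda>i. a i e) k x"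
      using pval_shift[of "\<lambda>i. ?b i e", OF polyfun_closed[OF b e(1)] e(2), of k] by simp
    then show "x \<otimes> G e x = pval (\<lambda>i. ?b i e) (Suc k) x" using a(2) cl e by simp
  qed
qed

lemma uni_polyfun_closed:
  assumes "uni_polyfun n G" "range e \<subseteq> carrier R" "x \<in> carrier R"
  shows "G e x \<in> carrier R"
proof -
  obtain a k where a: "\<And>i. a i \<in> polyfun n"
    "\<And>e x. \<lbrakk> range e \<subseteq> carrier R; x \<in> carrier R \<rbrakk> \<Longrightarrow> G e x = pval (\<lambda>i. a i e) k x"
    using uni_polyfunE[OF assms(1)] by blast
  have "a i e \<in> carrier R" for i using polyfun_closed[OF a(1) assms(2)] .
  then show ?thesis using a(2)[OF assms(2,3)] assms(3) by simp
qed

text \<open>Horner's recursion in the first factor reduces products to those with a coefficient and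
  with the variable.\<close>

lemma uni_polyfun_mult:
  assumes "uni_polyfun n G" "uni_polyfun n H"
  shows "uni_polyfun n (\<lambda>e x. G e x \<otimes> H e x)"
proof -
  have "uni_polyfun n (\<lambda>e x. pval (\<lambda>i. a i e) k x \<otimes> H e x)" if "\<And>i. a i \<in> polyfun n" for a k
    using that
  proof (induction k arbitrary: a)
    case 0
    show ?case by (rule uni_polyfun_cong[OF uni_polyfun_coeff[OF polyfun_zero]]) (use uni_polyfun_closed[OF assms(2)] in simp)
  next
    case (Suc k)
    have "uni_polyfun n (\<lambda>e x. a 0 e \<otimes> H e x \<oplus> x \<otimes> (pval (\<lambda>i. a (Suc i) e) k x \<otimes> H e x))"
      using Suc assms(2) by (intro uni_polyfun_add uni_polyfun_coeff_mult uni_polyfun_var_mult) auto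
    then show ?case
    proof (rule uni_polyfun_cong)
      fix e :: "nat \<Rightarrow> 'a" and x assume e: "range e \<subseteq> carrier R" "x \<in> carrier R"
      have cl: "a i e \<in> carrier R" for i using Suc.prems e polyfun_closed by blast
      define h u v where "h = H e x" and "u = a 0 e" and "v = pval (\<lambda>i. a (Suc i) e) k x"
      have cl': "h \<in> carrier R" "u \<in> carrier R" "v \<in> carrier R"
        using uni_polyfun_closed[OF assms(2) e] cl e by (auto simp: h_def u_def v_def)
      show "a 0 e \<otimes> H e x \<oplus> x \<otimes> (pval (\<lambda>i. a (Suc i) e) k x \<otimes> H e x) = pval (\<lambda>i. a i e) (Suc k) x \<otimes> H e x"
        unfolding pval_shift[of "\<lambda>i. a i e", OF cl e(2)] h_def[symmetric] u_def[symmetric] v_def[symmetric]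
        using cl' e(2) by algebra
    qed
  qed
  moreover obtain a k where "\<And>i. a i \<in> polyfun n"
    "\<And>e x. \<lbrakk> range e \<subseteq> carrier R; x \<in> carrier R \<rbrakk> \<Longrightarrow> G e x = pval (\<lambda>i. a i e) k x"
    using uni_polyfunE[OF assms(1)] by blast
  ultimately show ?thesis using uni_polyfun_cong[of n "\<lambda>e x. pval (\<lambda>i. a i e) k x \<otimes> H e x"] by simp
qed

lemma polyfun_Suc_rep: "f \<in> polyfun (Suc n) \<Longrightarrow> uni_polyfun n (\<lambda>e x. f (e(n := x)))"
proof (induction rule: polyfun.induct)
  case (polyfun_const c)
  then show ?case using uni_polyfun_coeff[OF polyfun.polyfun_const] by simp
next
  case (polyfun_var i)
  show ?case
  proof (cases "i = n")
    case True
    show ?thesis by (rule uni_polyfun_cong[OF uni_polyfun_var_mult[OF uni_polyfun_coeff[OF polyfun_one]]]) (use True in auto)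
  next
    case False
    then show ?thesis using uni_polyfun_coeff[OF polyfun.polyfun_var[of i n]] polyfun_var by simp
  qed
qed (auto intro: uni_polyfun_add uni_polyfun_mult)

section \<open>Sign conditions at a point and elimination of one variable\<close>

text \<open>The property \<open>\<Phi>\<close> is enforced by finitely many sign conditions that hold at \<open>c\<close>. Thus one branch of the
  case distinctions of a quantifier elimination is followed, the one to which \<open>c\<close> belongs.\<close>

definition near :: "nat \<Rightarrow> (nat \<Rightarrow> 'a) \<Rightarrow> ((nat \<Rightarrow> 'a) \<Rightarrow> bool) \<Rightarrow> bool"
  where "near n c \<Phi> \<longleftrightarrow> (\<exists>Q. finite Q \<and> Q \<subseteq> polyfun n \<and>
    (\<forall>e. range e \<subseteq> carrier R \<longrightarrow> (\<forall>q\<in>Q. sg (q e) = sg (q c)) \<longrightarrow> \<Phi> e))"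

lemma near_sign: "q \<in> polyfun n \<Longrightarrow> near n c (\<lambda>e. sg (q e) = sg (q c))"
  unfolding near_def by (intro exI[of _ "{q}"]) auto

lemma near_mono: "\<lbrakk> near n c \<Phi>; \<And>e. \<lbrakk> range e \<subseteq> carrier R; \<Phi> e \<rbrakk> \<Longrightarrow> \<Psi> e \<rbrakk> \<Longrightarrow> near n c \<Psi>"
  unfolding near_def by metis

lemma near_triv: "(\<And>e. range e \<subseteq> carrier R \<Longrightarrow> \<Phi> e) \<Longrightarrow> near n c \<Phi>"
  unfolding near_def by (intro exI[of _ "{}"]) auto

lemma near_conj:
  assumes "near n c \<Phi>" "near n c \<Psi>"
  shows "near n c (\<lambda>e. \<Phi> e \<and> \<Psi> e)"
proof -
  obtain Q Q' where "finite Q" "Q \<subseteq> polyfun n" "finite Q'" "Q' \<subseteq> polyfun n"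
    "\<forall>e. range e \<subseteq> carrier R \<longrightarrow> (\<forall>q\<in>Q. sg (q e) = sg (q c)) \<longrightarrow> \<Phi> e"
    "\<forall>e. range e \<subseteq> carrier R \<longrightarrow> (\<forall>q\<in>Q'. sg (q e) = sg (q c)) \<longrightarrow> \<Psi> e"
    using assms unfolding near_def by metis
  then show ?thesis unfolding near_def by (intro exI[of _ "Q \<union> Q'"]) auto
qed

lemma near_ball:
  assumes "finite I" "\<And>i. i \<in> I \<Longrightarrow> near n c (\<Phi> i)"
  shows "near n c (\<lambda>e. \<forall>i\<in>I. \<Phi> i e)"
  using assms
proof (induction I)
  case empty
  show ?case by (rule near_triv) simp
next
  case (insert i I)
  then have "near n c (\<lambda>e. \<Phi> i e \<and> (\<forall>i\<in>I. \<Phi> i e))" by (intro near_conj) auto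
  then show ?case by (rule near_mono) auto
qed

lemma near_self: "\<lbrakk> near n c \<Phi>; range c \<subseteq> carrier R \<rbrakk> \<Longrightarrow> \<Phi> c"
  unfolding near_def by auto

abbreviation ev :: "(nat \<Rightarrow> (nat \<Rightarrow> 'a) \<Rightarrow> 'a) \<times> nat \<Rightarrow> (nat \<Rightarrow> 'a) \<Rightarrow> 'a \<Rightarrow> 'a"
  where "ev p e x \<equiv> pval (\<lambda>i. fst p i e) (snd p) x"

text \<open>Polynomials with parameters \<open>e\<close> whose formal degree is their true degree at
  \<open>c\<close>; the count 0 stands for the zero polynomial.\<close>

definition nonvanishing :: "nat \<Rightarrow> (nat \<Rightarrow> 'a) \<Rightarrow> ((nat \<Rightarrow> (nat \<Rightarrow> 'a) \<Rightarrow> 'a) \<times> nat) set"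
  where "nonvanishing n c =
    {p. (\<forall>i. fst p i \<in> polyfun n) \<and> (snd p > 0 \<longrightarrow> fst p (snd p - 1) c \<noteq> \<zero>)}"

text \<open>Top coefficients that vanish at \<open>c\<close> are dropped. That they vanish at
  \<open>e\<close> as well is one of the sign conditions.\<close>

lemma truncate:
  assumes "\<And>i. a i \<in> polyfun n" "range c \<subseteq> carrier R"
  shows "\<exists>l\<le>k. (a, l) \<in> nonvanishing n c \<and>
    near n c (\<lambda>e. \<forall>x\<in>carrier R. pval (\<lambda>i. a i e) k x = pval (\<lambda>i. a i e) l x)"
proof (induction k)
  case 0
  show ?case using assms by (intro exI[of _ 0]) (auto simp: nonvanishing_def intro: near_triv)
next
  case (Suc k)
  show ?case
  proof (cases "a k c = \<zero>")
    case True
    obtain l where l: "l \<le> k" "(a, l) \<in> nonvanishing n c"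
      "near n c (\<lambda>e. \<forall>x\<in>carrier R. pval (\<lambda>i. a i e) k x = pval (\<lambda>i. a i e) l x)"
      using Suc by blast
    have "near n c (\<lambda>e. \<forall>x\<in>carrier R. pval (\<lambda>i. a i e) (Suc k) x = pval (\<lambda>i. a i e) l x)"
    proof (rule near_mono[OF near_conj[OF l(3) near_sign[OF assms(1)[of k]]]])
      fix e :: "nat \<Rightarrow> 'a"
      assume e: "range e \<subseteq> carrier R"
        "(\<forall>x\<in>carrier R. pval (\<lambda>i. a i e) k x = pval (\<lambda>i. a i e) l x) \<and> sg (a k e) = sg (a k c)"
      have cl: "a i e \<in> carrier R" for i using polyfun_closed[OF assms(1) e(1)] .
      have "sg (a k e) = 0" using e(2) True by simp
      then have "a k e = \<zero>" using cl sg_0_iff by blast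
      then show "\<forall>x\<in>carrier R. pval (\<lambda>i. a i e) (Suc k) x = pval (\<lambda>i. a i e) l x"
        using e(2) cl by (simp add: pval_Suc)
    qed
    then show ?thesis using l by (intro exI[of _ l]) auto
  next
    case False
    then show ?thesis using assms(1)
      by (intro exI[of _ "Suc k"]) (auto simp: nonvanishing_def intro: near_triv)
  qed
qed

text \<open>Multiplying the dividend by the square of the leading coefficient \<open>b l\<close> of the divisor keeps
  its sign wherever that coefficient does not vanish.\<close>

lemma pseudo_remainder:
  assumes "\<And>i. a i \<in> polyfun n" "\<And>i. b i \<in> polyfun n"
  shows "\<exists>r j. (\<forall>i. r i \<in> polyfun n) \<and> j \<le> l \<and>
    (\<forall>e x. range e \<subseteq> carrier R \<longrightarrow> x \<in> carrier R \<longrightarrow> b l e \<noteq> \<zero> \<longrightarrow>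
      pval (\<lambda>i. b i e) (Suc l) x = \<zero> \<longrightarrow>
      sg (pval (\<lambda>i. r i e) j x) = sg (pval (\<lambda>i. a i e) k x))"
  using assms(1)
proof (induction k arbitrary: a)
  case 0
  then show ?case by (intro exI[of _ a] exI[of _ 0]) auto
next
  case (Suc k)
  show ?case
  proof (cases "Suc k \<le> l")
    case True
    then show ?thesis using Suc.prems by (intro exI[of _ a] exI[of _ "Suc k"]) auto
  next
    case False
    define d where "d = k - l"
    have k: "k = d + l" using False by (simp add: d_def)
    define s where "s e = b l e \<otimes> b l e" for e
    define t where "t e = \<ominus> \<one> \<otimes> (a k e \<otimes> b l e)" for e
    have st: "s \<in> polyfun n" "t \<in> polyfun n"
      unfolding s_def t_def using Suc.prems assms(2) by (auto intro!: polyfun_mult polyfun_m1)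
    define sh where "sh i e = (if i < d then \<zero> else b (i - d) e)" for i e
    have sh: "sh i \<in> polyfun n" for i
      unfolding sh_def using assms(2) polyfun_zero by (cases "i < d") auto
    \<comment> \<open>One step of long division, scaled by the square of b_l: a_k b_l X^d times the
      divisor is subtracted. The coefficient of X^k cancels and is no longer counted, so
      \<open>k\<close> coefficients remain.\<close>
    define a' where "a' i e = s e \<otimes> a i e \<oplus> t e \<otimes> sh i e" for i e
    have a': "a' i \<in> polyfun n" for i
      unfolding a'_def using st sh Suc.prems by (auto intro!: polyfun_add polyfun_mult)
    have sgn: "sg (pval (\<lambda>i. a' i e) k x) = sg (pval (\<lambda>i. a i e) (Suc k) x)"
      if e: "range e \<subseteq> carrier R" "x \<in> carrier R" "b l e \<noteq> \<zero>" "pval (\<lambda>i. b i e) (Suc l) x = \<zero>" for e x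
    proof -
      have cl: "a i e \<in> carrier R" "b i e \<in> carrier R" "s e \<in> carrier R" "t e \<in> carrier R" "sh i e \<in> carrier R" for i
        using polyfun_closed[OF _ e(1)] Suc.prems assms(2) st sh by blast+
      define u v y z where "u = pval (\<lambda>i. a i e) k x" and "v = pval (\<lambda>i. b i e) l x"
        and "y = x [^] d" and "z = x [^] l"
      define p q where "p = a k e" and "q = b l e"
      have c: "u \<in> carrier R" "v \<in> carrier R" "y \<in> carrier R" "z \<in> carrier R" "p \<in> carrier R" "q \<in> carrier R"
        using cl e(2) by (auto simp: u_def v_def y_def z_def p_def q_def)
      have "pval (\<lambda>i. a' i e) k x = pval (\<lambda>i. s e \<otimes> a i e) k x \<oplus> pval (\<lambda>i. t e \<otimes> sh i e) k x"
        unfolding a'_def by (rule pval_add) (use cl e in auto)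
      also have "pval (\<lambda>i. s e \<otimes> a i e) k x = s e \<otimes> u"
        unfolding u_def by (rule pval_smult) (use cl e in auto)
      also have "pval (\<lambda>i. t e \<otimes> sh i e) k x = t e \<otimes> pval (\<lambda>i. sh i e) k x"
        by (rule pval_smult) (use cl e in auto)
      also have "pval (\<lambda>i. sh i e) k x = y \<otimes> v"
        unfolding sh_def k y_def v_def by (rule pval_raise) (use cl e in auto)
      finally have 1: "pval (\<lambda>i. a' i e) k x = q \<otimes> q \<otimes> u \<oplus> \<ominus> \<one> \<otimes> (p \<otimes> q) \<otimes> (y \<otimes> v)"
        by (simp add: s_def t_def p_def q_def)
      have "q \<otimes> z \<oplus> v = \<zero>" using e(4) by (simp add: pval_Suc q_def z_def v_def)
      then have v: "v = \<ominus> (q \<otimes> z)" using c by (metis add.m_comm m_closed minus_equality)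
      have "q \<otimes> q \<otimes> u \<oplus> \<ominus> \<one> \<otimes> (p \<otimes> q) \<otimes> (y \<otimes> \<ominus> (q \<otimes> z)) = q \<otimes> q \<otimes> (p \<otimes> (y \<otimes> z) \<oplus> u)"
        using c by algebra
      moreover have "pval (\<lambda>i. a i e) (Suc k) x = p \<otimes> (y \<otimes> z) \<oplus> u"
        using e(2) by (simp add: pval_Suc u_def p_def y_def z_def k nat_pow_mult)
      ultimately have "pval (\<lambda>i. a' i e) k x = q \<otimes> q \<otimes> pval (\<lambda>i. a i e) (Suc k) x"
        using 1 v by simp
      moreover have "sg (q \<otimes> q) = 1"
        using sg_range[of q] sg_0_iff[of q] e(3) c by (auto simp: sg_mult q_def)
      ultimately show ?thesis using c cl e(2) by (simp add: sg_mult)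
    qed
    obtain r j where r: "\<forall>i. r i \<in> polyfun n" "j \<le> l"
      "\<forall>e x. range e \<subseteq> carrier R \<longrightarrow> x \<in> carrier R \<longrightarrow> b l e \<noteq> \<zero> \<longrightarrow>
        pval (\<lambda>i. b i e) (Suc l) x = \<zero> \<longrightarrow>
        sg (pval (\<lambda>i. r i e) j x) = sg (pval (\<lambda>i. a' i e) k x)"
      using Suc.IH[of a'] a' by blast
    show ?thesis using r sgn by (intro exI[of _ r] exI[of _ j]) simp
  qed
qed

text \<open>The pseudo-remainder, cut down to its degree at \<open>c\<close>. It works at those
  \<open>e\<close> where the leading coefficient of \<open>q\<close> does not vanish, and this is
  enforced by a sign condition.\<close>

lemma remainder_exists:
  assumes "p \<in> nonvanishing n c" "q \<in> nonvanishing n c" "snd q \<ge> 2" and c: "range c \<subseteq> carrier R"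
  shows "\<exists>r\<in>nonvanishing n c. snd r < snd q \<and>
    near n c (\<lambda>e. \<forall>x\<in>carrier R. ev q e x = \<zero> \<longrightarrow> sg (ev r e x) = sg (ev p e x))"
proof -
  obtain l where l: "snd q = Suc l" using assms(3) by (cases "snd q") auto
  have polyfun: "fst p i \<in> polyfun n" "fst q i \<in> polyfun n" for i using assms unfolding nonvanishing_def by auto
  have lc: "fst q l c \<noteq> \<zero>" using assms l unfolding nonvanishing_def by auto
  obtain r j where r: "\<And>i. r i \<in> polyfun n" "j \<le> l"
    "\<And>e x. \<lbrakk> range e \<subseteq> carrier R; x \<in> carrier R; fst q l e \<noteq> \<zero>; ev q e x = \<zero> \<rbrakk> \<Longrightarrow>
      sg (pval (\<lambda>i. r i e) j x) = sg (ev p e x)"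
    using pseudo_remainder[of "fst p" n "fst q" l "snd p"] polyfun l by metis
  obtain i where i: "i \<le> j" "(r, i) \<in> nonvanishing n c"
    "near n c (\<lambda>e. \<forall>x\<in>carrier R. pval (\<lambda>i. r i e) j x = pval (\<lambda>m. r m e) i x)"
    using truncate[of r n c j] r(1) c by blast
  have "near n c (\<lambda>e. \<forall>x\<in>carrier R. ev q e x = \<zero> \<longrightarrow> sg (ev (r, i) e x) = sg (ev p e x))"
  proof (rule near_mono[OF near_conj[OF i(3) near_sign[OF polyfun(2)[of l]]]])
    fix e :: "nat \<Rightarrow> 'a"
    assume e: "range e \<subseteq> carrier R"
      "(\<forall>x\<in>carrier R. pval (\<lambda>i. r i e) j x = pval (\<lambda>m. r m e) i x) \<and> sg (fst q l e) = sg (fst q l c)"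
    then have "fst q l e \<noteq> \<zero>" using lc sg_0_iff[OF polyfun_closed[OF polyfun(2) c]] by auto
    then show "\<forall>x\<in>carrier R. ev q e x = \<zero> \<longrightarrow> sg (ev (r, i) e x) = sg (ev p e x)"
      using r(3)[OF e(1)] e(2) by auto
  qed
  moreover have "snd (r, i) < snd q" using i(1) r(2) l by simp
  ultimately show ?thesis using i(2) by blast
qed

definition der_pair :: "(nat \<Rightarrow> (nat \<Rightarrow> 'a) \<Rightarrow> 'a) \<times> nat \<Rightarrow> (nat \<Rightarrow> (nat \<Rightarrow> 'a) \<Rightarrow> 'a) \<times> nat"
  where "der_pair p = (\<lambda>i e. pder (\<lambda>j. fst p j e) i, snd p - 1)"

lemma der_pair:
  assumes "p \<in> nonvanishing n c" "snd p \<ge> 2" and c: "range c \<subseteq> carrier R"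
  shows "der_pair p \<in> nonvanishing n c"
proof -
  have polyfun: "fst p i \<in> polyfun n" for i using assms unfolding nonvanishing_def by auto
  have "fst (der_pair p) i \<in> polyfun n" for i
    unfolding der_pair_def pder_def fst_conv by (rule polyfun_add_pow[OF polyfun])
  \<comment> \<open>The leading coefficient of the derivative is a positive integer multiple of that
    of \<open>p\<close>, hence nonzero in an ordered field.\<close>
  moreover have "pder (\<lambda>j. fst p j c) (snd p - 2) \<noteq> \<zero>"
  proof -
    have "Suc (snd p - 2) = snd p - 1" using assms(2) by simp
    then have "fst p (Suc (snd p - 2)) c \<noteq> \<zero>" using assms unfolding nonvanishing_def by auto
    then have "sg (fst p (Suc (snd p - 2)) c) \<noteq> 0" using sg_0_iff polyfun_closed[OF polyfun c] by blast
    then have "sg (pder (\<lambda>j. fst p j c) (snd p - 2)) \<noteq> 0"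
      unfolding pder_def using sg_add_pow polyfun_closed[OF polyfun c] by simp
    then show ?thesis by auto
  qed
  ultimately show ?thesis unfolding nonvanishing_def by (auto simp: der_pair_def numeral_2_eq_2)
qed

text \<open>The family is first closed under derivatives and remainders. As the closure is finite,
  finitely many sign conditions ensure that leading signs agree at \<open>c\<close> and
  \<open>e\<close> and that the remainders work at \<open>e\<close>; then the specialisations at
  \<open>c\<close> and \<open>e\<close> are matched families.\<close>

lemma near_sign_transfer_nonvanishing:
  assumes S: "finite S" "S \<subseteq> nonvanishing n c" and c: "range c \<subseteq> carrier R"
  shows "near n c (\<lambda>e. \<forall>x\<in>carrier R. \<exists>y\<in>carrier R. \<forall>p\<in>S. sg (ev p c x) = sg (ev p e y))"
proof -
  let ?N = "nonvanishing n c"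
  define good where "good p q r \<longleftrightarrow> r \<in> ?N \<and> snd r < snd q \<and>
    near n c (\<lambda>e. \<forall>x\<in>carrier R. ev q e x = \<zero> \<longrightarrow> sg (ev r e x) = sg (ev p e x))" for p q r
  have "\<exists>r. good p q r" if "p \<in> ?N" "q \<in> ?N" "snd q \<ge> 2" for p q
    using remainder_exists[OF that c] unfolding good_def by blast
  then obtain M where "\<And>p q. \<lbrakk> p \<in> ?N; q \<in> ?N; snd q \<ge> 2 \<rbrakk> \<Longrightarrow> good p q (M p q)"
    by metis
  note M = this[unfolded good_def]
  have "\<exists>T. finite T \<and> S \<subseteq> T \<and> T \<subseteq> ?N \<and> (\<forall>p\<in>T. snd p \<ge> 2 \<longrightarrow> der_pair p \<in> T) \<and>
    (\<forall>p\<in>T. \<forall>q\<in>T. snd q \<le> snd p \<longrightarrow> snd q \<ge> 2 \<longrightarrow> M p q \<in> T)"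
  proof (rule finite_descending_closure[OF S])
    show "der_pair p \<in> ?N \<and> snd (der_pair p) < snd p" if "p \<in> ?N" "snd p \<ge> 2" for p
      using der_pair[OF that c] that(2) by (simp add: der_pair_def)
    show "M p q \<in> ?N \<and> snd (M p q) < snd q"
      if "p \<in> ?N" "q \<in> ?N" "snd q \<le> snd p" "snd q \<ge> 2" for p q
      using M[OF that(1,2,4)] by blast
  qed
  then obtain T where T: "finite T" "S \<subseteq> T" "T \<subseteq> ?N" "\<And>p. \<lbrakk> p \<in> T; snd p \<ge> 2 \<rbrakk> \<Longrightarrow> der_pair p \<in> T"
    "\<And>p q. \<lbrakk> p \<in> T; q \<in> T; snd q \<le> snd p; snd q \<ge> 2 \<rbrakk> \<Longrightarrow> M p q \<in> T"
    by metis
  have polyfun: "fst p i \<in> polyfun n" if "p \<in> T" for p i using that T(3) unfolding nonvanishing_def by auto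
  define rem_ok where "rem_ok p q e \<longleftrightarrow> (snd q \<ge> 2 \<longrightarrow>
    (\<forall>x\<in>carrier R. ev q e x = \<zero> \<longrightarrow> sg (ev (M p q) e x) = sg (ev p e x)))" for p q e
  have rem: "near n c (rem_ok p q)" if "p \<in> T" "q \<in> T" for p q
  proof (cases "snd q \<ge> 2")
    case True
    then show ?thesis using M[of p q] that T(3) unfolding rem_ok_def by auto
  qed (auto simp: rem_ok_def intro: near_triv)
  have lead: "near n c (\<lambda>e. sg (fst p (snd p - 1) e) = sg (fst p (snd p - 1) c))" if "p \<in> T" for p
    using near_sign polyfun that by blast
  have "near n c (\<lambda>e. (\<forall>p\<in>T. \<forall>q\<in>T. rem_ok p q e) \<and>
      (\<forall>p\<in>T. sg (fst p (snd p - 1) e) = sg (fst p (snd p - 1) c)))"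
    using T(1) rem lead by (intro near_conj near_ball) auto
  note nr = this
  \<comment> \<open>The remainders also have to work at \<open>c\<close>, which satisfies its own
    sign conditions.\<close>
  have rem_c: "rem_ok p q c" if "p \<in> T" "q \<in> T" for p q using near_self[OF nr c] that by blast
  show ?thesis
  proof (rule near_mono[OF nr])
    fix e :: "nat \<Rightarrow> 'a"
    assume e: "range e \<subseteq> carrier R" and h: "(\<forall>p\<in>T. \<forall>q\<in>T. rem_ok p q e) \<and>
      (\<forall>p\<in>T. sg (fst p (snd p - 1) e) = sg (fst p (snd p - 1) c))"
    \<comment> \<open>The locale asks for coefficients in the carrier at every index, also outside
      \<open>T\<close>; hence the default zero.\<close>
    define A where "A p i = (if p \<in> T then fst p i c else \<zero>)" for p i
    define B where "B p i = (if p \<in> T then fst p i e else \<zero>)" for p i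
    have AB: "A p = (\<lambda>i. fst p i c)" "B p = (\<lambda>i. fst p i e)" if "p \<in> T" for p
      using that by (auto simp: A_def B_def)
    interpret matched_polys R sg T A B snd
    proof
      show "finite T" by fact
      show "A p i \<in> carrier R" "B p i \<in> carrier R" for p i
        using polyfun_closed[OF polyfun c, of p i] polyfun_closed[OF polyfun e, of p i] by (simp_all add: A_def B_def)
      show "A p (snd p - 1) \<noteq> \<zero> \<and> sg (B p (snd p - 1)) = sg (A p (snd p - 1))"
        if "p \<in> T" "snd p > 0" for p
        using that T(3) h unfolding nonvanishing_def by (auto simp: AB)
      show "\<exists>i\<in>T. snd i = snd p - 1 \<and>
        (\<forall>x\<in>carrier R. pval (A i) (snd i) x = pval (pder (A p)) (snd p - 1) x) \<and>
        (\<forall>x\<in>carrier R. pval (B i) (snd i) x = pval (pder (B p)) (snd p - 1) x)"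
        if "p \<in> T" "snd p \<ge> 2" for p
        using T(4)[OF that] that by (intro bexI[of _ "der_pair p"]) (auto simp: AB, auto simp: der_pair_def)
      show "\<exists>r\<in>T. snd r < snd q \<and>
        (\<forall>x\<in>carrier R. pval (A q) (snd q) x = \<zero> \<longrightarrow> sg (pval (A r) (snd r) x) = sg (pval (A p) (snd p) x)) \<and>
        (\<forall>x\<in>carrier R. pval (B q) (snd q) x = \<zero> \<longrightarrow> sg (pval (B r) (snd r) x) = sg (pval (B p) (snd p) x))"
        if pq: "p \<in> T" "q \<in> T" "snd q \<le> snd p" "snd q \<ge> 2" for p q
      proof (intro bexI[of _ "M p q"] conjI)
        show MT: "M p q \<in> T" using T(5)[OF pq] .
        show "snd (M p q) < snd q" using M[of p q] pq T(3) by blast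
        show "\<forall>x\<in>carrier R. pval (A q) (snd q) x = \<zero> \<longrightarrow> sg (pval (A (M p q)) (snd (M p q)) x) = sg (pval (A p) (snd p) x)"
          using rem_c[OF pq(1,2)] pq(4) unfolding AB[OF MT] AB[OF pq(1)] AB[OF pq(2)] rem_ok_def by blast
        have "rem_ok p q e" using h pq by blast
        then show "\<forall>x\<in>carrier R. pval (B q) (snd q) x = \<zero> \<longrightarrow> sg (pval (B (M p q)) (snd (M p q)) x) = sg (pval (B p) (snd p) x)"
          using pq(4) unfolding AB[OF MT] AB[OF pq(1)] AB[OF pq(2)] rem_ok_def by blast
      qed
    qed
    show "\<forall>x\<in>carrier R. \<exists>y\<in>carrier R. \<forall>p\<in>S. sg (ev p c x) = sg (ev p e y)"
    proof
      fix x assume "x \<in> carrier R"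
      then obtain y where y: "y \<in> carrier R" "\<forall>j\<in>T. sg (pval (A j) (snd j) x) = sg (pval (B j) (snd j) y)"
        using sign_transfer by blast
      have "sg (ev p c x) = sg (ev p e y)" if "p \<in> S" for p
      proof -
        have "p \<in> T" using that T(2) by blast
        then show ?thesis using y(2) by (simp add: AB)
      qed
      then show "\<exists>y\<in>carrier R. \<forall>p\<in>S. sg (ev p c x) = sg (ev p e y)" using y(1) by blast
    qed
  qed
qed

lemma near_sign_transfer:
  assumes S: "finite S" "\<And>p i. p \<in> S \<Longrightarrow> fst p i \<in> polyfun n" and c: "range c \<subseteq> carrier R"
  shows "near n c (\<lambda>e. \<forall>x\<in>carrier R. \<exists>y\<in>carrier R. \<forall>p\<in>S. sg (ev p c x) = sg (ev p e y))"
proof -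
  define good where "good p q \<longleftrightarrow> q \<in> nonvanishing n c \<and>
    near n c (\<lambda>e. \<forall>x\<in>carrier R. ev p e x = ev q e x)" for p q
  have "\<exists>q. good p q" if p: "p \<in> S" for p
  proof -
    obtain l where "(fst p, l) \<in> nonvanishing n c"
      "near n c (\<lambda>e. \<forall>x\<in>carrier R. ev p e x = pval (\<lambda>i. fst p i e) l x)"
      using truncate[of "fst p" n c "snd p"] S(2)[OF p] c by blast
    then show ?thesis unfolding good_def by (intro exI[of _ "(fst p, l)"]) simp
  qed
  then obtain g where "\<And>p. p \<in> S \<Longrightarrow> good p (g p)" by metis
  then have g: "\<And>p. p \<in> S \<Longrightarrow> g p \<in> nonvanishing n c"
    "\<And>p. p \<in> S \<Longrightarrow> near n c (\<lambda>e. \<forall>x\<in>carrier R. ev p e x = ev (g p) e x)"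
    unfolding good_def by auto
  have 1: "near n c (\<lambda>e. \<forall>x\<in>carrier R. \<exists>y\<in>carrier R. \<forall>p\<in>g ` S. sg (ev p c x) = sg (ev p e y))"
    by (rule near_sign_transfer_nonvanishing) (use S g c in auto)
  have 2: "near n c (\<lambda>e. \<forall>p\<in>S. \<forall>x\<in>carrier R. ev p e x = ev (g p) e x)"
    by (rule near_ball[OF S(1) g(2)])
  note gc = near_self[OF 2 c]
  show ?thesis
  proof (rule near_mono[OF near_conj[OF 1 2]])
    fix e :: "nat \<Rightarrow> 'a"
    assume "range e \<subseteq> carrier R" and h: "(\<forall>x\<in>carrier R. \<exists>y\<in>carrier R. \<forall>p\<in>g ` S. sg (ev p c x) = sg (ev p e y)) \<and>
       (\<forall>p\<in>S. \<forall>x\<in>carrier R. ev p e x = ev (g p) e x)"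
    show "\<forall>x\<in>carrier R. \<exists>y\<in>carrier R. \<forall>p\<in>S. sg (ev p c x) = sg (ev p e y)"
    proof
      fix x assume x: "x \<in> carrier R"
      then obtain y where y: "y \<in> carrier R" "\<And>p. p \<in> g ` S \<Longrightarrow> sg (ev p c x) = sg (ev p e y)" using h by blast
      have "sg (ev p c x) = sg (ev p e y)" if p: "p \<in> S" for p
      proof -
        have "ev p c x = ev (g p) c x" "ev p e y = ev (g p) e y" using gc h p x y(1) by blast+
        then show ?thesis using y(2)[of "g p"] p by simp
      qed
      then show "\<exists>y\<in>carrier R. \<forall>p\<in>S. sg (ev p c x) = sg (ev p e y)" using y(1) by blast
    qed
  qed
qed

text \<open>All zeros of the nonzero members lie in \<open>K\<close>. If \<open>y\<close> is not
  among them, \<open>K\<close> has a point in the same gap between these zeros, and the signs there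
  are the same, because a sign change would produce a further zero inside the gap.\<close>

lemma sign_transfer_univariate:
  assumes S: "finite S" "\<And>p i. p \<in> S \<Longrightarrow> fst p i \<in> K" and y: "y \<in> carrier R"
  shows "\<exists>z\<in>K. \<forall>p\<in>S. sg (pval (fst p) (snd p) z) = sg (pval (fst p) (snd p) y)"
proof -
  have cl: "fst p i \<in> carrier R" if "p \<in> S" for p i using S(2) that K_carrier by blast
  have "\<exists>k. (k > 0 \<longrightarrow> a (k - 1) \<noteq> \<zero>) \<and> (\<forall>x\<in>carrier R. pval a m x = pval a k x)"
    if "\<And>i. a i \<in> K" for a m
  proof (induction m)
    case (Suc m)
    show ?case
    proof (cases "a m = \<zero>")
      case True
      then show ?thesis using Suc that K_carrier by (simp add: pval_Suc)
    qed (intro exI[of _ "Suc m"], simp)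
  qed auto
  then have "\<forall>p. \<exists>k. p \<in> S \<longrightarrow> (k > 0 \<longrightarrow> fst p (k - 1) \<noteq> \<zero>) \<and>
      (\<forall>x\<in>carrier R. pval (fst p) (snd p) x = pval (fst p) k x)"
    using S(2) by meson
  then obtain k where k: "\<And>p. \<lbrakk> p \<in> S; k p > 0 \<rbrakk> \<Longrightarrow> fst p (k p - 1) \<noteq> \<zero>"
    "\<And>p x. \<lbrakk> p \<in> S; x \<in> carrier R \<rbrakk> \<Longrightarrow> pval (fst p) (snd p) x = pval (fst p) (k p) x"
    by metis
  define Z where "Z = (\<Union>p\<in>{p \<in> S. k p > 0}. {x \<in> carrier R. pval (fst p) (k p) x = \<zero>})"
  have Z: "finite Z" unfolding Z_def using S(1) k(1) cl by (intro finite_UN_I finite_pval_zeros) auto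
  have ZK: "Z \<subseteq> K" unfolding Z_def using K_closed k(1) S(2) by blast
  have Zc: "Z \<subseteq> carrier R" unfolding Z_def by blast
  show ?thesis
  proof (cases "y \<in> Z")
    case True
    then show ?thesis using ZK by blast
  next
    case False
    have "\<exists>z\<in>K. (\<forall>x\<in>{x \<in> Z. x \<ll> y}. x \<ll> z) \<and> (\<forall>x\<in>{x \<in> Z. y \<ll> x}. z \<ll> x)"
    proof (rule finite_separate[OF K_subfield])
      fix u v assume "u \<in> {x \<in> Z. x \<ll> y}" "v \<in> {x \<in> Z. y \<ll> x}"
      then show "u \<ll> v" using prec_trans[of u y v] Zc y by blast
    qed (use Z ZK in auto)
    then obtain z where z: "z \<in> K" "\<And>x. x \<in> Z \<Longrightarrow> x \<ll> y \<Longrightarrow> x \<ll> z" "\<And>x. x \<in> Z \<Longrightarrow> y \<ll> x \<Longrightarrow> z \<ll> x"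
      by blast
    have zc: "z \<in> carrier R" using z(1) K_carrier by blast
    have "sg (pval (fst p) (k p) z) = sg (pval (fst p) (k p) y)" if p: "p \<in> S" "k p > 0" for p
    proof (rule ccontr)
      let ?f = "pval (fst p) (k p)"
      assume ne: "sg (?f z) \<noteq> sg (?f y)"
      have inZ: "x \<in> Z \<longleftrightarrow> ?f x = \<zero> \<or> x \<in> Z" if "x \<in> carrier R" for x
        using p that unfolding Z_def by blast
      have "z \<notin> Z"
      proof
        assume "z \<in> Z"
        then show False using z(2)[of z] z(3)[of z] prec_cases[OF zc y] False zc by auto
      qed
      then have nz: "?f z \<noteq> \<zero>" "?f y \<noteq> \<zero>" using inZ zc y False by blast+
      have fc: "?f z \<in> carrier R" "?f y \<in> carrier R" using cl p zc y by auto
      have sgs: "sg (?f z) * sg (?f y) = - 1"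
        using nz ne fc sg_range[of "?f z"] sg_range[of "?f y"] sg_0_iff[of "?f z"] sg_0_iff[of "?f y"] by auto
      show False
      proof (cases rule: prec_cases[OF zc y])
        case 1
        then obtain w where w: "w \<in> carrier R" "z \<ll> w" "w \<ll> y" "?f w = \<zero>"
          using ivt[of "fst p" z y "k p"] cl p zc y sgs by blast
        then have "w \<in> Z" using inZ by blast
        then show False using z(2) w prec_asym[of z w] zc by blast
      next
        case 2
        then show False using ne by simp
      next
        case 3
        then obtain w where w: "w \<in> carrier R" "y \<ll> w" "w \<ll> z" "?f w = \<zero>"
          using ivt[of "fst p" y z "k p"] cl p zc y sgs by (auto simp: mult.commute)
        then have "w \<in> Z" using inZ by blast
        then show False using z(3) w prec_asym[of w z] zc by blast
      qed
    qed
    then have "sg (pval (fst p) (snd p) z) = sg (pval (fst p) (snd p) y)" if "p \<in> S" for p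
      using k(2)[OF that] zc y that by (cases "k p = 0") auto
    then show ?thesis using z(1) by blast
  qed
qed

text \<open>The variable with index n is split off. By induction the others move to
  \<open>K\<close>, subject to the conditions \<open>Q\<close> under which a last coordinate
  \<open>y\<close> with the right signs exists in the ambient field. The coefficients now lie in
  \<open>K\<close>, so \<open>sign_transfer_univariate\<close> moves \<open>y\<close> to
  \<open>K\<close> as well.\<close>

theorem sign_transfer_subfield:
  assumes "finite P" "P \<subseteq> polyfun n" "range c \<subseteq> carrier R"
  shows "\<exists>r. range r \<subseteq> K \<and> (\<forall>p\<in>P. sg (p r) = sg (p c))"
  using assms
proof (induction n arbitrary: P)
  case 0
  have "sg (p (\<lambda>_. \<zero>)) = sg (p c)" if "p \<in> P" for p
    by (rule arg_cong[OF polyfun_independent[of p 0]]) (use that 0 in auto)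
  moreover have "range (\<lambda>_. \<zero>) \<subseteq> K" using K_subring(2) by auto
  ultimately show ?case by (intro exI[of _ "\<lambda>_. \<zero>"] conjI ballI)
next
  case (Suc n)
  define good where "good p q \<longleftrightarrow> (\<forall>i. fst q i \<in> polyfun n) \<and>
    (\<forall>e x. range e \<subseteq> carrier R \<longrightarrow> x \<in> carrier R \<longrightarrow> p (e(n := x)) = ev q e x)" for p q
  have "\<exists>q. good p q" if "p \<in> P" for p
  proof -
    have "uni_polyfun n (\<lambda>e x. p (e(n := x)))" using polyfun_Suc_rep Suc.prems(2) that by blast
    then obtain a k where "\<And>i. a i \<in> polyfun n"
      "\<And>e x. \<lbrakk> range e \<subseteq> carrier R; x \<in> carrier R \<rbrakk> \<Longrightarrow> p (e(n := x)) = pval (\<lambda>i. a i e) k x"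
      using uni_polyfunE by blast
    then show ?thesis unfolding good_def by (intro exI[of _ "(a, k)"]) auto
  qed
  then obtain g where "\<And>p. p \<in> P \<Longrightarrow> good p (g p)" by metis
  then have g: "\<And>p i. p \<in> P \<Longrightarrow> fst (g p) i \<in> polyfun n"
    "\<And>p e x. \<lbrakk> p \<in> P; range e \<subseteq> carrier R; x \<in> carrier R \<rbrakk> \<Longrightarrow> p (e(n := x)) = ev (g p) e x"
    unfolding good_def by auto
  have "near n c (\<lambda>e. \<forall>x\<in>carrier R. \<exists>y\<in>carrier R. \<forall>p\<in>g ` P. sg (ev p c x) = sg (ev p e y))"
    by (rule near_sign_transfer) (use Suc.prems g(1) in auto)
  then obtain Q where Q: "finite Q" "Q \<subseteq> polyfun n"
    "\<And>e. \<lbrakk> range e \<subseteq> carrier R; \<And>q. q \<in> Q \<Longrightarrow> sg (q e) = sg (q c) \<rbrakk> \<Longrightarrow>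
      \<forall>x\<in>carrier R. \<exists>y\<in>carrier R. \<forall>p\<in>g ` P. sg (ev p c x) = sg (ev p e y)"
    unfolding near_def by metis
  obtain r where r: "range r \<subseteq> K" "\<And>q. q \<in> Q \<Longrightarrow> sg (q r) = sg (q c)"
    using Suc.IH[OF Q(1,2) Suc.prems(3)] by blast
  have rc: "range r \<subseteq> carrier R" using r(1) K_carrier by blast
  have cn: "c n \<in> carrier R" using Suc.prems(3) by blast
  obtain y where y: "y \<in> carrier R" "\<And>p. p \<in> g ` P \<Longrightarrow> sg (ev p c (c n)) = sg (ev p r y)"
    using Q(3)[OF rc r(2)] cn by blast
  have gK: "fst (g p) i r \<in> K" if "p \<in> P" for p i
    by (rule polyfun_in_K[OF g(1)[OF that] r(1)])
  let ?S = "(\<lambda>p. (\<lambda>i. fst (g p) i r, snd (g p))) ` P"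
  have "\<exists>z\<in>K. \<forall>s\<in>?S. sg (pval (fst s) (snd s) z) = sg (pval (fst s) (snd s) y)"
    by (rule sign_transfer_univariate) (use Suc.prems(1) gK y(1) in auto)
  then obtain z where z: "z \<in> K" "\<And>p. p \<in> P \<Longrightarrow> sg (ev (g p) r z) = sg (ev (g p) r y)" by auto
  have "sg (p (r(n := z))) = sg (p c)" if p: "p \<in> P" for p
  proof -
    have "sg (p (r(n := z))) = sg (ev (g p) r z)" using g(2)[OF p rc] z(1) K_carrier by simp
    also have "\<dots> = sg (ev (g p) c (c n))" using z(2) y(2) p by simp
    also have "\<dots> = sg (p (c(n := c n)))" using g(2)[OF p Suc.prems(3) cn] by simp
    finally show ?thesis by simp
  qed
  moreover have "range (r(n := z)) \<subseteq> K" using r(1) z(1) by auto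
  ultimately show ?case by (intro exI[of _ "r(n := z)"] conjI ballI)
qed

end

section \<open>Sums of squares and maximal real subfields\<close>

text \<open>An inductive form of \<open>sum_of_squares\<close>, for inductions that adjoin one
  square at a time. As it refers to the carrier, it can be applied to subfields of a fixed
  field.\<close>

inductive_set sos :: "('a, 'p) ring_scheme \<Rightarrow> 'a set" for A where
  sos_zero: "\<zero>\<^bsub>A\<^esub> \<in> sos A"
| sos_step: "\<lbrakk> x \<in> carrier A; s \<in> sos A \<rbrakk> \<Longrightarrow> x \<otimes>\<^bsub>A\<^esub> x \<oplus>\<^bsub>A\<^esub> s \<in> sos A"

lemma (in cring) sum_of_squares_iff: "sum_of_squares R c \<longleftrightarrow> c \<in> sos R"
proof
  assume "sum_of_squares R c"
  then obtain n :: nat and x where x: "x \<in> {..<n} \<rightarrow> carrier R" "c = (\<Oplus>i\<in>{..<n}. x i [^] (2::nat))"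
    unfolding sum_of_squares_def by blast
  have "(\<Oplus>i\<in>{..<n}. x i [^] (2::nat)) \<in> sos R"
    using x(1)
  proof (induction n)
    case 0
    show ?case by (simp add: sos_zero)
  next
    case (Suc n)
    have xc: "x i \<in> carrier R" if "i \<le> n" for i using Suc.prems that by (auto simp: Pi_def)
    have "(\<Oplus>i\<in>{..<Suc n}. x i [^] (2::nat)) = x n [^] (2::nat) \<oplus> (\<Oplus>i\<in>{..<n}. x i [^] (2::nat))"
      unfolding lessThan_Suc by (rule finsum_insert) (use xc in \<open>auto simp: Pi_def\<close>)
    also have "x n [^] (2::nat) = x n \<otimes> x n" using xc by (simp add: numeral_2_eq_2)
    finally show ?case using Suc xc by (simp add: sos_step)
  qed
  then show "c \<in> sos R" using x(2) by simp
next
  assume "c \<in> sos R"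
  then show "sum_of_squares R c"
  proof induction
    case sos_zero
    show ?case unfolding sum_of_squares_def by (intro exI[of _ "0::nat"]) auto
  next
    case (sos_step y s)
    then obtain n :: nat and x where x: "x \<in> {..<n} \<rightarrow> carrier R" "s = (\<Oplus>i\<in>{..<n}. x i [^] (2::nat))"
      unfolding sum_of_squares_def by blast
    let ?x = "x(n := y)"
    have "(\<Oplus>i\<in>{..<Suc n}. ?x i [^] (2::nat)) = ?x n [^] (2::nat) \<oplus> (\<Oplus>i\<in>{..<n}. ?x i [^] (2::nat))"
      unfolding lessThan_Suc by (rule finsum_insert) (use x(1) sos_step.hyps in \<open>auto simp: Pi_def\<close>)
    also have "(\<Oplus>i\<in>{..<n}. ?x i [^] (2::nat)) = s"
      unfolding x(2) by (rule finsum_cong') (use x(1) in \<open>auto simp: Pi_def\<close>)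
    finally have "y \<otimes> y \<oplus> s = (\<Oplus>i\<in>{..<Suc n}. ?x i [^] (2::nat))"
      using sos_step.hyps by (simp add: numeral_2_eq_2)
    moreover have "?x \<in> {..<Suc n} \<rightarrow> carrier R" using x(1) sos_step.hyps by (auto simp: Pi_def)
    ultimately show ?case unfolding sum_of_squares_def by blast
  qed
qed

context cring
begin

lemma sos_closed: "s \<in> sos R \<Longrightarrow> s \<in> carrier R"
  by (induction rule: sos.induct) auto

lemma sos_add: "\<lbrakk> s \<in> sos R; t \<in> sos R \<rbrakk> \<Longrightarrow> s \<oplus> t \<in> sos R"
  by (induction rule: sos.induct) (auto simp: a_assoc sos_closed intro: sos_step)

lemma sos_square: "x \<in> carrier R \<Longrightarrow> x \<otimes> x \<in> sos R"
  using sos_step[OF _ sos_zero, of x R] by simp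

lemma sos_square_mult: "\<lbrakk> t \<in> sos R; x \<in> carrier R \<rbrakk> \<Longrightarrow> x \<otimes> x \<otimes> t \<in> sos R"
proof (induction rule: sos.induct)
  case (sos_step y s)
  have "x \<otimes> x \<otimes> (y \<otimes> y \<oplus> s) = (x \<otimes> y) \<otimes> (x \<otimes> y) \<oplus> x \<otimes> x \<otimes> s"
    using sos_step.hyps(1) sos_step.prems sos_closed[OF sos_step.hyps(2)] by algebra
  then show ?case using sos.sos_step[of "x \<otimes> y" R] sos_step by simp
qed (auto intro: sos_zero)

lemma sos_mult: "\<lbrakk> s \<in> sos R; t \<in> sos R \<rbrakk> \<Longrightarrow> s \<otimes> t \<in> sos R"
proof (induction rule: sos.induct)
  case (sos_step x s)
  have "(x \<otimes> x \<oplus> s) \<otimes> t = x \<otimes> x \<otimes> t \<oplus> s \<otimes> t"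
    using sos_step.hyps(1) sos_closed[OF sos_step.hyps(2)] sos_closed[OF sos_step.prems] by algebra
  then show ?case using sos_add[OF sos_square_mult] sos_step by simp
qed (auto simp: sos_closed intro: sos_zero)

end

lemma sos_hom:
  assumes "cring A" "cring B" "h \<in> ring_hom A B" "s \<in> sos A"
  shows "h s \<in> sos B"
proof -
  interpret A: cring A by fact
  interpret B: cring B by fact
  interpret h: ring_hom_cring A B h by unfold_locales (fact assms(3))
  show ?thesis using assms(4)
    by induction (auto simp: A.sos_closed intro: sos.intros)
qed

lemma sos_mono: "\<lbrakk> s \<in> sos (A\<lparr>carrier := M\<rparr>); M \<subseteq> M' \<rbrakk> \<Longrightarrow> s \<in> sos (A\<lparr>carrier := M'\<rparr>)"
proof (induction rule: sos.induct)
  case sos_zero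
  show ?case using sos.sos_zero[of "A\<lparr>carrier := M'\<rparr>"] by simp
next
  case (sos_step x s)
  then show ?case using sos.sos_step[of x "A\<lparr>carrier := M'\<rparr>" s] by auto
qed

lemma real_field_iff: "real_field F \<longleftrightarrow> field F \<and> \<ominus>\<^bsub>F\<^esub> \<one>\<^bsub>F\<^esub> \<notin> sos F"
proof (cases "field F")
  case True
  then interpret field F .
  show ?thesis using True by (simp add: real_field_def sum_of_squares_iff)
qed (simp add: real_field_def)

section \<open>Maximal real subfields of an algebraically closed field\<close>

context field
begin

definition real_subfield :: "'a set \<Rightarrow> bool"
  where "real_subfield M \<longleftrightarrow> subfield M R \<and> \<ominus> \<one> \<notin> sos (R\<lparr>carrier := M\<rparr>)"

text \<open>Zorn's lemma: a representation of -1 as a sum of squares involves finitely many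
  elements, and these lie in one member of the chain, so the union of a chain of real subfields is
  real.\<close>

lemma exists_maximal_real_subfield:
  assumes "real_subfield K"
  shows "\<exists>M. K \<subseteq> M \<and> real_subfield M \<and> (\<forall>M'. real_subfield M' \<longrightarrow> M \<subseteq> M' \<longrightarrow> M' = M)"
proof -
  let ?F = "{M. real_subfield M \<and> K \<subseteq> M}"
  have "\<exists>M\<in>?F. \<forall>M'\<in>?F. M \<subseteq> M' \<longrightarrow> M' = M"
  proof (rule subset_Zorn_nonempty)
    show "?F \<noteq> {}" using assms by auto
    fix \<C> assume C: "\<C> \<noteq> {}" "subset.chain ?F \<C>"
    then have sf: "subfield M R" and re: "\<ominus> \<one> \<notin> sos (R\<lparr>carrier := M\<rparr>)" and K: "K \<subseteq> M" if "M \<in> \<C>" for M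
      using that unfolding subset_chain_def real_subfield_def by blast+
    have lin: "M \<subseteq> N \<or> N \<subseteq> M" if "M \<in> \<C>" "N \<in> \<C>" for M N
      using C(2) that unfolding subset_chain_def by blast
    have two: "\<exists>M\<in>\<C>. x \<in> M \<and> y \<in> M" if "x \<in> \<Union>\<C>" "y \<in> \<Union>\<C>" for x y
      using that lin by blast
    note sr = subringE[OF subfieldE(1)[OF sf]]
    have "subring (\<Union>\<C>) R"
    proof (rule subringI)
      show "\<Union>\<C> \<subseteq> carrier R" using sr(1) by blast
      show "\<one> \<in> \<Union>\<C>" using sr(3) C(1) by blast
      show "\<ominus> h \<in> \<Union>\<C>" if "h \<in> \<Union>\<C>" for h using that sr(5) by blast
      show "h1 \<otimes> h2 \<in> \<Union>\<C>" "h1 \<oplus> h2 \<in> \<Union>\<C>" if "h1 \<in> \<Union>\<C>" "h2 \<in> \<Union>\<C>" for h1 h2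
        using two[OF that] sr(6,7) by blast+
    qed
    then have "subfield (\<Union>\<C>) R"
      by (rule subfieldI') (use subfield_m_inv(1)[OF sf] in blast)
    moreover have "\<exists>M\<in>\<C>. s \<in> sos (R\<lparr>carrier := M\<rparr>)" if "s \<in> sos (R\<lparr>carrier := \<Union>\<C>\<rparr>)" for s
      using that
    proof induction
      case sos_zero
      obtain M where "M \<in> \<C>" using C(1) by blast
      then show ?case using sos.sos_zero[of "R\<lparr>carrier := M\<rparr>"] by auto
    next
      case (sos_step x s)
      then obtain M N where MN: "M \<in> \<C>" "x \<in> M" "N \<in> \<C>" "s \<in> sos (R\<lparr>carrier := N\<rparr>)" by auto
      then obtain L where L: "L \<in> \<C>" "M \<subseteq> L" "N \<subseteq> L"
        using lin[OF MN(1,3)] MN(1,3) by blast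
      have "s \<in> sos (R\<lparr>carrier := L\<rparr>)" "x \<in> L" using sos_mono[OF MN(4) L(3)] MN(2) L(2) by auto
      then show ?case using sos.sos_step[of x "R\<lparr>carrier := L\<rparr>" s] L(1) by auto
    qed
    then have "\<ominus> \<one> \<notin> sos (R\<lparr>carrier := \<Union>\<C>\<rparr>)" using re by blast
    moreover have "K \<subseteq> \<Union>\<C>" using K C(1) by blast
    ultimately show "\<Union>\<C> \<in> ?F" unfolding real_subfield_def by blast
  qed
  then obtain M where M: "real_subfield M" "K \<subseteq> M" "\<forall>M'\<in>?F. M \<subseteq> M' \<longrightarrow> M' = M" by blast
  then have "M' = M" if "real_subfield M'" "M \<subseteq> M'" for M' using that by blast
  then show ?thesis using M by blast
qed

end

lemma (in algebraically_closed) exists_root_of: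
  assumes "p \<in> carrier (poly_ring L)" "degree p > 0"
  obtains x where "x \<in> carrier L" "eval p x = \<zero>"
proof -
  have "roots p \<noteq> {#}" using roots_over_carrier[OF assms(1)] assms(2) unfolding splitted_def by auto
  then obtain x where "x \<in># roots p" by blast
  then show thesis using that roots_mem_iff_is_root[OF assms(1)] unfolding is_root_def by blast
qed

locale maximal_real_subfield = algebraically_closed L for L (structure) +
  fixes M :: "'a set"
  assumes real_M: "real_subfield M"
    and maximal: "\<lbrakk> real_subfield M'; M \<subseteq> M' \<rbrakk> \<Longrightarrow> M' = M"
begin

abbreviation F where "F \<equiv> L\<lparr>carrier := M\<rparr>"

lemma M_subfield: "subfield M L"
  using real_M unfolding real_subfield_def by blast

lemma F_field: "field F"
  using subfield_iff(2)[OF M_subfield] .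

lemmas M_subring = subringE[OF subfieldE(1)[OF M_subfield]]

lemma M_carrier: "x \<in> M \<Longrightarrow> x \<in> carrier L"
  using M_subring(1) by blast

lemma F_minus: "x \<in> M \<Longrightarrow> \<ominus>\<^bsub>F\<^esub> x = \<ominus> x"
proof -
  interpret F: field F by (rule F_field)
  assume x: "x \<in> M"
  then have "x \<oplus> \<ominus>\<^bsub>F\<^esub> x = \<zero>" "\<ominus>\<^bsub>F\<^esub> x \<in> M" using F.r_neg[of x] F.a_inv_closed[of x] by auto
  then show ?thesis using x M_carrier minus_equality[of "\<ominus>\<^bsub>F\<^esub> x" x] a_comm by metis
qed

lemma real_F: "\<ominus> \<one> \<notin> sos F"
  using real_M unfolding real_subfield_def by blast

lemma sos_F_in_M: "s \<in> sos F \<Longrightarrow> s \<in> M"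
proof -
  interpret F: field F by (rule F_field)
  show "s \<in> sos F \<Longrightarrow> s \<in> M" using F.sos_closed by simp
qed

text \<open>Adjoining an algebraic element gives a field, and one that properly contains
  \<open>M\<close> cannot be real.\<close>

lemma minus_one_sos_extension:
  assumes "x \<in> carrier L" "x \<notin> M" "(algebraic over M) x"
  shows "\<ominus> \<one> \<in> sos (L\<lparr>carrier := simple_extension M x\<rparr>)"
proof (rule ccontr)
  assume "\<not> ?thesis"
  moreover have "subfield (simple_extension M x) L"
    using simple_extension_is_subfield[OF M_subfield assms(1)] assms(3) by simp
  ultimately have "real_subfield (simple_extension M x)" unfolding real_subfield_def by blast
  then have "simple_extension M x = M"
    using maximal simple_extension_incl[OF M_subring(1) assms(1)] by blast
  then show False using assms(2) simple_extension_mem[OF subfieldE(1)[OF M_subfield] assms(1)] by simp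
qed

text \<open>Adjoin a root t of X^2 - a. If t is outside \<open>M\<close>, write -1 as the sum of the
  (u_i + v_i t)^2 and use t^2 = a: the coefficient of t has to vanish, and there remains the sum of
  the u_i^2 plus a times the sum of the v_i^2.\<close>

lemma square_or_minus_one:
  assumes a: "a \<in> M"
  shows "(\<exists>b\<in>M. a = b \<otimes> b) \<or> (\<exists>p\<in>sos F. \<exists>q\<in>sos F. \<ominus> \<one> = p \<oplus> a \<otimes> q)"
proof -
  interpret F: field F by (rule F_field)
  have aL: "a \<in> carrier L" using a M_carrier by blast
  have poly: "[\<one>, \<zero>, \<ominus> a] \<in> carrier (M[X])"
    using a M_subring by (auto simp: univ_poly_carrier[symmetric] polynomial_def)
  then have "[\<one>, \<zero>, \<ominus> a] \<in> carrier (poly_ring L)"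
    using carrier_polynomial_shell[OF subfieldE(1)[OF M_subfield]] by blast
  then obtain t where t: "t \<in> carrier L" "eval [\<one>, \<zero>, \<ominus> a] t = \<zero>"
    using exists_root_of[of "[\<one>, \<zero>, \<ominus> a]"] by auto
  have "t \<otimes> t \<ominus> a = \<zero>" using t aL by (simp add: numeral_2_eq_2 a_minus_def)
  then have tt: "t \<otimes> t = a" using t(1) aL by simp
  show ?thesis
  proof (cases "t \<in> M")
    case True
    then show ?thesis using tt by blast
  next
    case False
    have "(algebraic over M) t" using algebraicI[OF poly _ t(2)] by simp
    then have m1: "\<ominus> \<one> \<in> sos (L\<lparr>carrier := simple_extension M t\<rparr>)"
      using minus_one_sos_extension t(1) False by blast
    have ext: "\<exists>u\<in>M. \<exists>v\<in>M. z = u \<oplus> v \<otimes> t" if "z \<in> simple_extension M t" for z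
      using that
    proof induction
      case zero
      then show ?case using M_subring(2) t(1) by (intro bexI[of _ \<zero>]) auto
    next
      case (lin k1 k2)
      then obtain u v where uv: "u \<in> M" "v \<in> M" "k1 = u \<oplus> v \<otimes> t" by blast
      have c: "u \<in> carrier L" "v \<in> carrier L" "k2 \<in> carrier L" using uv lin M_carrier by auto
      have "(u \<oplus> v \<otimes> t) \<otimes> t \<oplus> k2 = (v \<otimes> (t \<otimes> t) \<oplus> k2) \<oplus> u \<otimes> t" using c t(1) by algebra
      then show ?case unfolding uv(3) tt using uv a lin M_subring(6,7) by blast
    qed
    have "\<exists>p\<in>sos F. \<exists>q\<in>sos F. \<exists>r\<in>M. z = (p \<oplus> a \<otimes> q) \<oplus> r \<otimes> t"
      if "z \<in> sos (L\<lparr>carrier := simple_extension M t\<rparr>)" for z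
      using that
    proof induction
      case sos_zero
      have "\<zero> \<in> sos F" using sos.sos_zero[of F] by simp
      then show ?case using M_subring(2) t(1) aL by (intro bexI[of _ \<zero>]) auto
    next
      case (sos_step x s)
      then obtain p q r where s: "p \<in> sos F" "q \<in> sos F" "r \<in> M" "s = (p \<oplus> a \<otimes> q) \<oplus> r \<otimes> t" by blast
      have "x \<in> simple_extension M t" using sos_step by simp
      then obtain u v where uv: "u \<in> M" "v \<in> M" "x = u \<oplus> v \<otimes> t" using ext by blast
      have c: "u \<in> carrier L" "v \<in> carrier L" "p \<in> carrier L" "q \<in> carrier L" "r \<in> carrier L"
        using uv s sos_F_in_M M_carrier by auto
      have "x \<otimes> x \<oplus> s = ((u \<otimes> u \<oplus> p) \<oplus> (v \<otimes> v \<otimes> (t \<otimes> t) \<oplus> a \<otimes> q)) \<oplus> (u \<otimes> v \<oplus> u \<otimes> v \<oplus> r) \<otimes> t"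
        unfolding uv(3) s(4) using c t(1) aL by algebra
      also have "\<dots> = ((u \<otimes> u \<oplus> p) \<oplus> a \<otimes> (v \<otimes> v \<oplus> q)) \<oplus> (u \<otimes> v \<oplus> u \<otimes> v \<oplus> r) \<otimes> t"
        unfolding tt using c t(1) aL by algebra
      finally have "x \<otimes> x \<oplus> s = ((u \<otimes> u \<oplus> p) \<oplus> a \<otimes> (v \<otimes> v \<oplus> q)) \<oplus> (u \<otimes> v \<oplus> u \<otimes> v \<oplus> r) \<otimes> t" .
      moreover have "u \<otimes> u \<oplus> p \<in> sos F" "v \<otimes> v \<oplus> q \<in> sos F"
        using sos.sos_step[of u F p] sos.sos_step[of v F q] uv s by auto
      moreover have "u \<otimes> v \<oplus> u \<otimes> v \<oplus> r \<in> M" by (intro M_subring(6,7) uv s)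
      ultimately have "\<exists>p\<in>sos F. \<exists>q\<in>sos F. \<exists>r\<in>M. x \<otimes> x \<oplus> s = (p \<oplus> a \<otimes> q) \<oplus> r \<otimes> t"
        by blast
      then show ?case by simp
    qed
    then obtain p q r where p: "p \<in> sos F" "q \<in> sos F" "r \<in> M" "\<ominus> \<one> = (p \<oplus> a \<otimes> q) \<oplus> r \<otimes> t"
      using m1 by blast
    have c: "p \<in> carrier L" "q \<in> carrier L" "r \<in> carrier L" and pqM: "p \<in> M" "q \<in> M"
      using p sos_F_in_M M_carrier by auto
    have "r = \<zero>"
    proof (rule ccontr)
      assume "r \<noteq> \<zero>"
      define w where "w = \<ominus> \<one> \<ominus> (p \<oplus> a \<otimes> q)"
      have "w \<in> M" unfolding w_def a_minus_def by (intro M_subring(3,5,6,7) pqM a)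
      moreover have "w = r \<otimes> t" unfolding w_def p(4) using c aL t(1) by algebra
      ultimately have "r \<otimes> t \<in> M" by simp
      then have "t \<in> M" using subfield_m_inv_simprule[OF M_subfield, of r t] p(3) \<open>r \<noteq> \<zero>\<close> t(1) by blast
      then show False using False by blast
    qed
    then have "\<ominus> \<one> = p \<oplus> a \<otimes> q" using p(4) c aL t(1) by simp
    then show ?thesis using p by blast
  qed
qed

text \<open>Writing \<open>- 1\<close> as a sum of squares modulo the minimal polynomial \<open>g\<close> of a root of \<open>f\<close> outside \<open>M\<close> gives
  \<open>g q = 1 + \<Sum> f\<^sub>i\<^sup>2\<close> with \<open>deg f\<^sub>i < deg g\<close>. Hence \<open>g\<close> changes its sign only where \<open>q\<close>, of smaller degree, does.\<close>

lemma root_or_definite_product: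
  assumes f: "f \<in> carrier (M[X])" "degree f > 0"
  shows "(\<exists>r\<in>M. eval f r = \<zero>) \<or>
    (\<exists>g\<in>carrier (M[X]). \<exists>h\<in>carrier (M[X]). \<exists>q\<in>carrier (M[X]).
      f = g \<otimes>\<^bsub>M[X]\<^esub> h \<and> degree g > 0 \<and> q \<noteq> [] \<and> degree q < degree g \<and>
      (\<forall>r\<in>M. \<exists>s\<in>sos F. eval g r \<otimes> eval q r = \<one> \<oplus> s))"
proof -
  interpret F: field F by (rule F_field)
  have K: "subring M L" using subfieldE(1)[OF M_subfield] .
  interpret UP: domain "M[X]" using univ_poly_is_domain[OF K] .
  note ev = eval_cring_hom[OF K]
  have up0: "\<zero>\<^bsub>M[X]\<^esub> = []" by (simp add: univ_poly_zero)
  obtain t where t: "t \<in> carrier L" "eval f t = \<zero>"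
    using exists_root_of[of f] carrier_polynomial_shell[OF K f(1)] f(2) by blast
  show ?thesis
  proof (cases "t \<in> M")
    case True
    then show ?thesis using t by blast
  next
    case False
    interpret evt: ring_hom_cring "M[X]" L "\<lambda>p. eval p t" by (rule ev[OF t(1)])
    have "f \<noteq> []" using f(2) by auto
    then have alg: "(algebraic over M) t" using algebraicI[OF f(1) _ t(2)] by simp
    define g where "g = Irr M t"
    have g: "g \<in> carrier (M[X])" "pirreducible M g" "eval g t = \<zero>"
      using IrrE[OF M_subfield t(1) alg] by (auto simp: g_def)
    have dg: "degree g \<ge> 1" using pirreducible_degree[OF M_subfield g(1,2)] .
    have gne: "g \<noteq> []" using dg by auto
    have gdvd: "\<exists>h\<in>carrier (M[X]). p = g \<otimes>\<^bsub>M[X]\<^esub> h" if "p \<in> carrier (M[X])" "eval p t = \<zero>" for p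
      using Irr_minimal[OF M_subfield t(1) alg that] pdivides_iff_shell[OF M_subfield g(1) that(1)]
      unfolding g_def[symmetric] factor_def by blast
    obtain h where h: "h \<in> carrier (M[X])" "f = g \<otimes>\<^bsub>M[X]\<^esub> h" using gdvd[OF f(1) t(2)] by blast
    \<comment> \<open>Lifts of sums of squares in M(t) to polynomials. Squaring remainders modulo
      \<open>g\<close> keeps the degree small, and the value of a lift at any point of
      \<open>M\<close> is again a sum of squares.\<close>
    have "\<exists>G\<in>carrier (M[X]). eval G t = z \<and> degree G \<le> 2 * (degree g - 1) \<and> (\<forall>r\<in>M. eval G r \<in> sos F)"
      if "z \<in> sos (L\<lparr>carrier := simple_extension M t\<rparr>)" for z
      using that
    proof induction
      case sos_zero
      have "\<zero> \<in> sos F" using sos.sos_zero[of F] by simp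
      then show ?case using UP.zero_closed unfolding up0 by (intro bexI[of _ "[]"]) auto
    next
      case (sos_step x s)
      then obtain G where G: "G \<in> carrier (M[X])" "eval G t = s" "degree G \<le> 2 * (degree g - 1)"
        "\<And>r. r \<in> M \<Longrightarrow> eval G r \<in> sos F" by blast
      have "x \<in> simple_extension M t" using sos_step by simp
      then obtain p where p: "p \<in> carrier (M[X])" "x = eval p t"
        using simple_extension_as_eval_img[OF M_subring(1) t(1)] by auto
      define p' where "p' = pmod p g"
      define d where "d = pdiv p g"
      have p': "p' \<in> carrier (M[X])" "d \<in> carrier (M[X])" "p = (g \<otimes>\<^bsub>M[X]\<^esub> d) \<oplus>\<^bsub>M[X]\<^esub> p'"
        using long_division_closed[OF M_subfield p(1) g(1)] pdiv_pmod[OF M_subfield p(1) g(1)]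
        by (auto simp: p'_def d_def)
      have dp': "degree p' \<le> degree g - 1"
        using pmod_degree[OF M_subfield p(1) g(1) gne] by (auto simp: p'_def)
      have "eval p t = eval p' t" unfolding p'(3) using p' g by simp
      then have x: "x = eval p' t" using p(2) by simp
      let ?H = "p' \<otimes>\<^bsub>M[X]\<^esub> p' \<oplus>\<^bsub>M[X]\<^esub> G"
      have "degree (p' \<otimes>\<^bsub>M[X]\<^esub> p') \<le> 2 * (degree g - 1)"
        using poly_mult_degree_eq[OF K, of p' p'] p'(1) dp'
        by (simp add: univ_poly_mult univ_poly_carrier del: poly_mult.simps)
      then have "degree ?H \<le> 2 * (degree g - 1)"
        unfolding univ_poly_add using G(3) by (intro order_trans[OF poly_add_degree max.boundedI])
      moreover have "eval ?H r \<in> sos F" if r: "r \<in> M" for r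
      proof -
        interpret evr: ring_hom_cring "M[X]" L "\<lambda>p. eval p r" by (rule ev[OF M_carrier[OF r]])
        have "eval p' r \<in> M"
        proof -
          have "eval p' r \<in> simple_extension M r"
            using simple_extension_as_eval_img[OF M_subring(1) M_carrier[OF r]] p'(1) by blast
          then show ?thesis using simple_extension_subring_incl[OF K _ r, of M] by blast
        qed
        then have "eval p' r \<otimes> eval p' r \<oplus> eval G r \<in> sos F"
          using sos.sos_step[of "eval p' r" F "eval G r"] G(4)[OF r] by simp
        then show ?thesis using p'(1) G(1) by simp
      qed
      moreover have "eval ?H t = x \<otimes> x \<oplus> s" using p'(1) G(1,2) x by simp
      ultimately show ?case using p'(1) G(1) by (intro bexI[of _ ?H]) auto
    qed
    then obtain G where G: "G \<in> carrier (M[X])" "eval G t = \<ominus> \<one>" "degree G \<le> 2 * (degree g - 1)"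
        "\<And>r. r \<in> M \<Longrightarrow> eval G r \<in> sos F" using minus_one_sos_extension[OF t(1) False alg] by blast
    define H where "H = \<one>\<^bsub>M[X]\<^esub> \<oplus>\<^bsub>M[X]\<^esub> G"
    have H: "H \<in> carrier (M[X])" "eval H t = \<zero>" using G by (auto simp: H_def r_neg)
    have evH: "eval H r = \<one> \<oplus> eval G r" if r: "r \<in> M" for r
    proof -
      interpret evr: ring_hom_cring "M[X]" L "\<lambda>p. eval p r" by (rule ev[OF M_carrier[OF r]])
      show ?thesis using G(1) by (simp add: H_def)
    qed
    have dH: "degree H \<le> 2 * (degree g - 1)"
      unfolding H_def univ_poly_add univ_poly_one using G(3)
      by (intro order_trans[OF poly_add_degree max.boundedI]) simp_all
    \<comment> \<open>At 0 the value is 1 + G(0), which is nonzero because -1 is not a sum of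
      squares in \<open>M\<close>.\<close>
    have "H \<noteq> []"
    proof
      assume "H = []"
      then have z: "\<one> \<oplus> eval G \<zero> = \<zero>" using evH[OF M_subring(2)] by simp
      moreover have "eval G \<zero> \<in> carrier L" using G(4)[OF M_subring(2)] sos_F_in_M M_carrier by blast
      ultimately have "\<ominus> \<one> = eval G \<zero>" using minus_equality[of "eval G \<zero>" \<one>] a_comm by simp
      then show False using real_F G(4)[OF M_subring(2)] by simp
    qed
    obtain q where q: "q \<in> carrier (M[X])" "H = g \<otimes>\<^bsub>M[X]\<^esub> q" using gdvd[OF H] by blast
    have qne: "q \<noteq> []" using \<open>H \<noteq> []\<close> q g(1) UP.r_null[OF g(1)] unfolding up0 by auto
    have "degree H = degree g + degree q"
      using poly_mult_degree_eq[OF K, of g q] g(1) q gne qne by (simp add: univ_poly_mult univ_poly_carrier del: poly_mult.simps)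
    \<comment> \<open>This follows from deg g + deg q = deg H \<le> 2 deg g - 2.\<close>
    then have dq: "degree q < degree g" using dH dg by simp
    have "\<exists>s\<in>sos F. eval g r \<otimes> eval q r = \<one> \<oplus> s" if r: "r \<in> M" for r
    proof -
      interpret evr: ring_hom_cring "M[X]" L "\<lambda>p. eval p r" by (rule ev[OF M_carrier[OF r]])
      have "eval g r \<otimes> eval q r = eval H r" unfolding q(2) using g(1) q(1) by simp
      then show ?thesis using evH[OF r] G(4)[OF r] by auto
    qed
    then show ?thesis using g(1) h q(1) qne dq dg
      by (intro disjI2 bexI[of _ g] bexI[of _ h] bexI[of _ q]) auto
  qed
qed

end

section \<open>Ordering and intermediate values from sums of squares\<close>

lemma (in abelian_group) minus_eq_zero_iff:
  assumes "x \<in> carrier G"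
  shows "\<ominus> x = \<zero> \<longleftrightarrow> x = \<zero>"
proof
  assume "\<ominus> x = \<zero>"
  then show "x = \<zero>" using r_neg[OF assms] assms by simp
qed simp

text \<open>The two dichotomies just shown for a maximal real subfield, stated without reference to
  the algebraically closed field around it.\<close>

locale sos_definite_field = field R for R (structure) +
  assumes real: "\<ominus> \<one> \<notin> sos R"
    and square_cases: "a \<in> carrier R \<Longrightarrow>
      (\<exists>b\<in>carrier R. a = b \<otimes> b) \<or> (\<exists>p\<in>sos R. \<exists>q\<in>sos R. \<ominus> \<one> = p \<oplus> a \<otimes> q)"
    and root_cases: "\<lbrakk> f \<in> carrier (poly_ring R); degree f > 0 \<rbrakk> \<Longrightarrow>
      (\<exists>r\<in>carrier R. eval f r = \<zero>) \<or>
      (\<exists>g\<in>carrier (poly_ring R). \<exists>h\<in>carrier (poly_ring R). \<exists>q\<in>carrier (poly_ring R).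
        f = g \<otimes>\<^bsub>poly_ring R\<^esub> h \<and> degree g > 0 \<and> q \<noteq> [] \<and> degree q < degree g \<and>
        (\<forall>r\<in>carrier R. \<exists>s\<in>sos R. eval g r \<otimes> eval q r = \<one> \<oplus> s))"
begin

definition sos_sgn :: "'a \<Rightarrow> int"
  where "sos_sgn x = (if x = \<zero> then 0 else if x \<in> sos R then 1 else - 1)"

text \<open>If x is nonzero, then -1 = x^(-2) x (-x) would be a sum of squares.\<close>

lemma sos_antisym: "\<lbrakk> x \<in> sos R; \<ominus> x \<in> sos R \<rbrakk> \<Longrightarrow> x = \<zero>"
proof (rule ccontr)
  assume x: "x \<in> sos R" "\<ominus> x \<in> sos R" "x \<noteq> \<zero>"
  have c: "x \<in> carrier R" using sos_closed x(1) .
  then have u: "x \<in> Units R" using x(3) by (simp add: field_Units)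
  have "inv x \<otimes> inv x \<otimes> (x \<otimes> (\<ominus> x)) \<in> sos R"
    using sos_square_mult[OF sos_mult[OF x(1,2)], of "inv x"] u by simp
  moreover have "inv x \<otimes> inv x \<otimes> (x \<otimes> (\<ominus> x)) = \<ominus> ((inv x \<otimes> x) \<otimes> (inv x \<otimes> x))"
    using c u by (simp add: r_minus m_ac)
  ultimately show False using u real by simp
qed

text \<open>If \<open>a\<close> is not a square, -1 = p + a q with q nonzero, so -a = q^(-2) q (1 +
  p) is a sum of squares.\<close>

lemma sos_total: "a \<in> carrier R \<Longrightarrow> a \<in> sos R \<or> \<ominus> a \<in> sos R"
proof -
  assume a: "a \<in> carrier R"
  show ?thesis
  proof (cases "\<exists>b\<in>carrier R. a = b \<otimes> b")
    case True
    then show ?thesis using sos_square by blast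
  next
    case False
    then obtain p q where pq: "p \<in> sos R" "q \<in> sos R" "\<ominus> \<one> = p \<oplus> a \<otimes> q" using square_cases[OF a] by blast
    have c: "p \<in> carrier R" "q \<in> carrier R" using pq sos_closed by auto
    have "q \<noteq> \<zero>"
    proof
      assume "q = \<zero>"
      then have "\<ominus> \<one> = p" using pq(3) a c by simp
      then show False using real pq(1) by simp
    qed
    then have u: "q \<in> Units R" using c by (simp add: field_Units)
    define i where "i = inv q"
    have i: "i \<in> carrier R" "i \<otimes> q = \<one>" using u by (auto simp: i_def)
    have "\<ominus> (a \<otimes> q) = \<one> \<oplus> p"
    proof -
      have "a \<otimes> q = \<ominus> \<one> \<ominus> p" unfolding pq(3) using a c by algebra
      then show ?thesis using a c by algebra
    qed
    then have "i \<otimes> i \<otimes> (q \<otimes> (\<one> \<oplus> p)) = i \<otimes> i \<otimes> (q \<otimes> (\<ominus> (a \<otimes> q)))" by simp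
    also have "\<dots> = \<ominus> ((i \<otimes> q) \<otimes> (i \<otimes> q) \<otimes> a)" using a c i(1) by algebra
    also have "\<dots> = \<ominus> a" using i a by simp
    finally have "\<ominus> a = i \<otimes> i \<otimes> (q \<otimes> (\<one> \<oplus> p))" by simp
    moreover have "\<one> \<oplus> p \<in> sos R" using sos_step[OF one_closed pq(1)] by simp
    ultimately show ?thesis using sos_square_mult[OF sos_mult[OF pq(2)] i(1)] by simp
  qed
qed

lemma sos_sgn_minus: "x \<in> carrier R \<Longrightarrow> sos_sgn (\<ominus> x) = - sos_sgn x"
  using sos_total[of x] sos_antisym[of x] unfolding sos_sgn_def
  by (auto simp: minus_eq_zero_iff)

sublocale sign_field R sos_sgn
proof
  fix x y assume x: "x \<in> carrier R" and y: "y \<in> carrier R"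
  have pos: "sos_sgn (u \<otimes> v) = 1" if "u \<in> sos R" "v \<in> sos R" "u \<noteq> \<zero>" "v \<noteq> \<zero>" for u v
    using that sos_mult[OF that(1,2)] sos_closed integral[of u v] unfolding sos_sgn_def by auto
  show "sos_sgn (x \<otimes> y) = sos_sgn x * sos_sgn y"
  proof (cases "x = \<zero> \<or> y = \<zero>")
    case True
    then show ?thesis using x y by (auto simp: sos_sgn_def)
  next
    case False
    then have nz: "x \<noteq> \<zero>" "y \<noteq> \<zero>" "\<ominus> x \<noteq> \<zero>" "\<ominus> y \<noteq> \<zero>" using x y by (auto simp: minus_eq_zero_iff)
    consider "x \<in> sos R" "y \<in> sos R" | "x \<in> sos R" "\<ominus> y \<in> sos R" | "\<ominus> x \<in> sos R" "y \<in> sos R"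
      | "\<ominus> x \<in> sos R" "\<ominus> y \<in> sos R" using sos_total x y by blast
    then show ?thesis
    proof cases
      case 1
      then show ?thesis using pos[OF 1 nz(1,2)] nz by (simp add: sos_sgn_def)
    next
      case 2
      have "sos_sgn (x \<otimes> (\<ominus> y)) = 1" using pos[OF 2 nz(1,4)] .
      then have "sos_sgn (x \<otimes> y) = - 1" using x y sos_sgn_minus[of "x \<otimes> y"] by (simp add: r_minus)
      moreover have "sos_sgn x = 1" "sos_sgn (\<ominus> y) = 1" using 2 nz by (auto simp: sos_sgn_def)
      ultimately show ?thesis using sos_sgn_minus[OF y] by simp
    next
      case 3
      have "sos_sgn ((\<ominus> x) \<otimes> y) = 1" using pos[OF 3 nz(3,2)] .
      then have "sos_sgn (x \<otimes> y) = - 1" using x y sos_sgn_minus[of "x \<otimes> y"] by (simp add: l_minus)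
      moreover have "sos_sgn y = 1" "sos_sgn (\<ominus> x) = 1" using 3 nz by (auto simp: sos_sgn_def)
      ultimately show ?thesis using sos_sgn_minus[OF x] by simp
    next
      case 4
      have "sos_sgn ((\<ominus> x) \<otimes> (\<ominus> y)) = 1" using pos[OF 4 nz(3,4)] .
      then have "sos_sgn (x \<otimes> y) = 1" using x y by (simp add: l_minus r_minus)
      moreover have "sos_sgn (\<ominus> y) = 1" "sos_sgn (\<ominus> x) = 1" using 4 nz by (auto simp: sos_sgn_def)
      ultimately show ?thesis using sos_sgn_minus x y by simp
    qed
  qed
  assume "sos_sgn x = 1" "sos_sgn y \<noteq> - 1"
  then have s: "x \<in> sos R" "y \<in> sos R" "x \<noteq> \<zero>"
    unfolding sos_sgn_def using sos_zero[of R] by (auto split: if_splits)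
  have "x \<oplus> y \<noteq> \<zero>"
  proof
    assume "x \<oplus> y = \<zero>"
    then have "\<ominus> x = y" using x y minus_equality[of y x] a_comm by simp
    then show False using sos_antisym[of x] s by simp
  qed
  then show "sos_sgn (x \<oplus> y) = 1" using sos_add[OF s(1,2)] by (simp add: sos_sgn_def)
qed (auto simp: sos_sgn_def)

abbreviation sos_less :: "'a \<Rightarrow> 'a \<Rightarrow> bool" (infix \<open>\<ll>\<close> 50)
  where "x \<ll> y \<equiv> sos_sgn (y \<ominus> x) = 1"

lemma pos_sos_succ: "s \<in> sos R \<Longrightarrow> sos_sgn (\<one> \<oplus> s) = 1"
proof -
  assume s: "s \<in> sos R"
  then have "sos_sgn s \<noteq> - 1" by (simp add: sos_sgn_def)
  then show ?thesis using sg_add[of \<one> s] sos_closed[OF s] by simp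
qed

text \<open>Induction on the degree. A root r outside (x, y) gives a factor X - r without sign
  change between x and y, so the cofactor changes its sign. In a product g h the factor
  \<open>g\<close> cannot change its sign: as g q = 1 + s is positive everywhere, \<open>q\<close>
  would change its sign too and by induction have a zero, where g q = 0.\<close>

lemma poly_intermediate_value:
  assumes "f \<in> carrier (poly_ring R)" "x \<in> carrier R" "y \<in> carrier R" "sos_sgn (y \<ominus> x) = 1"
    and "sos_sgn (eval f x) * sos_sgn (eval f y) = - 1"
  shows "\<exists>z\<in>carrier R. x \<ll> z \<and> z \<ll> y \<and> eval f z = \<zero>"
  using assms(1,5)
proof (induction "length f" arbitrary: f rule: less_induct)
  case less
  note f = less.prems(1)
  have K: "subring (carrier R) R" by (rule carrier_is_subring)
  interpret evx: ring_hom_cring "poly_ring R" R "\<lambda>p. eval p x" by (rule eval_cring_hom[OF K assms(2)])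
  interpret evy: ring_hom_cring "poly_ring R" R "\<lambda>p. eval p y" by (rule eval_cring_hom[OF K assms(3)])
  have ev: "eval p z \<in> carrier R" if "p \<in> carrier (poly_ring R)" "z \<in> carrier R" for p z
    using eval_poly_in_carrier[OF K _ that(2)] that(1) by (simp add: univ_poly_carrier)
  have df: "degree f > 0"
  proof (rule ccontr)
    assume "\<not> degree f > 0"
    then consider "f = []" | c where "f = [c]" by (cases f) auto
    then show False
    proof cases
      case 1
      then show ?thesis using less.prems(2) by (simp add: sos_sgn_def)
    next
      case 2
      then have "c \<in> carrier R" using f by (auto simp: univ_poly_carrier[symmetric] polynomial_def)
      then have "eval f x = c" "eval f y = c" using 2 assms by auto
      then show ?thesis using less.prems(2) by (auto simp: sos_sgn_def split: if_splits)
    qed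
  qed
  consider (root) r where "r \<in> carrier R" "eval f r = \<zero>"
    | (prod) g h q where "g \<in> carrier (poly_ring R)" "h \<in> carrier (poly_ring R)" "q \<in> carrier (poly_ring R)"
      "f = g \<otimes>\<^bsub>poly_ring R\<^esub> h" "degree g > 0" "q \<noteq> []" "degree q < degree g"
      "\<And>r. r \<in> carrier R \<Longrightarrow> \<exists>s\<in>sos R. eval g r \<otimes> eval q r = \<one> \<oplus> s"
    using root_cases[OF f df] by metis
  then show ?case
  proof cases
    case (root r)
    obtain m where m: "length f = Suc m" using df by (cases f) auto
    have fc: "set f \<subseteq> carrier R" using f by (auto simp: univ_poly_carrier[symmetric] polynomial_def)
    have fp: "eval f z = pval (coeff f) (Suc m) z" for z
      unfolding pval_def m[symmetric] coeff_list ..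
    obtain g where g: "\<And>i. g i \<in> carrier R"
      "\<And>z. z \<in> carrier R \<Longrightarrow> pval (coeff f) (Suc m) z \<ominus> pval (coeff f) (Suc m) r = (z \<ominus> r) \<otimes> pval g m z"
      using pval_factor[of "coeff f" r m] fc root(1) by (metis coeff_in_carrier)
    have fz: "eval f z = (z \<ominus> r) \<otimes> pval g m z" if "z \<in> carrier R" for z
      using g(2)[OF that] root fp[of z] fp[of r] ev[OF f that] by (simp add: a_minus_def)
    show ?thesis
    proof (cases "x \<ll> r \<and> r \<ll> y")
      case True
      then show ?thesis using root by blast
    next
      case False
      define g' where "g' = normalize (map g (rev [0..<m]))"
      have gc: "set (map g (rev [0..<m])) \<subseteq> carrier R" using g(1) by auto
      have g': "g' \<in> carrier (poly_ring R)" "length g' < length f"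
        using normalize_gives_polynomial[OF gc] normalize_length_le[of "map g (rev [0..<m])"] m
        by (auto simp: g'_def univ_poly_carrier[symmetric])
      have ev': "eval g' z = pval g m z" if "z \<in> carrier R" for z
        unfolding g'_def pval_def using eval_normalize[OF gc that] .
      have "sos_sgn (x \<ominus> r) * sos_sgn (y \<ominus> r) * (sos_sgn (pval g m x) * sos_sgn (pval g m y)) = - 1"
        using less.prems(2) fz assms(2,3) g(1) root(1) by (simp add: sg_mult mult_ac)
      moreover have "sos_sgn (x \<ominus> r) * sos_sgn (y \<ominus> r) \<noteq> - 1"
      proof
        assume a: "sos_sgn (x \<ominus> r) * sos_sgn (y \<ominus> r) = - 1"
        have sw: "sos_sgn (r \<ominus> x) = - sos_sgn (x \<ominus> r)" by (rule sg_diff_swap) (use root assms in auto)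
        consider "sos_sgn (x \<ominus> r) = 0" | "sos_sgn (x \<ominus> r) = 1" | "sos_sgn (x \<ominus> r) = - 1"
          using sg_range[of "x \<ominus> r"] assms root by auto
        then show False
        proof cases
          case 1
          then show ?thesis using a by simp
        next
          case 2
          then have "r \<ll> y" using prec_trans[of r x y] assms root by blast
          then show ?thesis using a 2 by simp
        next
          case 3
          then show ?thesis using a sw False by simp
        qed
      qed
      moreover have "sos_sgn (x \<ominus> r) * sos_sgn (y \<ominus> r) \<in> {0, 1, - 1}"
        "sos_sgn (pval g m x) * sos_sgn (pval g m y) \<in> {0, 1, - 1}"
        by (auto simp: sos_sgn_def)
      ultimately have "sos_sgn (pval g m x) * sos_sgn (pval g m y) = - 1" by auto
      then have "\<exists>z\<in>carrier R. x \<ll> z \<and> z \<ll> y \<and> eval g' z = \<zero>"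
        using less.hyps[OF g'(2,1)] ev' assms by simp
      then obtain z where z: "z \<in> carrier R" "x \<ll> z" "z \<ll> y" "eval g' z = \<zero>" by blast
      then have "eval f z = \<zero>" using fz ev' root(1) by simp
      then show ?thesis using z by blast
    qed
  next
    case (prod g h q)
    have fe: "eval f z = eval g z \<otimes> eval h z" if z: "z \<in> carrier R" for z
    proof -
      interpret evz: ring_hom_cring "poly_ring R" R "\<lambda>p. eval p z" by (rule eval_cring_hom[OF K z])
      show ?thesis unfolding prod(4) using prod by simp
    qed
    have fne: "f \<noteq> []" using df by auto
    have gne: "g \<noteq> []" using prod(5) by auto
    have hne: "h \<noteq> []"
    proof
      assume "h = []"
      then have "eval f x = \<zero>" using fe[OF assms(2)] ev[OF prod(1) assms(2)] by simp
      then show False using less.prems(2) by (simp add: sos_sgn_def)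
    qed
    have "degree f = degree g + degree h"
      using poly_mult_degree_eq[OF K, of g h] prod gne hne
      by (simp add: univ_poly_mult univ_poly_carrier del: poly_mult.simps)
    then have dh: "length h < length f" and dg: "length g \<le> length f"
      using prod(5) gne hne fne by (cases f; cases g; cases h; auto)+
    have "sos_sgn (eval g x) * sos_sgn (eval g y) * (sos_sgn (eval h x) * sos_sgn (eval h y)) = - 1"
      using less.prems(2) fe assms ev prod by (simp add: sg_mult mult_ac)
    moreover have "sos_sgn (eval g x) * sos_sgn (eval g y) \<in> {0, 1, - 1}"
        "sos_sgn (eval h x) * sos_sgn (eval h y) \<in> {0, 1, - 1}"
      by (auto simp: sos_sgn_def)
    ultimately consider "sos_sgn (eval h x) * sos_sgn (eval h y) = - 1" | "sos_sgn (eval g x) * sos_sgn (eval g y) = - 1"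
      by auto
    then show ?thesis
    proof cases
      case 1
      then obtain z where z: "z \<in> carrier R" "x \<ll> z" "z \<ll> y" "eval h z = \<zero>"
        using less.hyps[OF dh prod(2)] by blast
      then have "eval f z = \<zero>" using fe ev prod(1) by simp
      then show ?thesis using z by blast
    next
      case 2
      have gq: "sos_sgn (eval g z) * sos_sgn (eval q z) = 1" if z: "z \<in> carrier R" for z
      proof -
        obtain s where "s \<in> sos R" "eval g z \<otimes> eval q z = \<one> \<oplus> s" using prod(8)[OF z] by blast
        then have "sos_sgn (eval g z \<otimes> eval q z) = 1" using pos_sos_succ by simp
        then show ?thesis using ev prod z by (simp add: sg_mult)
      qed
      have eq: "sos_sgn (eval q z) = sos_sgn (eval g z)" if z: "z \<in> carrier R" for z
        using gq[OF z] by (auto simp: sos_sgn_def split: if_splits)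
      \<comment> \<open>\<open>g\<close> may be as long as \<open>f\<close>, but \<open>q\<close> is
        shorter than \<open>g\<close>, so the induction hypothesis applies to it.\<close>
      have "length q < length f" using prod(6,7) dg gne by (cases q; cases g; auto)
      then obtain z where z: "z \<in> carrier R" "eval q z = \<zero>"
        using less.hyps[OF _ prod(3)] 2 eq assms by auto
      then show ?thesis using gq[OF z(1)] by (simp add: sos_sgn_def)
    qed
  qed
qed

sublocale ivt_field R sos_sgn
proof
  fix a :: "nat \<Rightarrow> 'a" and x y n
  assume a: "\<And>i. a i \<in> carrier R" and h: "x \<in> carrier R" "y \<in> carrier R" "x \<ll> y"
    "sos_sgn (pval a n x) * sos_sgn (pval a n y) = - 1"
  define f where "f = normalize (map a (rev [0..<n]))"
  have gc: "set (map a (rev [0..<n])) \<subseteq> carrier R" using a by auto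
  have f: "f \<in> carrier (poly_ring R)"
    using normalize_gives_polynomial[OF gc] by (simp add: f_def univ_poly_carrier[symmetric])
  have "eval f z = pval a n z" if "z \<in> carrier R" for z
    unfolding f_def pval_def using eval_normalize[OF gc that] .
  then show "\<exists>z\<in>carrier R. x \<ll> z \<and> z \<ll> y \<and> pval a n z = \<zero>"
    using poly_intermediate_value[OF f h(1-3)] h by auto
qed

end

lemma (in maximal_real_subfield) sos_definite_F: "sos_definite_field F"
proof -
  interpret F: field F by (rule F_field)
  have K: "subring M L" using subfieldE(1)[OF M_subfield] .
  have m1: "\<ominus>\<^bsub>F\<^esub> \<one>\<^bsub>F\<^esub> = \<ominus> \<one>" using F_minus[OF M_subring(3)] by simp
  have ev: "ring.eval F = eval" using eval_consistent[OF K] .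
  have up: "univ_poly F = univ_poly L" using univ_poly_consistent[OF K] .
  show ?thesis
  proof
    show "\<ominus>\<^bsub>F\<^esub> \<one>\<^bsub>F\<^esub> \<notin> sos F" using real_F m1 by simp
    show "(\<exists>b\<in>carrier F. a = b \<otimes>\<^bsub>F\<^esub> b) \<or>
        (\<exists>p\<in>sos F. \<exists>q\<in>sos F. \<ominus>\<^bsub>F\<^esub> \<one>\<^bsub>F\<^esub> = p \<oplus>\<^bsub>F\<^esub> a \<otimes>\<^bsub>F\<^esub> q)" if "a \<in> carrier F" for a
      using square_or_minus_one[of a] that unfolding m1 by simp
    show "(\<exists>r\<in>carrier F. F.eval f r = \<zero>\<^bsub>F\<^esub>) \<or>
      (\<exists>g\<in>carrier (poly_ring F). \<exists>h\<in>carrier (poly_ring F). \<exists>q\<in>carrier (poly_ring F).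
        f = g \<otimes>\<^bsub>poly_ring F\<^esub> h \<and> degree g > 0 \<and> q \<noteq> [] \<and> degree q < degree g \<and>
        (\<forall>r\<in>carrier F. \<exists>s\<in>sos F. F.eval g r \<otimes>\<^bsub>F\<^esub> F.eval q r = \<one>\<^bsub>F\<^esub> \<oplus>\<^bsub>F\<^esub> s))"
      if "f \<in> carrier (poly_ring F)" "degree f > 0" for f
      using root_or_definite_product[of f] that unfolding ev up by simp
  qed
qed

text \<open>The carrier type of \<open>F\<close> is that of the algebraic closure of
  \<open>K\<close>, whose elements are indexed polynomials over \<open>K\<close>. The copy of
  \<open>K\<close> in it is real, so a maximal real subfield lies above it.\<close>

theorem real_field_embeds:
  fixes K :: "('a, 'p) ring_scheme"
  assumes "real_field K"
  shows "\<exists>(F :: (('a list \<times> nat) multiset \<Rightarrow> 'a) ring) h. sos_definite_field F \<and> h \<in> ring_hom K F"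
proof -
  have K: "field K" "\<ominus>\<^bsub>K\<^esub> \<one>\<^bsub>K\<^esub> \<notin> sos K" using assms by (auto simp: real_field_iff)
  interpret K: field K by fact
  define C where "C = K.alg_closure"
  define h where "h = (K.indexed_const :: 'a \<Rightarrow> ('a list \<times> nat) multiset \<Rightarrow> 'a)"
  have ac: "algebraic_closure C (h ` carrier K)" and hom: "h \<in> ring_hom K C"
    using K.alg_closureE by (auto simp: C_def h_def)
  interpret C: algebraic_closure C "h ` carrier K" by (rule ac)
  interpret h: ring_hom_cring K C h by unfold_locales (rule hom)
  have sf: "subfield (h ` carrier K) C" by (rule C.subfield_axioms)
  let ?K = "C\<lparr>carrier := h ` carrier K\<rparr>"
  have inj: "inj_on h (carrier K)" using K.indexed_const_inj_on by (simp add: h_def)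
  have pre: "\<exists>t\<in>sos K. s = h t" if "s \<in> sos ?K" for s
    using that
  proof induction
    case sos_zero
    show ?case using sos.sos_zero[of K] by (intro bexI[of _ "\<zero>\<^bsub>K\<^esub>"]) auto
  next
    case (sos_step x s)
    then obtain y t where "y \<in> carrier K" "x = h y" "t \<in> sos K" "s = h t" by auto
    then show ?case using sos.sos_step[of y K t] K.sos_closed
      by (intro bexI[of _ "y \<otimes>\<^bsub>K\<^esub> y \<oplus>\<^bsub>K\<^esub> t"]) auto
  qed
  have "\<ominus>\<^bsub>C\<^esub> \<one>\<^bsub>C\<^esub> \<notin> sos ?K"
  proof
    assume "\<ominus>\<^bsub>C\<^esub> \<one>\<^bsub>C\<^esub> \<in> sos ?K"
    then obtain t where t: "t \<in> sos K" "\<ominus>\<^bsub>C\<^esub> \<one>\<^bsub>C\<^esub> = h t" using pre by blast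
    then have "h (\<ominus>\<^bsub>K\<^esub> \<one>\<^bsub>K\<^esub>) = h t" by simp
    then have "\<ominus>\<^bsub>K\<^esub> \<one>\<^bsub>K\<^esub> = t"
      by (rule inj_onD[OF inj]) (use K.sos_closed[OF t(1)] in auto)
    then show False using K(2) t(1) by simp
  qed
  then have "C.real_subfield (h ` carrier K)" using sf unfolding C.real_subfield_def by simp
  then obtain M where M: "h ` carrier K \<subseteq> M" "C.real_subfield M"
    "\<And>M'. \<lbrakk> C.real_subfield M'; M \<subseteq> M' \<rbrakk> \<Longrightarrow> M' = M"
    using C.exists_maximal_real_subfield by metis
  interpret M: maximal_real_subfield C M by unfold_locales (use M(2,3) in auto)
  have "h \<in> ring_hom K (C\<lparr>carrier := M\<rparr>)"
    using hom M(1) by (auto simp: ring_hom_def)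
  then show ?thesis using M.sos_definite_F by blast
qed

section \<open>Real extensions of real closed fields\<close>

definition hom_algebra :: "('k \<Rightarrow> 'a) \<Rightarrow> ('a, 'p) ring_scheme \<Rightarrow> ('k, 'a) module"
  where "hom_algebra h A = \<lparr>carrier = carrier A, monoid.mult = monoid.mult A, one = \<one>\<^bsub>A\<^esub>,
    ring.zero = \<zero>\<^bsub>A\<^esub>, ring.add = ring.add A, smult = (\<lambda>c x. h c \<otimes>\<^bsub>A\<^esub> x)\<rparr>"

lemma hom_algebra_simps [simp]:
  "carrier (hom_algebra h A) = carrier A" "monoid.mult (hom_algebra h A) = monoid.mult A"
  "\<one>\<^bsub>hom_algebra h A\<^esub> = \<one>\<^bsub>A\<^esub>" "\<zero>\<^bsub>hom_algebra h A\<^esub> = \<zero>\<^bsub>A\<^esub>" "ring.add (hom_algebra h A) = ring.add A"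
  "c \<odot>\<^bsub>hom_algebra h A\<^esub> x = h c \<otimes>\<^bsub>A\<^esub> x"
  by (simp_all add: hom_algebra_def)

lemma hom_algebra_iso: "id \<in> ring_iso A (hom_algebra h A)"
  by (simp add: ring_iso_def ring_hom_def)

lemma hom_algebra_field: "field A \<Longrightarrow> field (hom_algebra h A)"
  using field.ring_iso_imp_img_field[OF _ hom_algebra_iso[of A h]] by (simp add: hom_algebra_def)

lemma hom_algebra_cring: "cring A \<Longrightarrow> cring (hom_algebra h A)"
  using cring.ring_iso_imp_img_cring[OF _ hom_algebra_iso[of A h]] by (simp add: hom_algebra_def)

lemma hom_algebra_algebra:
  assumes "cring k" "cring A" "h \<in> ring_hom k A"
  shows "algebra k (hom_algebra h A)"
proof -
  interpret k: cring k by fact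
  interpret A: cring A by fact
  interpret h: ring_hom_cring k A h by unfold_locales fact
  show ?thesis
    by (rule algebraI)
      (use assms(1) hom_algebra_cring[OF assms(2)] in
        \<open>auto simp: A.l_distr A.r_distr A.m_assoc\<close>)
qed

lemma structure_map_hom:
  assumes "algebra k A"
  shows "structure_map A \<in> ring_hom k A"
proof -
  interpret algebra k A by fact
  show ?thesis
  proof (rule ring_hom_memI)
    fix x y assume x: "x \<in> carrier k" and y: "y \<in> carrier k"
    show "structure_map A x \<in> carrier A" using x by (simp add: structure_map_def)
    show "structure_map A (x \<oplus>\<^bsub>k\<^esub> y) = structure_map A x \<oplus>\<^bsub>A\<^esub> structure_map A y"
      using x y by (simp add: structure_map_def smult_l_distr)
    have "structure_map A x \<otimes>\<^bsub>A\<^esub> structure_map A y = x \<odot>\<^bsub>A\<^esub> (\<one>\<^bsub>A\<^esub> \<otimes>\<^bsub>A\<^esub> (y \<odot>\<^bsub>A\<^esub> \<one>\<^bsub>A\<^esub>))"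
      unfolding structure_map_def by (rule smult_assoc2) (use x y in auto)
    then show "structure_map A (x \<otimes>\<^bsub>k\<^esub> y) = structure_map A x \<otimes>\<^bsub>A\<^esub> structure_map A y"
      using x y by (simp add: structure_map_def smult_assoc1)
  qed (simp add: structure_map_def)
qed

lemma image_subfield:
  assumes "field k" "field F" "h \<in> ring_hom k F"
  shows "subfield (h ` carrier k) F"
proof -
  interpret k: field k by fact
  interpret F: field F by fact
  interpret h: ring_hom_ring k F h by (rule ring_hom_ringI2) (use assms k.is_ring F.is_ring in auto)
  show ?thesis using h.img_is_subfield(2)[OF k.carrier_is_subfield] F.one_not_zero by simp
qed

text \<open>The simple extension is copied to a carrier of sets of lists by sending an element to the set of
  all coefficient lists that represent it.\<close>

lemma real_closed_contains_algebraic: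
  fixes k :: "('k, 'p) ring_scheme" and F :: "('a, 'q) ring_scheme"
  assumes "real_closed_field k" "real_field F" "h \<in> ring_hom k F" "x \<in> carrier F"
    and alg: "(ring.algebraic F over (h ` carrier k)) x"
  shows "x \<in> h ` carrier k"
proof -
  have kr: "real_field k" using assms(1) unfolding real_closed_field_def by blast
  have kf: "field k" and Ff: "field F" and Fm: "\<ominus>\<^bsub>F\<^esub> \<one>\<^bsub>F\<^esub> \<notin> sos F"
    using kr assms(2) by (auto simp: real_field_iff)
  interpret k: field k by fact
  interpret F: field F by fact
  let ?K = "h ` carrier k"
  have K: "subfield ?K F" using image_subfield[OF kf Ff assms(3)] .
  define E where "E = F.simple_extension ?K x"
  have E: "subfield E F" using F.simple_extension_is_subfield[OF K assms(4)] alg by (simp add: E_def)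
  have Ec: "E \<subseteq> carrier F" using subfieldE(3)[OF E] .
  have KE: "?K \<subseteq> E" using F.simple_extension_incl[OF subfieldE(3)[OF K] assms(4)] by (simp add: E_def)
  have xE: "x \<in> E" using F.simple_extension_mem[OF subfieldE(1)[OF K] assms(4)] by (simp add: E_def)
  define FE where "FE = F\<lparr>carrier := E\<rparr>"
  have FE: "field FE" using F.subfield_iff(2)[OF E] by (simp add: FE_def)
  interpret FE: field FE by fact
  define j where "j y = {l. set l \<subseteq> carrier k \<and> F.eval (map h l) x = y}" for y
  have "j y \<noteq> {}" if "y \<in> E" for y
  proof -
    obtain p where p: "p \<in> carrier (?K[X]\<^bsub>F\<^esub>)" "y = F.eval p x"
      using \<open>y \<in> E\<close> F.simple_extension_as_eval_img[OF subfieldE(3)[OF K] assms(4)] by (auto simp: E_def)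
    have "set p \<subseteq> ?K" using p(1) by (auto simp: univ_poly_carrier[symmetric] polynomial_def)
    then have "map h (map (inv_into (carrier k) h) p) = p" "set (map (inv_into (carrier k) h) p) \<subseteq> carrier k"
      by (auto simp: map_idI f_inv_into_f subsetD inv_into_into)
    then have "map (inv_into (carrier k) h) p \<in> j y"
      unfolding j_def p(2) by (intro CollectI conjI) (simp_all only:)
    then show ?thesis by blast
  qed
  note ne = this
  \<comment> \<open>Sets that belong to different elements are disjoint, and being nonempty they
    differ.\<close>
  have inj: "inj_on j (carrier FE)"
  proof (rule inj_onI)
    fix y z assume yz: "y \<in> carrier FE" "z \<in> carrier FE" "j y = j z"
    then have "j y \<noteq> {}" using ne by (simp add: FE_def)
    then obtain l where "l \<in> j y" "l \<in> j z" using yz(3) by blast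
    then show "y = z" unfolding j_def by simp
  qed
  define J where "J = image_ring j FE"
  have J: "field J" unfolding J_def using FE.inj_imp_image_ring_is_field[OF inj] .
  have jiso: "j \<in> ring_iso FE J" unfolding J_def using inj_imp_image_ring_iso[OF inj] .
  have hFE: "h \<in> ring_hom k FE"
    using assms(3) KE by (auto simp: ring_hom_def FE_def)
  have jh: "j \<circ> h \<in> ring_hom k J"
    using ring_hom_trans[OF hFE] jiso by (auto simp: ring_iso_def)
  define T where "T = hom_algebra (j \<circ> h) J"
  have Tf: "field T" unfolding T_def using hom_algebra_field[OF J] .
  interpret T: field T by fact
  have jT: "j \<in> ring_iso FE T" using jiso by (simp add: T_def ring_iso_def ring_hom_def)
  have Ta: "algebra k T" unfolding T_def
    by (rule hom_algebra_algebra[OF fieldE(1)[OF kf] fieldE(1)[OF J] jh])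
  have smc: "structure_map T c = j (h c)" if "c \<in> carrier k" for c
  proof -
    interpret J: field J by fact
    have "j (h c) \<in> carrier J" using jh that by (auto simp: ring_hom_def)
    then show ?thesis by (simp add: structure_map_def T_def)
  qed
  have sm: "structure_map T ` carrier k = j ` ?K" unfolding image_image using smc by (intro image_cong) auto
  have "(T.algebraic over (structure_map T ` carrier k)) y" if yT: "y \<in> carrier T" for y
  proof -
    have "carrier T = j ` E" using jT by (auto simp: ring_iso_def bij_betw_def FE_def)
    then obtain z where z: "z \<in> E" "y = j z" using yT by auto
    have "(F.algebraic over ?K) z"
      using F.simple_extesion_mem_imp_algebraic[OF K assms(4) alg] z(1) by (simp add: E_def)
    then have "(FE.algebraic over ?K) z"
      unfolding FE_def over_def F.transcendental_consistent[OF subfieldE(1)[OF E], symmetric] .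
    moreover have "subfield ?K FE"
      using FE.subfield_iff(1)[of ?K] F.subfield_iff(2)[OF K] KE by (simp add: FE_def)
    ultimately show ?thesis unfolding sm z(2)
      using algebraic_hom[of j FE T ?K z] jT FE Tf z(1) by (auto simp: ring_iso_def FE_def)
  qed
  \<comment> \<open>A sum of squares in \<open>T\<close> is carried to one in the real field
    \<open>F\<close>, as \<open>T\<close> is a copy of a subfield of \<open>F\<close>.\<close>
  moreover have "real_field T"
  proof -
    define g where "g = inv_into (carrier FE) j"
    have "g \<in> ring_iso T FE" unfolding g_def using ring_iso_set_sym[OF FE.is_ring jT] .
    then have g: "g \<in> ring_hom T F" using Ec by (auto simp: ring_iso_def ring_hom_def FE_def)
    interpret g: ring_hom_cring T F g by unfold_locales (rule g)
    have "\<ominus>\<^bsub>T\<^esub> \<one>\<^bsub>T\<^esub> \<notin> sos T"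
    proof
      assume "\<ominus>\<^bsub>T\<^esub> \<one>\<^bsub>T\<^esub> \<in> sos T"
      then have "g (\<ominus>\<^bsub>T\<^esub> \<one>\<^bsub>T\<^esub>) \<in> sos F" by (rule sos_hom[OF T.is_cring F.is_cring g])
      then show False using Fm by simp
    qed
    then show ?thesis using Tf by (simp add: real_field_iff)
  qed
  \<comment> \<open>The carrier type of the copy is the one over which real closedness quantifies,
    so the simple extension collapses to the image of \<open>k\<close>.\<close>
  ultimately have "structure_map T ` carrier k = carrier T"
    using assms(1) kf Tf Ta
    unfolding real_closed_field_def algebraic_extension_def field_extension_def by blast
  moreover have "j x \<in> carrier T" using jT xE by (auto simp: ring_iso_def ring_hom_def FE_def)
  ultimately obtain z where z: "z \<in> ?K" "j x = j z" unfolding sm by blast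
  have "carrier FE = E" by (simp add: FE_def)
  then have "x = z" using inj_onD[OF inj z(2)] xE KE z(1) by blast
  then show ?thesis using z by simp
qed

section \<open>Members of the signature as polynomial functions\<close>

lemma (in ring) indexed_pset_support:
  "P \<in> indexed_pset I K \<Longrightarrow> finite {m. P m \<noteq> \<zero>} \<and> (\<forall>m. P m \<noteq> \<zero> \<longrightarrow> set_mset m \<subseteq> I)"
proof (induction rule: indexed_pset.induct)
  case (indexed_const c)
  have "{m. indexed_const c m \<noteq> \<zero>} \<subseteq> {{#}}" by (auto simp: indexed_const_def)
  then show ?case using finite_subset by (auto simp: indexed_const_def)
next
  case (indexed_padd P Q)
  have "{m. indexed_padd P Q m \<noteq> \<zero>} \<subseteq> {m. P m \<noteq> \<zero>} \<union> {m. Q m \<noteq> \<zero>}"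
    by (auto simp: indexed_padd_def)
  moreover from this have "finite {m. indexed_padd P Q m \<noteq> \<zero>}"
    using indexed_padd.IH finite_subset by blast
  ultimately show ?case using indexed_padd.IH by blast
next
  case (indexed_pmult P i)
  have sub: "{m. indexed_pmult P i m \<noteq> \<zero>} \<subseteq> add_mset i ` {m. P m \<noteq> \<zero>}"
  proof
    fix m assume "m \<in> {m. indexed_pmult P i m \<noteq> \<zero>}"
    then have "i \<in># m" "P (m - {#i#}) \<noteq> \<zero>" by (auto simp: indexed_pmult_def split: if_splits)
    then show "m \<in> add_mset i ` {m. P m \<noteq> \<zero>}" by (intro image_eqI[of _ _ "m - {#i#}"]) auto
  qed
  then have "finite {m. indexed_pmult P i m \<noteq> \<zero>}"
    using indexed_pmult.IH finite_subset by blast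
  moreover have "set_mset m \<subseteq> I" if "indexed_pmult P i m \<noteq> \<zero>" for m
  proof -
    have "m \<in> add_mset i ` {m. P m \<noteq> \<zero>}" using sub that by blast
    then obtain m' where "m = add_mset i m'" "P m' \<noteq> \<zero>" by blast
    then show ?thesis using indexed_pmult by auto
  qed
  ultimately show ?case by blast
qed

text \<open>The conditions on \<open>a\<close> and \<open>e\<close> concern the variables that occur
  in \<open>P\<close>, because elsewhere the values of \<open>a\<close> may lie outside the
  carrier.\<close>

lemma poly_value_hom:
  assumes "cring A" "cring B" "h \<in> ring_hom A B"
    and \<phi>: "\<And>m. \<phi> (P m) \<in> carrier A"
    and ab: "\<And>m i. P m \<noteq> \<zero>\<^bsub>k\<^esub> \<Longrightarrow> i \<in># m \<Longrightarrow> (a(0 := b)) i \<in> carrier A"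
    and ee: "\<And>m i. P m \<noteq> \<zero>\<^bsub>k\<^esub> \<Longrightarrow> i \<in># m \<Longrightarrow> e i = h ((a(0 := b)) i)"
  shows "h (poly_value k A \<phi> P a b) = poly_value k B (h \<circ> \<phi>) P e (e 0)"
proof -
  interpret A: cring A by fact
  interpret B: cring B by fact
  interpret h: ring_hom_cring A B h by unfold_locales (rule assms(3))
  let ?t = "\<lambda>m. \<Otimes>\<^bsub>A\<^esub>i\<in>set_mset m. (a(0 := b)) i [^]\<^bsub>A\<^esub> count m i"
  have t: "?t m \<in> carrier A" if "P m \<noteq> \<zero>\<^bsub>k\<^esub>" for m
    using ab[OF that] by (intro A.finprod_closed) (auto simp: Pi_def simp del: fun_upd_apply)
  have ht: "h (?t m) = (\<Otimes>\<^bsub>B\<^esub>i\<in>set_mset m. e i [^]\<^bsub>B\<^esub> count m i)" if m: "P m \<noteq> \<zero>\<^bsub>k\<^esub>" for m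
  proof -
    have "h (?t m) = (\<Otimes>\<^bsub>B\<^esub>i\<in>set_mset m. (h \<circ> (\<lambda>i. (a(0 := b)) i [^]\<^bsub>A\<^esub> count m i)) i)"
      using ab[OF m] by (intro h.hom_finprod) (auto simp: Pi_def simp del: fun_upd_apply)
    also have "\<dots> = (\<Otimes>\<^bsub>B\<^esub>i\<in>set_mset m. e i [^]\<^bsub>B\<^esub> count m i)"
      by (rule B.finprod_cong') (use ab[OF m] ee[OF m] in \<open>auto simp: Pi_def h.hom_pow simp del: fun_upd_apply\<close>)
    finally show ?thesis .
  qed
  have "h (poly_value k A \<phi> P a b) = (\<Oplus>\<^bsub>B\<^esub>m\<in>{m. P m \<noteq> \<zero>\<^bsub>k\<^esub>}. (h \<circ> (\<lambda>m. \<phi> (P m) \<otimes>\<^bsub>A\<^esub> ?t m)) m)"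
    unfolding poly_value_def by (rule h.hom_finsum) (use \<phi> t in auto)
  also have "\<dots> = (\<Oplus>\<^bsub>B\<^esub>m\<in>{m. P m \<noteq> \<zero>\<^bsub>k\<^esub>}. (h \<circ> \<phi>) (P m) \<otimes>\<^bsub>B\<^esub> (\<Otimes>\<^bsub>B\<^esub>i\<in>set_mset m. (e(0 := e 0)) i [^]\<^bsub>B\<^esub> count m i))"
  proof (rule B.finsum_cong')
    show "(\<lambda>m. (h \<circ> \<phi>) (P m) \<otimes>\<^bsub>B\<^esub> (\<Otimes>\<^bsub>B\<^esub>i\<in>set_mset m. (e(0 := e 0)) i [^]\<^bsub>B\<^esub> count m i))
        \<in> {m. P m \<noteq> \<zero>\<^bsub>k\<^esub>} \<rightarrow> carrier B"
      using ht[symmetric] t \<phi> by (auto simp: Pi_def)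
  qed (use ht t \<phi> in auto)
  finally show ?thesis by (simp add: poly_value_def)
qed

context ivt_pair
begin

lemma polyfun_finsum:
  assumes "finite I" "\<And>i. i \<in> I \<Longrightarrow> f i \<in> polyfun n"
  shows "\<exists>g\<in>polyfun n. \<forall>e. range e \<subseteq> carrier R \<longrightarrow> g e = (\<Oplus>i\<in>I. f i e)"
  using assms
proof (induction I)
  case empty
  show ?case by (intro bexI[OF _ polyfun_zero]) auto
next
  case (insert i I)
  then obtain g where g: "g \<in> polyfun n" "\<forall>e. range e \<subseteq> carrier R \<longrightarrow> g e = (\<Oplus>i\<in>I. f i e)" by auto
  have "f i e \<oplus> g e = (\<Oplus>i\<in>insert i I. f i e)" if e: "range e \<subseteq> carrier R" for e
  proof -
    have "f j e \<in> carrier R" if "j \<in> insert i I" for j using polyfun_closed[OF insert.prems[OF that] e] .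
    then show ?thesis using g(2) e insert.hyps by (subst finsum_insert) (auto simp: Pi_def)
  qed
  then show ?case using polyfun_add[OF insert.prems[of i] g(1)] by (intro bexI[of _ "\<lambda>e. f i e \<oplus> g e"]) auto
qed

lemma polyfun_finprod:
  assumes "finite I" "\<And>i. i \<in> I \<Longrightarrow> f i \<in> polyfun n"
  shows "\<exists>g\<in>polyfun n. \<forall>e. range e \<subseteq> carrier R \<longrightarrow> g e = (\<Otimes>i\<in>I. f i e)"
  using assms
proof (induction I)
  case empty
  show ?case by (intro bexI[OF _ polyfun_one]) auto
next
  case (insert i I)
  then obtain g where g: "g \<in> polyfun n" "\<forall>e. range e \<subseteq> carrier R \<longrightarrow> g e = (\<Otimes>i\<in>I. f i e)" by auto
  have "f i e \<otimes> g e = (\<Otimes>i\<in>insert i I. f i e)" if e: "range e \<subseteq> carrier R" for e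
  proof -
    have "f j e \<in> carrier R" if "j \<in> insert i I" for j using polyfun_closed[OF insert.prems[OF that] e] .
    then show ?thesis using g(2) e insert.hyps by (subst finprod_insert) (auto simp: Pi_def)
  qed
  then show ?case using polyfun_mult[OF insert.prems[of i] g(1)] by (intro bexI[of _ "\<lambda>e. f i e \<otimes> g e"]) auto
qed

text \<open>There are \<open>Suc n\<close> variables because Y, at index 0, is counted. Equality is
  claimed for values in the carrier, where finite sums and products can be unfolded.\<close>

lemma polyfun_poly_value:
  assumes "finite {m. P m \<noteq> \<zero>\<^bsub>k\<^esub>}" "\<And>m. P m \<noteq> \<zero>\<^bsub>k\<^esub> \<Longrightarrow> set_mset m \<subseteq> {0..n}" "\<And>m. \<iota> (P m) \<in> K"
  shows "\<exists>g\<in>polyfun (Suc n). \<forall>e. range e \<subseteq> carrier R \<longrightarrow> g e = poly_value k R \<iota> P e (e 0)"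
proof -
  define good where "good m t \<longleftrightarrow> t \<in> polyfun (Suc n) \<and>
    (\<forall>e. range e \<subseteq> carrier R \<longrightarrow> t e = \<iota> (P m) \<otimes> (\<Otimes>i\<in>set_mset m. e i [^] count m i))" for m t
  have "\<exists>t. good m t" if m: "P m \<noteq> \<zero>\<^bsub>k\<^esub>" for m
  proof -
    have "(\<lambda>e. e i [^] count m i) \<in> polyfun (Suc n)" if "i \<in># m" for i
      by (rule polyfun_pow, rule polyfun_var) (use assms(2)[OF m] that in auto)
    then obtain g where g: "g \<in> polyfun (Suc n)"
      "\<forall>e. range e \<subseteq> carrier R \<longrightarrow> g e = (\<Otimes>i\<in>set_mset m. e i [^] count m i)"
      using polyfun_finprod[of "set_mset m" "\<lambda>i e. e i [^] count m i" "Suc n"] by auto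
    then show ?thesis unfolding good_def using polyfun_mult[OF polyfun_const[OF assms(3)[of m]] g(1)]
      by (intro exI[of _ "\<lambda>e. \<iota> (P m) \<otimes> g e"]) auto
  qed
  then obtain t where "\<And>m. P m \<noteq> \<zero>\<^bsub>k\<^esub> \<Longrightarrow> good m (t m)" by metis
  then have t: "\<And>m. P m \<noteq> \<zero>\<^bsub>k\<^esub> \<Longrightarrow> t m \<in> polyfun (Suc n)"
    "\<And>m e. \<lbrakk> P m \<noteq> \<zero>\<^bsub>k\<^esub>; range e \<subseteq> carrier R \<rbrakk> \<Longrightarrow>
      t m e = \<iota> (P m) \<otimes> (\<Otimes>i\<in>set_mset m. e i [^] count m i)"
    unfolding good_def by auto
  obtain g where g: "g \<in> polyfun (Suc n)"
    "\<And>e. range e \<subseteq> carrier R \<Longrightarrow> g e = (\<Oplus>m\<in>{m. P m \<noteq> \<zero>\<^bsub>k\<^esub>}. t m e)"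
    using polyfun_finsum[OF assms(1), of t "Suc n"] t(1) by auto
  have "g e = poly_value k R \<iota> P e (e 0)" if e: "range e \<subseteq> carrier R" for e
  proof -
    have ec: "e i \<in> carrier R" for i using e by blast
    have "\<iota> (P m) \<in> carrier R" for m using assms(3) K_carrier by blast
    then have "(\<Oplus>m\<in>{m. P m \<noteq> \<zero>\<^bsub>k\<^esub>}. t m e) =
        (\<Oplus>m\<in>{m. P m \<noteq> \<zero>\<^bsub>k\<^esub>}. \<iota> (P m) \<otimes> (\<Otimes>i\<in>set_mset m. e i [^] count m i))"
      using t(2)[OF _ e] ec by (intro finsum_cong') (auto simp: Pi_def intro!: finprod_closed m_closed)
    then show ?thesis using g(2)[OF e] by (simp add: poly_value_def)
  qed
  then show ?thesis using g(1) by blast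
qed

end

theorem real_extension_special:
  fixes k :: "('k, 'p) ring_scheme" and L :: "('k, 'a, 'q) module_scheme"
  assumes k: "real_closed_field k" and L: "field_extension k L" "real_field L"
  shows "special_extension k L"
proof -
  have kf: "field k" and Lf: "field L" and La: "algebra k L"
    using L(1) unfolding field_extension_def by auto
  interpret k: field k by fact
  interpret L: field L by fact
  have sm: "structure_map L \<in> ring_hom k L" using structure_map_hom[OF La] .
  obtain F :: "(('a list \<times> nat) multiset \<Rightarrow> 'a) ring" and h where F: "sos_definite_field F" "h \<in> ring_hom L F"
    using real_field_embeds[OF L(2)] by blast
  interpret F: sos_definite_field F by fact
  have Ff: "field F" ..
  have Fr: "real_field F" using Ff F.real by (simp add: real_field_iff)
  interpret h: ring_hom_cring L F h by unfold_locales (rule F(2))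
  define \<iota> where "\<iota> = h \<circ> structure_map L"
  have \<iota>: "\<iota> \<in> ring_hom k F" unfolding \<iota>_def using ring_hom_trans[OF sm F(2)] .
  interpret \<iota>: ring_hom_cring k F \<iota> by unfold_locales (rule \<iota>)
  have injh: "inj_on h (carrier L)" using non_trivial_field_hom_is_inj[OF F(2) Lf Ff] .
  have inj\<iota>: "inj_on \<iota> (carrier k)" using non_trivial_field_hom_is_inj[OF \<iota> kf Ff] .
  interpret ivt_pair F F.sos_sgn "\<iota> ` carrier k"
  proof (intro ivt_pair.intro ivt_pair_axioms.intro)
    show "ivt_field F F.sos_sgn" by (rule F.ivt_field_axioms)
    show K: "subfield (\<iota> ` carrier k) F" using image_subfield[OF kf Ff \<iota>] .
    \<comment> \<open>Real closedness of \<open>k\<close> enters here: \<open>F\<close> is real and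
      \<open>x\<close> is algebraic over the image of \<open>k\<close>.\<close>
    show "x \<in> \<iota> ` carrier k" if h: "\<And>i. a i \<in> \<iota> ` carrier k" "0 < n" "a (n - 1) \<noteq> \<zero>\<^bsub>F\<^esub>"
      "x \<in> carrier F" "F.pval a n x = \<zero>\<^bsub>F\<^esub>" for a n x
    proof (rule real_closed_contains_algebraic[OF k Fr \<iota> h(4)])
      let ?f = "map a (rev [0..<n])"
      obtain m where m: "n = Suc m" using h(2) by (cases n) auto
      have "?f \<in> carrier ((\<iota> ` carrier k)[X]\<^bsub>F\<^esub>)" "?f \<noteq> []"
        using h(1,3) m by (auto simp: univ_poly_carrier[symmetric] polynomial_def)
      then show "(F.algebraic over (\<iota> ` carrier k)) x"
        using F.algebraicI h(5) unfolding F.pval_def by blast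
    qed
  qed
  have "b = \<zero>\<^bsub>L\<^esub>"
    if P: "P \<in> homogeneous_signature k n" and a: "a \<in> {1..n} \<rightarrow> carrier L" and b: "b \<in> carrier L"
      and v: "poly_value k L (structure_map L) P a b = \<zero>\<^bsub>L\<^esub>" for n P a b
  proof -
    have P1: "P \<in> k.indexed_pset {0..n} (carrier k)"
      and P2: "\<And>a b. \<lbrakk> a \<in> {1..n} \<rightarrow> carrier k; b \<in> carrier k; poly_value k k (\<lambda>c. c) P a b = \<zero>\<^bsub>k\<^esub> \<rbrakk> \<Longrightarrow> b = \<zero>\<^bsub>k\<^esub>"
      using P unfolding homogeneous_signature_def by auto
    have fin: "finite {m. P m \<noteq> \<zero>\<^bsub>k\<^esub>}" and supp: "\<And>m. P m \<noteq> \<zero>\<^bsub>k\<^esub> \<Longrightarrow> set_mset m \<subseteq> {0..n}"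
      using k.indexed_pset_support[OF P1] by auto
    have Pc: "P m \<in> carrier k" for m
      using k.indexed_pset_in_carrier[OF subset_refl P1] unfolding k.carrier_coeff_def by blast
    obtain g where g: "g \<in> polyfun (Suc n)"
      "\<And>e. range e \<subseteq> carrier F \<Longrightarrow> g e = poly_value k F \<iota> P e (e 0)"
      using polyfun_poly_value[OF fin supp, of \<iota>] Pc by auto
    \<comment> \<open>The image of the given zero of \<open>P\<close>. Beyond index
      \<open>n\<close>, where \<open>a\<close> is arbitrary, the default zero keeps the point in the
      carrier.\<close>
    define e where "e i = (if i \<le> n then h ((a(0 := b)) i) else \<zero>\<^bsub>F\<^esub>)" for i
    have ab: "(a(0 := b)) i \<in> carrier L" if "i \<le> n" for i
      using a b that by (cases i) (auto simp: Pi_def)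
    have e: "range e \<subseteq> carrier F" using ab by (auto simp: e_def simp del: fun_upd_apply)
    have "h (poly_value k L (structure_map L) P a b) = poly_value k F \<iota> P e (e 0)"
      unfolding \<iota>_def
    proof (rule poly_value_hom[OF L.is_cring F.is_cring F(2)])
      show "structure_map L (P m) \<in> carrier L" for m using sm Pc by (auto simp: ring_hom_def)
      fix m i assume "P m \<noteq> \<zero>\<^bsub>k\<^esub>" "i \<in># m"
      then have "i \<le> n" using supp[of m] by auto
      then show "(a(0 := b)) i \<in> carrier L" "e i = h ((a(0 := b)) i)" using ab by (auto simp: e_def simp del: fun_upd_apply)
    qed
    then have ge: "g e = \<zero>\<^bsub>F\<^esub>" using g(2)[OF e] v by simp
    \<comment> \<open>Two signs are transferred: that of the value of \<open>P\<close>, which is 0,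
      and that of the coordinate of Y, so that the new zero has Y = 0 exactly if the old one
      has.\<close>
    obtain r where r: "range r \<subseteq> \<iota> ` carrier k"
      "F.sos_sgn (g r) = F.sos_sgn (g e)" "F.sos_sgn (r 0) = F.sos_sgn (e 0)"
      using sign_transfer_subfield[of "{g, \<lambda>e. e 0}" "Suc n" e] g(1) polyfun_var[of 0 "Suc n"] e by auto
    define s where "s i = inv_into (carrier k) \<iota> (r i)" for i
    have s: "s i \<in> carrier k" "\<iota> (s i) = r i" for i
      using r(1) by (auto simp: s_def inv_into_into f_inv_into_f subset_iff)
    have "r i \<in> carrier F" for i using \<iota>.hom_closed[OF s(1)[of i]] s(2)[of i] by simp
    then have rc: "range r \<subseteq> carrier F" by auto
    have "g r \<in> carrier F" using polyfun_closed[OF g(1) rc] .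
    then have "g r = \<zero>\<^bsub>F\<^esub>" using r(2) ge F.sg_0_iff[of "g r"] by simp
    moreover have "\<iota> (poly_value k k (\<lambda>c. c) P s (s 0)) = poly_value k F (\<iota> \<circ> (\<lambda>c. c)) P r (r 0)"
      by (rule poly_value_hom[OF k.is_cring F.is_cring \<iota>]) (use Pc s in auto)
    ultimately have "\<iota> (poly_value k k (\<lambda>c. c) P s (s 0)) = \<iota> \<zero>\<^bsub>k\<^esub>"
      using g(2)[OF rc] by (simp add: comp_def)
    moreover have "poly_value k k (\<lambda>c. c) P s (s 0) \<in> carrier k"
      unfolding poly_value_def using Pc s
      by (intro k.finsum_closed) (auto simp: Pi_def intro!: k.m_closed k.finprod_closed)
    ultimately have "poly_value k k (\<lambda>c. c) P s (s 0) = \<zero>\<^bsub>k\<^esub>" using inj_onD[OF inj\<iota>] by blast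
    then have "s 0 = \<zero>\<^bsub>k\<^esub>" using P2[of s "s 0"] s by simp
    then have "r 0 = \<zero>\<^bsub>F\<^esub>" using s(2)[of 0] by simp
    then have "e 0 = \<zero>\<^bsub>F\<^esub>" using r(3) F.sg_0_iff[of "e 0"] e by auto
    then have "h b = h \<zero>\<^bsub>L\<^esub>" by (simp add: e_def)
    then show ?thesis using inj_onD[OF injh] b by blast
  qed
  then show ?thesis using L(1) La unfolding special_extension_def special_algebra_def by blast
qed

section \<open>Morphisms into special extensions\<close>

lemma (in cring) finsum_squares_sos:
  assumes "finite I" "\<And>i. i \<in> I \<Longrightarrow> x i \<in> carrier R"
  shows "(\<Oplus>i\<in>I. x i \<otimes> x i) \<in> sos R"
  using assms
proof (induction I)
  case (insert i I)
  have "(\<Oplus>i\<in>insert i I. x i \<otimes> x i) = x i \<otimes> x i \<oplus> (\<Oplus>i\<in>I. x i \<otimes> x i)"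
    using insert by (intro finsum_insert) auto
  then show ?case using insert sos_step[of "x i" R] by simp
qed (simp add: sos_zero)

text \<open>Otherwise -1 = b^(-2) s would be a sum of squares.\<close>

lemma (in field) real_sum_zero:
  assumes "\<ominus> \<one> \<notin> sos R" "b \<in> carrier R" "s \<in> sos R" "b \<otimes> b \<oplus> s = \<zero>"
  shows "b = \<zero>"
proof (rule ccontr)
  assume "b \<noteq> \<zero>"
  then have u: "b \<in> Units R" using assms(2) by (simp add: field_Units)
  define i where "i = inv b"
  have i: "i \<in> carrier R" "i \<otimes> b = \<one>" using u by (auto simp: i_def)
  have sc: "s \<in> carrier R" using sos_closed assms(3) .
  have "i \<otimes> i \<otimes> s = i \<otimes> i \<otimes> (b \<otimes> b \<oplus> s) \<ominus> (i \<otimes> b) \<otimes> (i \<otimes> b)"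
    using i(1) assms(2) sc by algebra
  also have "\<dots> = \<ominus> \<one>" unfolding assms(4) i(2) using i(1) by (simp add: a_minus_def)
  finally show False using sos_square_mult[OF assms(3) i(1)] assms(1) by simp
qed

section \<open>The form Y^2 + X_1^2 + ... + X_n^2\<close>

lemma mset_pair_eq_iff: "{#i, i#} = {#j, j#} \<longleftrightarrow> i = j"
proof
  assume "{#i, i#} = {#j, j#}"
  then have "set_mset {#i, i#} = set_mset {#j, j#}" by (simp only:)
  then show "i = j" by simp
qed simp

text \<open>The multisets \<open>{#i, i#}\<close> are the squares of the variables, with Y at index
  0.\<close>

definition square_sum_poly :: "('k, 'p) ring_scheme \<Rightarrow> nat \<Rightarrow> nat multiset \<Rightarrow> 'k"
  where "square_sum_poly k n m = (if m \<in> (\<lambda>i. {#i, i#}) ` {0..n} then \<one>\<^bsub>k\<^esub> else \<zero>\<^bsub>k\<^esub>)"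

text \<open>\<open>indexed_pset\<close> is inductive, so the form is built up by adding one square
  of a variable at a time.\<close>

lemma (in domain) square_sum_poly_indexed:
  "square_sum_poly R n \<in> indexed_pset {0..n} (carrier R)"
proof -
  have "(\<lambda>m. if m \<in> (\<lambda>i. {#i, i#}) ` J then \<one> else \<zero>) \<in> indexed_pset {0..n} (carrier R)"
    if "finite J" "J \<subseteq> {0..n}" for J
    using that
  proof (induction J)
    case empty
    have "indexed_const \<zero> \<in> indexed_pset {0..n} (carrier R)" by (rule indexed_pset.indexed_const) simp
    then show ?case by (simp add: indexed_const_def)
  next
    case (insert j J)
    let ?P = "\<lambda>m. if m \<in> (\<lambda>i. {#i, i#}) ` J then \<one> else \<zero>"
    let ?Q = "indexed_pmult (indexed_pmult (indexed_const \<one>) j) j"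
    have "?P \<in> indexed_pset {0..n} (carrier R)" using insert by simp
    moreover have "?Q \<in> indexed_pset {0..n} (carrier R)"
      using insert.prems by (intro indexed_pset.indexed_pmult indexed_pset.indexed_const) auto
    ultimately have "indexed_padd ?P ?Q \<in> indexed_pset {0..n} (carrier R)" by (rule indexed_pset.indexed_padd)
    moreover have Q: "?Q m = (if m = {#j, j#} then \<one> else \<zero>)" for m
    proof (cases "m = {#j, j#}")
      case False
      have "m = {#j, j#}" if "j \<in># m" "j \<in># m - {#j#}" "m - {#j#} - {#j#} = {#}"
        using that by (metis add_mset_diff_bothsides insert_DiffM diff_empty)
      then show ?thesis using False by (auto simp: indexed_pmult_def indexed_const_def)
    qed (simp add: indexed_pmult_def indexed_const_def)
    moreover have "{#j, j#} \<notin> (\<lambda>i. {#i, i#}) ` J"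
      using insert.hyps(2) by (auto simp: mset_pair_eq_iff)
    ultimately show ?case unfolding indexed_padd_def Q
      by (auto simp: fun_eq_iff elim!: back_subst[of "\<lambda>f. f \<in> indexed_pset {0..n} (carrier R)"])
  qed
  from this[of "{0..n}"] show ?thesis unfolding square_sum_poly_def by simp
qed

lemma poly_value_square_sum:
  assumes "domain k" "cring A" "\<phi> \<one>\<^bsub>k\<^esub> = \<one>\<^bsub>A\<^esub>" "a \<in> {1..n} \<rightarrow> carrier A" "b \<in> carrier A"
  shows "poly_value k A \<phi> (square_sum_poly k n) a b =
    b \<otimes>\<^bsub>A\<^esub> b \<oplus>\<^bsub>A\<^esub> (\<Oplus>\<^bsub>A\<^esub>i\<in>{1..n}. a i \<otimes>\<^bsub>A\<^esub> a i)"
proof -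
  interpret k: domain k by fact
  interpret A: cring A by fact
  let ?d = "\<lambda>i::nat. {#i, i#}" and ?e = "a(0 := b)"
  have supp: "{m. square_sum_poly k n m \<noteq> \<zero>\<^bsub>k\<^esub>} = ?d ` {0..n}" by (auto simp: square_sum_poly_def)
  have e: "?e i \<in> carrier A" if "i \<in> {0..n}" for i using that assms(4,5) by (cases i) (auto simp: Pi_def)
  have val: "\<phi> (square_sum_poly k n (?d i)) \<otimes>\<^bsub>A\<^esub> (\<Otimes>\<^bsub>A\<^esub>j\<in>set_mset (?d i). ?e j [^]\<^bsub>A\<^esub> count (?d i) j) =
      ?e i \<otimes>\<^bsub>A\<^esub> ?e i" if i: "i \<in> {0..n}" for i
  proof -
    have "(\<Otimes>\<^bsub>A\<^esub>j\<in>{i}. ?e j [^]\<^bsub>A\<^esub> count (?d i) j) = ?e i [^]\<^bsub>A\<^esub> count (?d i) i"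
      using A.finprod_insert[of "{}" i "\<lambda>j. ?e j [^]\<^bsub>A\<^esub> count (?d i) j"] e[OF i] by (auto simp del: fun_upd_apply)
    moreover have "square_sum_poly k n (?d i) = \<one>\<^bsub>k\<^esub>" using i by (simp add: square_sum_poly_def)
    moreover have "?e i [^]\<^bsub>A\<^esub> count (?d i) i = ?e i \<otimes>\<^bsub>A\<^esub> ?e i"
      using e[OF i] by (simp add: numeral_2_eq_2 del: fun_upd_apply)
    ultimately show ?thesis using e[OF i] assms(3) by (simp del: fun_upd_apply)
  qed
  have inj: "inj_on ?d {0..n}" unfolding inj_on_def mset_pair_eq_iff by blast
  have "poly_value k A \<phi> (square_sum_poly k n) a b =
      (\<Oplus>\<^bsub>A\<^esub>i\<in>{0..n}. \<phi> (square_sum_poly k n (?d i)) \<otimes>\<^bsub>A\<^esub> (\<Otimes>\<^bsub>A\<^esub>j\<in>set_mset (?d i). ?e j [^]\<^bsub>A\<^esub> count (?d i) j))"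
    unfolding poly_value_def supp
    by (rule A.finsum_reindex[OF _ inj]) (use val e in \<open>auto simp: Pi_def simp del: fun_upd_apply\<close>)
  also have "\<dots> = (\<Oplus>\<^bsub>A\<^esub>i\<in>{0..n}. ?e i \<otimes>\<^bsub>A\<^esub> ?e i)"
    by (rule A.finsum_cong') (use val e in \<open>auto simp: Pi_def simp del: fun_upd_apply\<close>)
  also have "{0..n} = insert 0 {1..n}" by auto
  also have "(\<Oplus>\<^bsub>A\<^esub>i\<in>insert 0 {1..n}. ?e i \<otimes>\<^bsub>A\<^esub> ?e i) = b \<otimes>\<^bsub>A\<^esub> b \<oplus>\<^bsub>A\<^esub> (\<Oplus>\<^bsub>A\<^esub>i\<in>{1..n}. ?e i \<otimes>\<^bsub>A\<^esub> ?e i)"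
    using assms(4,5) by (subst A.finsum_insert) (auto simp: Pi_def)
  also have "(\<Oplus>\<^bsub>A\<^esub>i\<in>{1..n}. ?e i \<otimes>\<^bsub>A\<^esub> ?e i) = (\<Oplus>\<^bsub>A\<^esub>i\<in>{1..n}. a i \<otimes>\<^bsub>A\<^esub> a i)"
    by (rule A.finsum_cong') (use assms(4) in \<open>auto simp: Pi_def\<close>)
  finally show ?thesis .
qed

lemma square_sum_poly_signature:
  assumes "real_field k"
  shows "square_sum_poly k n \<in> homogeneous_signature k n"
proof -
  have k: "field k" "\<ominus>\<^bsub>k\<^esub> \<one>\<^bsub>k\<^esub> \<notin> sos k" using assms by (auto simp: real_field_iff)
  interpret k: field k by fact
  have "square_sum_poly k n {#0, 0#} = \<one>\<^bsub>k\<^esub>" by (simp add: square_sum_poly_def)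
  then have "square_sum_poly k n \<noteq> (\<lambda>_. \<zero>\<^bsub>k\<^esub>)" by (metis k.one_not_zero)
  moreover have "homogeneous_poly k (square_sum_poly k n)"
    unfolding homogeneous_poly_def by (intro exI[of _ 2]) (auto simp: square_sum_poly_def)
  moreover have "b = \<zero>\<^bsub>k\<^esub>" if "a \<in> {1..n} \<rightarrow> carrier k" "b \<in> carrier k"
    "poly_value k k (\<lambda>c. c) (square_sum_poly k n) a b = \<zero>\<^bsub>k\<^esub>" for a b
  proof -
    have "(\<Oplus>\<^bsub>k\<^esub>i\<in>{1..n}. a i \<otimes>\<^bsub>k\<^esub> a i) \<in> sos k"
      using that(1) by (intro k.finsum_squares_sos) (auto simp: Pi_def)
    then show ?thesis
      using k.real_sum_zero[OF k(2) that(2)] that poly_value_square_sum[OF k.domain_axioms k.is_cring, of "\<lambda>c. c" a n b]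
      by simp
  qed
  ultimately show ?thesis unfolding homogeneous_signature_def using k.square_sum_poly_indexed by blast
qed

text \<open>If -1 is a sum of squares in \<open>F\<close>, the form vanishes at these elements with
  Y = 1, and speciality would give 1 = 0.\<close>

theorem special_extension_real:
  assumes "real_field k" "special_extension k F"
  shows "real_field F"
proof -
  have F: "field F" and Fa: "algebra k F" and sp: "special_algebra k F"
    using assms(2) unfolding special_extension_def field_extension_def by auto
  have k: "field k" using assms(1) by (simp add: real_field_iff)
  interpret k: field k by fact
  interpret F: field F by fact
  have "\<not> sum_of_squares F (\<ominus>\<^bsub>F\<^esub> \<one>\<^bsub>F\<^esub>)"
  proof
    assume "sum_of_squares F (\<ominus>\<^bsub>F\<^esub> \<one>\<^bsub>F\<^esub>)"
    then obtain n :: nat and x where x: "x \<in> {..<n} \<rightarrow> carrier F"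
      "\<ominus>\<^bsub>F\<^esub> \<one>\<^bsub>F\<^esub> = (\<Oplus>\<^bsub>F\<^esub>i\<in>{..<n}. x i [^]\<^bsub>F\<^esub> (2::nat))"
      unfolding sum_of_squares_def by blast
    \<comment> \<open>Sums of squares are indexed from 0, the variables X_i from 1.\<close>
    define a where "a i = x (i - 1)" for i
    have a: "a \<in> {1..n} \<rightarrow> carrier F" using x(1) by (auto simp: a_def Pi_def)
    have "(\<Oplus>\<^bsub>F\<^esub>i\<in>{1..n}. a i \<otimes>\<^bsub>F\<^esub> a i) = (\<Oplus>\<^bsub>F\<^esub>i\<in>Suc ` {..<n}. a i \<otimes>\<^bsub>F\<^esub> a i)"
      by (simp add: image_Suc_lessThan)
    also have "\<dots> = (\<Oplus>\<^bsub>F\<^esub>i\<in>{..<n}. a (Suc i) \<otimes>\<^bsub>F\<^esub> a (Suc i))"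
      by (rule F.finsum_reindex) (use x(1) in \<open>auto simp: a_def Pi_def\<close>)
    also have "\<dots> = (\<Oplus>\<^bsub>F\<^esub>i\<in>{..<n}. x i [^]\<^bsub>F\<^esub> (2::nat))"
      by (rule F.finsum_cong') (use x(1) in \<open>auto simp: a_def Pi_def numeral_2_eq_2\<close>)
    also have "\<dots> = \<ominus>\<^bsub>F\<^esub> \<one>\<^bsub>F\<^esub>" using x(2) by simp
    finally have s: "(\<Oplus>\<^bsub>F\<^esub>i\<in>{1..n}. a i \<otimes>\<^bsub>F\<^esub> a i) = \<ominus>\<^bsub>F\<^esub> \<one>\<^bsub>F\<^esub>" .
    have "structure_map F \<one>\<^bsub>k\<^esub> = \<one>\<^bsub>F\<^esub>" using structure_map_hom[OF Fa] by (simp add: ring_hom_one)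
    then have "poly_value k F (structure_map F) (square_sum_poly k n) a \<one>\<^bsub>F\<^esub> = \<zero>\<^bsub>F\<^esub>"
      using poly_value_square_sum[OF k.domain_axioms F.is_cring _ a F.one_closed] s by (simp add: F.r_neg)
    then have "\<one>\<^bsub>F\<^esub> = \<zero>\<^bsub>F\<^esub>"
      using sp square_sum_poly_signature[OF assms(1), of n] a unfolding special_algebra_def by blast
    then show False by simp
  qed
  then show ?thesis using F unfolding real_field_def by blast
qed

section \<open>A real residue field\<close>

text \<open>An ideal maximal among those avoiding the multiplicative set of all \<open>1 + s\<close>, \<open>s\<close> a sum of
  squares, becomes maximal after inverting this set, and the residue field is real.\<close>

context cring
begin

definition sos_units :: "'a set"
  where "sos_units = {\<one> \<oplus> s | s. s \<in> sos R}"

lemma sos_units_closed: "s \<in> sos_units \<Longrightarrow> s \<in> carrier R"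
  unfolding sos_units_def using sos_closed by auto

lemma sos_units_one: "\<one> \<in> sos_units"
  unfolding sos_units_def using sos_zero[of R] by force

lemma sos_units_add_sos: "\<lbrakk> s \<in> sos_units; t \<in> sos R \<rbrakk> \<Longrightarrow> s \<oplus> t \<in> sos_units"
  unfolding sos_units_def using sos_add sos_closed by (auto simp: a_assoc)

lemma sos_units_sos: "s \<in> sos_units \<Longrightarrow> s \<in> sos R"
  unfolding sos_units_def using sos_step[of \<one> R] by auto

lemma sos_units_mult: "\<lbrakk> s \<in> sos_units; t \<in> sos_units \<rbrakk> \<Longrightarrow> s \<otimes> t \<in> sos_units"
proof -
  assume s: "s \<in> sos_units" and t: "t \<in> sos_units"
  obtain u where u: "u \<in> sos R" "s = \<one> \<oplus> u" using s unfolding sos_units_def by blast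
  have "s \<otimes> t = t \<oplus> u \<otimes> t"
    unfolding u(2) using sos_closed[OF u(1)] sos_units_closed[OF t] by algebra
  then show ?thesis using sos_units_add_sos[OF t] sos_mult[OF u(1) sos_units_sos[OF t]] by simp
qed

lemma exists_maximal_avoiding_ideal:
  assumes "\<ominus> \<one> \<notin> sos R"
  shows "\<exists>I. ideal I R \<and> I \<inter> sos_units = {} \<and>
    (\<forall>a\<in>carrier R. a \<notin> I \<longrightarrow> (\<exists>i\<in>I. \<exists>b\<in>carrier R. i \<oplus> a \<otimes> b \<in> sos_units))"
proof -
  let ?F = "{I. ideal I R \<and> I \<inter> sos_units = {}}"
  \<comment> \<open>So the zero ideal is a candidate: 1 + s = 0 would make -1 a sum of
    squares.\<close>
  have z: "\<zero> \<notin> sos_units"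
  proof
    assume "\<zero> \<in> sos_units"
    then obtain s where s: "s \<in> sos R" "\<one> \<oplus> s = \<zero>" unfolding sos_units_def by auto
    then have "\<ominus> \<one> = s" using minus_equality[of s \<one>] sos_closed a_comm by simp
    then show False using assms s by simp
  qed
  have "\<exists>I\<in>?F. \<forall>J\<in>?F. I \<subseteq> J \<longrightarrow> J = I"
  proof (rule subset_Zorn_nonempty)
    show "?F \<noteq> {}" using zeroideal z by auto
    fix C assume C: "C \<noteq> {}" "subset.chain ?F C"
    then have "subset.chain {I. ideal I R} C" unfolding subset_chain_def by blast
    then have "ideal (\<Union>C) R" using chain_Union_is_ideal[of C] C(1) by simp
    moreover have "\<Union>C \<inter> sos_units = {}" using C(2) unfolding subset_chain_def by blast
    ultimately show "\<Union>C \<in> ?F" by blast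
  qed
  then obtain I where I0: "I \<in> ?F" "\<forall>J\<in>?F. I \<subseteq> J \<longrightarrow> J = I" by (rule bexE)
  then have I: "ideal I R" "I \<inter> sos_units = {}" by simp_all
  have I_max: "J = I" if "ideal J R" "J \<inter> sos_units = {}" "I \<subseteq> J" for J
    using bspec[OF I0(2), of J] that by simp
  interpret I: ideal I R by fact
  have "\<exists>i\<in>I. \<exists>b\<in>carrier R. i \<oplus> a \<otimes> b \<in> sos_units" if a: "a \<in> carrier R" "a \<notin> I" for a
  proof (rule ccontr)
    assume neg: "\<not> ?thesis"
    let ?J = "set_add R I (PIdl a)"
    have J: "ideal ?J R" using add_ideals[OF I(1) cgenideal_ideal[OF a(1)]] .
    have mem: "x \<in> ?J \<longleftrightarrow> (\<exists>i\<in>I. \<exists>b\<in>carrier R. x = i \<oplus> b \<otimes> a)" for x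
      unfolding set_add_def' cgenideal_def by auto
    have "?J \<inter> sos_units = {}" using neg a(1) by (auto simp: mem m_comm)
    moreover have "I \<subseteq> ?J"
    proof
      fix i assume i: "i \<in> I"
      have "i = i \<oplus> \<zero> \<otimes> a" using I.a_Hcarr[OF i] a(1) by simp
      then show "i \<in> ?J" using mem i by blast
    qed
    ultimately have "?J = I" using I_max[OF J] by simp
    moreover have "a \<in> ?J"
      unfolding mem using I.zero_closed a(1) by (intro bexI[of _ \<zero>] bexI[of _ \<one>]) simp_all
    ultimately show False using a(2) by simp
  qed
  then show ?thesis using I by (intro exI[of _ I]) simp
qed

end

text \<open>Maximality appears as the consequence that is used: for \<open>a\<close> outside
  \<open>I\<close>, the ideal I + (a) meets the multiplicative set.\<close>

locale sos_avoiding_ideal = cring R + ideal I R for R (structure) and I +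
  assumes avoid: "I \<inter> sos_units = {}"
    and maximal: "\<lbrakk> a \<in> carrier R; a \<notin> I \<rbrakk> \<Longrightarrow> \<exists>i\<in>I. \<exists>b\<in>carrier R. i \<oplus> a \<otimes> b \<in> sos_units"
begin

abbreviation S where "S \<equiv> sos_units"

lemma I_carrier: "i \<in> I \<Longrightarrow> i \<in> carrier R"
  by (rule a_Hcarr)

text \<open>If z were outside \<open>I\<close>, some i + z b would be in \<open>S\<close>, and s (i
  + z b) would lie both in \<open>I\<close> and in \<open>S\<close>. Hence members of
  \<open>S\<close> can be cancelled modulo \<open>I\<close>, which makes the equality of fractions
  transitive.\<close>

lemma S_cancel:
  assumes "s \<in> S" "z \<in> carrier R" "s \<otimes> z \<in> I"
  shows "z \<in> I"
proof (rule ccontr)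
  assume "z \<notin> I"
  then obtain i b where i: "i \<in> I" "b \<in> carrier R" "i \<oplus> z \<otimes> b \<in> S" using maximal assms(2) by blast
  have "s \<otimes> (i \<oplus> z \<otimes> b) = s \<otimes> i \<oplus> (s \<otimes> z) \<otimes> b"
    using sos_units_closed[OF assms(1)] assms(2) i(2) I_carrier[OF i(1)] by algebra
  also have "\<dots> \<in> I"
    using I_l_closed[OF i(1) sos_units_closed[OF assms(1)]] I_r_closed[OF assms(3) i(2)] a_closed by simp
  finally show False using sos_units_mult[OF assms(1) i(3)] avoid by blast
qed

text \<open>The class of x / s in the residue field, the localisation at \<open>S\<close> modulo the
  ideal generated by \<open>I\<close>. Localisation and quotient are taken in one step.\<close>

definition frac :: "'a \<Rightarrow> 'a \<Rightarrow> ('a \<times> 'a) set"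
  where "frac x s = {(y, t). y \<in> carrier R \<and> t \<in> S \<and> x \<otimes> t \<ominus> y \<otimes> s \<in> I}"

lemma frac_eq_iff:
  assumes "x \<in> carrier R" "y \<in> carrier R" "s \<in> S" "t \<in> S"
  shows "frac x s = frac y t \<longleftrightarrow> x \<otimes> t \<ominus> y \<otimes> s \<in> I"
proof
  note c = assms(1,2) sos_units_closed[OF assms(3)] sos_units_closed[OF assms(4)]
  assume "frac x s = frac y t"
  moreover have "(y, t) \<in> frac y t"
    unfolding frac_def using assms c zero_closed by (simp add: a_minus_def r_neg)
  ultimately have "(y, t) \<in> frac x s" by simp
  then show "x \<otimes> t \<ominus> y \<otimes> s \<in> I" unfolding frac_def by simp
next
  note c = assms(1,2) sos_units_closed[OF assms(3)] sos_units_closed[OF assms(4)]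
  have trans: "x' \<otimes> v \<ominus> u \<otimes> s' \<in> I"
    if h: "x' \<otimes> t' \<ominus> y' \<otimes> s' \<in> I" "y' \<otimes> v \<ominus> u \<otimes> t' \<in> I"
      and c': "x' \<in> carrier R" "y' \<in> carrier R" "s' \<in> S" "t' \<in> S" "u \<in> carrier R" "v \<in> S" for x' y' s' t' u v
  proof -
    note cc = c'(1,2,5) sos_units_closed[OF c'(3)] sos_units_closed[OF c'(4)] sos_units_closed[OF c'(6)]
    have "t' \<otimes> (x' \<otimes> v \<ominus> u \<otimes> s') = (x' \<otimes> t' \<ominus> y' \<otimes> s') \<otimes> v \<oplus> (y' \<otimes> v \<ominus> u \<otimes> t') \<otimes> s'"
      using cc by algebra
    then have "t' \<otimes> (x' \<otimes> v \<ominus> u \<otimes> s') \<in> I"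
      using I_r_closed[OF h(1) cc(6)] I_r_closed[OF h(2) cc(4)] a_closed by simp
    moreover have "x' \<otimes> v \<ominus> u \<otimes> s' \<in> carrier R" using cc by simp
    ultimately show ?thesis by (rule S_cancel[OF c'(4), rotated])
  qed
  assume h: "x \<otimes> t \<ominus> y \<otimes> s \<in> I"
  have "y \<otimes> s \<ominus> x \<otimes> t = \<ominus> (x \<otimes> t \<ominus> y \<otimes> s)" using c by algebra
  then have h': "y \<otimes> s \<ominus> x \<otimes> t \<in> I" using a_inv_closed[OF h] by simp
  show "frac x s = frac y t"
    unfolding frac_def using trans[OF h' _ assms(2,1,4,3)] trans[OF h _ assms] by blast
qed

lemma frac_eqI:
  assumes "x \<in> carrier R" "y \<in> carrier R" "s \<in> S" "t \<in> S" "x \<otimes> t = y \<otimes> s"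
  shows "frac x s = frac y t"
  using frac_eq_iff[OF assms(1-4)] assms sos_units_closed zero_closed by (simp add: a_minus_def r_neg)

text \<open>Operations on classes by chosen representatives: \<open>f\<close> computes the
  numerator, and denominators are multiplied. Independence of the choice is shown in
  \<open>frac_mult\<close> and \<open>frac_add\<close>.\<close>

definition frac_op :: "('a \<Rightarrow> 'a \<Rightarrow> 'a \<Rightarrow> 'a \<Rightarrow> 'a) \<Rightarrow> ('a \<times> 'a) set \<Rightarrow> ('a \<times> 'a) set \<Rightarrow> ('a \<times> 'a) set"
  where "frac_op f P Q = (let p = (SOME p. p \<in> P); q = (SOME q. q \<in> Q) in
    frac (f (fst p) (snd p) (fst q) (snd q)) (snd p \<otimes> snd q))"

lemma some_frac:
  assumes "x \<in> carrier R" "s \<in> S"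
  obtains y t where "(SOME p. p \<in> frac x s) = (y, t)" "y \<in> carrier R" "t \<in> S" "x \<otimes> t \<ominus> y \<otimes> s \<in> I"
proof -
  have "(x, s) \<in> frac x s"
    unfolding frac_def using assms sos_units_closed[OF assms(2)] zero_closed by (simp add: a_minus_def r_neg)
  then have "(SOME p. p \<in> frac x s) \<in> frac x s" by (rule someI)
  moreover obtain y t where yt: "(SOME p. p \<in> frac x s) = (y, t)" by (cases "SOME p. p \<in> frac x s")
  ultimately show thesis using that[OF yt] unfolding frac_def by auto
qed

definition frac_ring :: "('a \<times> 'a) set ring"
  where "frac_ring = \<lparr>carrier = {frac x s | x s. x \<in> carrier R \<and> s \<in> S},
    monoid.mult = frac_op (\<lambda>x s y t. x \<otimes> y), one = frac \<one> \<one>, ring.zero = frac \<zero> \<one>,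
    ring.add = frac_op (\<lambda>x s y t. x \<otimes> t \<oplus> y \<otimes> s)\<rparr>"

lemma frac_mult:
  assumes "x \<in> carrier R" "s \<in> S" "y \<in> carrier R" "t \<in> S"
  shows "frac x s \<otimes>\<^bsub>frac_ring\<^esub> frac y t = frac (x \<otimes> y) (s \<otimes> t)"
proof -
  obtain x' s' where x': "(SOME p. p \<in> frac x s) = (x', s')" "x' \<in> carrier R" "s' \<in> S" "x \<otimes> s' \<ominus> x' \<otimes> s \<in> I"
    using some_frac[OF assms(1,2)] .
  obtain y' t' where y': "(SOME p. p \<in> frac y t) = (y', t')" "y' \<in> carrier R" "t' \<in> S" "y \<otimes> t' \<ominus> y' \<otimes> t \<in> I"
    using some_frac[OF assms(3,4)] .
  note c = assms(1,3) x'(2) y'(2) sos_units_closed[OF assms(2)] sos_units_closed[OF assms(4)]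
    sos_units_closed[OF x'(3)] sos_units_closed[OF y'(3)]
  have "(x \<otimes> y) \<otimes> (s' \<otimes> t') \<ominus> (x' \<otimes> y') \<otimes> (s \<otimes> t) =
      (x \<otimes> s' \<ominus> x' \<otimes> s) \<otimes> (y \<otimes> t') \<oplus> (y \<otimes> t' \<ominus> y' \<otimes> t) \<otimes> (x' \<otimes> s)"
    using c by algebra
  also have "\<dots> \<in> I"
    using I_r_closed[OF x'(4), of "y \<otimes> t'"] I_r_closed[OF y'(4), of "x' \<otimes> s"] a_closed c by simp
  finally have "frac (x \<otimes> y) (s \<otimes> t) = frac (x' \<otimes> y') (s' \<otimes> t')"
    by (subst frac_eq_iff) (use c assms x' y' sos_units_mult in auto)
  then show ?thesis by (simp add: frac_ring_def frac_op_def x'(1) y'(1))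
qed

lemma frac_add:
  assumes "x \<in> carrier R" "s \<in> S" "y \<in> carrier R" "t \<in> S"
  shows "frac x s \<oplus>\<^bsub>frac_ring\<^esub> frac y t = frac (x \<otimes> t \<oplus> y \<otimes> s) (s \<otimes> t)"
proof -
  obtain x' s' where x': "(SOME p. p \<in> frac x s) = (x', s')" "x' \<in> carrier R" "s' \<in> S" "x \<otimes> s' \<ominus> x' \<otimes> s \<in> I"
    using some_frac[OF assms(1,2)] .
  obtain y' t' where y': "(SOME p. p \<in> frac y t) = (y', t')" "y' \<in> carrier R" "t' \<in> S" "y \<otimes> t' \<ominus> y' \<otimes> t \<in> I"
    using some_frac[OF assms(3,4)] .
  note c = assms(1,3) x'(2) y'(2) sos_units_closed[OF assms(2)] sos_units_closed[OF assms(4)]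
    sos_units_closed[OF x'(3)] sos_units_closed[OF y'(3)]
  have "(x \<otimes> t \<oplus> y \<otimes> s) \<otimes> (s' \<otimes> t') \<ominus> (x' \<otimes> t' \<oplus> y' \<otimes> s') \<otimes> (s \<otimes> t) =
      (x \<otimes> s' \<ominus> x' \<otimes> s) \<otimes> (t \<otimes> t') \<oplus> (y \<otimes> t' \<ominus> y' \<otimes> t) \<otimes> (s \<otimes> s')"
    using c by algebra
  also have "\<dots> \<in> I"
    using I_r_closed[OF x'(4), of "t \<otimes> t'"] I_r_closed[OF y'(4), of "s \<otimes> s'"] a_closed c by simp
  finally have "frac (x \<otimes> t \<oplus> y \<otimes> s) (s \<otimes> t) = frac (x' \<otimes> t' \<oplus> y' \<otimes> s') (s' \<otimes> t')"
    by (subst frac_eq_iff) (use c assms x' y' sos_units_mult in auto)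
  then show ?thesis by (simp add: frac_ring_def frac_op_def x'(1) y'(1))
qed

lemma frac_carrier: "\<lbrakk> x \<in> carrier R; s \<in> S \<rbrakk> \<Longrightarrow> frac x s \<in> carrier frac_ring"
  unfolding frac_ring_def by auto

lemma fracE:
  assumes "P \<in> carrier frac_ring"
  obtains x s where "P = frac x s" "x \<in> carrier R" "s \<in> S" "s \<in> carrier R"
  using assms sos_units_closed unfolding frac_ring_def by auto

lemma frac_zero: "\<zero>\<^bsub>frac_ring\<^esub> = frac \<zero> \<one>" and frac_one: "\<one>\<^bsub>frac_ring\<^esub> = frac \<one> \<one>"
  by (simp_all add: frac_ring_def)

lemma frac_cring: "cring frac_ring"
proof (intro cringI abelian_groupI comm_monoidI)
  fix P Q assume P: "P \<in> carrier frac_ring" and Q: "Q \<in> carrier frac_ring"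
  obtain x s where x: "P = frac x s" "x \<in> carrier R" "s \<in> S" "s \<in> carrier R" using fracE[OF P] .
  obtain y t where y: "Q = frac y t" "y \<in> carrier R" "t \<in> S" "t \<in> carrier R" using fracE[OF Q] .
  show "P \<oplus>\<^bsub>frac_ring\<^esub> Q \<in> carrier frac_ring" "P \<otimes>\<^bsub>frac_ring\<^esub> Q \<in> carrier frac_ring"
    unfolding x(1) y(1) using x y by (auto simp: frac_add frac_mult intro!: frac_carrier sos_units_mult)
  show "P \<oplus>\<^bsub>frac_ring\<^esub> Q = Q \<oplus>\<^bsub>frac_ring\<^esub> P" "P \<otimes>\<^bsub>frac_ring\<^esub> Q = Q \<otimes>\<^bsub>frac_ring\<^esub> P"
    unfolding x(1) y(1) using x y by (simp_all add: frac_add frac_mult a_comm m_comm)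
next
  fix P Q T assume P: "P \<in> carrier frac_ring" and Q: "Q \<in> carrier frac_ring" and T: "T \<in> carrier frac_ring"
  obtain x s where x: "P = frac x s" "x \<in> carrier R" "s \<in> S" "s \<in> carrier R" using fracE[OF P] .
  obtain y t where y: "Q = frac y t" "y \<in> carrier R" "t \<in> S" "t \<in> carrier R" using fracE[OF Q] .
  obtain z u where z: "T = frac z u" "z \<in> carrier R" "u \<in> S" "u \<in> carrier R" using fracE[OF T] .
  note S = sos_units_mult[OF x(3) y(3)] sos_units_mult[OF y(3) z(3)] sos_units_mult[OF x(3) z(3)]
  show "P \<otimes>\<^bsub>frac_ring\<^esub> Q \<otimes>\<^bsub>frac_ring\<^esub> T = P \<otimes>\<^bsub>frac_ring\<^esub> (Q \<otimes>\<^bsub>frac_ring\<^esub> T)"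
    unfolding x(1) y(1) z(1) using x y z S by (simp add: frac_mult m_assoc)
  have "(x \<otimes> t \<oplus> y \<otimes> s) \<otimes> u \<oplus> z \<otimes> (s \<otimes> t) = x \<otimes> (t \<otimes> u) \<oplus> (y \<otimes> u \<oplus> z \<otimes> t) \<otimes> s"
    using x(2,4) y(2,4) z(2,4) by algebra
  then show "P \<oplus>\<^bsub>frac_ring\<^esub> Q \<oplus>\<^bsub>frac_ring\<^esub> T = P \<oplus>\<^bsub>frac_ring\<^esub> (Q \<oplus>\<^bsub>frac_ring\<^esub> T)"
    unfolding x(1) y(1) z(1) using x y z S by (simp add: frac_add m_assoc)
  have "frac ((x \<otimes> t \<oplus> y \<otimes> s) \<otimes> z) (s \<otimes> t \<otimes> u) =
      frac (x \<otimes> z \<otimes> (t \<otimes> u) \<oplus> y \<otimes> z \<otimes> (s \<otimes> u)) (s \<otimes> u \<otimes> (t \<otimes> u))"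
  proof (rule frac_eqI)
    show "(x \<otimes> t \<oplus> y \<otimes> s) \<otimes> z \<otimes> (s \<otimes> u \<otimes> (t \<otimes> u)) =
        (x \<otimes> z \<otimes> (t \<otimes> u) \<oplus> y \<otimes> z \<otimes> (s \<otimes> u)) \<otimes> (s \<otimes> t \<otimes> u)"
      using x(2,4) y(2,4) z(2,4) by algebra
  qed (use x y z S sos_units_mult in auto)
  then show "(P \<oplus>\<^bsub>frac_ring\<^esub> Q) \<otimes>\<^bsub>frac_ring\<^esub> T = P \<otimes>\<^bsub>frac_ring\<^esub> T \<oplus>\<^bsub>frac_ring\<^esub> Q \<otimes>\<^bsub>frac_ring\<^esub> T"
    unfolding x(1) y(1) z(1) using x y z S by (simp add: frac_add frac_mult)
next
  fix P assume P: "P \<in> carrier frac_ring"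
  obtain x s where x: "P = frac x s" "x \<in> carrier R" "s \<in> S" "s \<in> carrier R" using fracE[OF P] .
  show "\<zero>\<^bsub>frac_ring\<^esub> \<oplus>\<^bsub>frac_ring\<^esub> P = P" "\<one>\<^bsub>frac_ring\<^esub> \<otimes>\<^bsub>frac_ring\<^esub> P = P"
    unfolding x(1) frac_zero frac_one using x sos_units_one by (simp_all add: frac_add frac_mult)
  have "frac ((\<ominus> x) \<otimes> s \<oplus> x \<otimes> s) (s \<otimes> s) = frac \<zero> \<one>"
  proof (rule frac_eqI)
    show "((\<ominus> x) \<otimes> s \<oplus> x \<otimes> s) \<otimes> \<one> = \<zero> \<otimes> (s \<otimes> s)"
      using x(2,4) by algebra
  qed (use x sos_units_mult sos_units_one in auto)
  then have "frac (\<ominus> x) s \<oplus>\<^bsub>frac_ring\<^esub> P = \<zero>\<^bsub>frac_ring\<^esub>"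
    unfolding x(1) frac_zero using x by (simp add: frac_add)
  then show "\<exists>Q\<in>carrier frac_ring. Q \<oplus>\<^bsub>frac_ring\<^esub> P = \<zero>\<^bsub>frac_ring\<^esub>"
    using frac_carrier[of "\<ominus> x" s] x by (intro bexI[of _ "frac (\<ominus> x) s"]) auto
qed (auto simp: frac_zero frac_one intro: frac_carrier sos_units_one)

lemma one_notin_ideal: "\<one> \<notin> I"
  using sos_units_one avoid by blast

lemma frac_field: "field frac_ring"
proof -
  interpret F: cring frac_ring by (rule frac_cring)
  show ?thesis
  proof (rule F.cring_fieldI2)
    show "\<zero>\<^bsub>frac_ring\<^esub> \<noteq> \<one>\<^bsub>frac_ring\<^esub>"
    proof
      assume "\<zero>\<^bsub>frac_ring\<^esub> = \<one>\<^bsub>frac_ring\<^esub>"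
      then have "\<one> \<otimes> \<one> \<ominus> \<zero> \<otimes> \<one> \<in> I"
        unfolding frac_zero frac_one using frac_eq_iff[of \<one> \<zero> \<one> \<one>] sos_units_one by simp
      then show False using one_notin_ideal by (simp add: a_minus_def)
    qed
    fix P assume P: "P \<in> carrier frac_ring" "P \<noteq> \<zero>\<^bsub>frac_ring\<^esub>"
    obtain x s where x: "P = frac x s" "x \<in> carrier R" "s \<in> S" "s \<in> carrier R" using fracE[OF P(1)] .
    have "x \<notin> I"
    proof
      assume "x \<in> I"
      then have "frac x s = frac \<zero> \<one>"
        using frac_eq_iff[of x \<zero> s \<one>] x sos_units_one by (simp add: a_minus_def)
      then show False using P(2) x(1) frac_zero by simp
    qed
    \<comment> \<open>Modulo \<open>I\<close> the element i + x b is x b, so s b / (i + x b) is the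
      inverse of x / s.\<close>
    then obtain i b where i: "i \<in> I" "b \<in> carrier R" "i \<oplus> x \<otimes> b \<in> S" using maximal[OF x(2)] by blast
    have ic: "i \<in> carrier R" using I_carrier[OF i(1)] .
    have "frac (x \<otimes> (s \<otimes> b)) (s \<otimes> (i \<oplus> x \<otimes> b)) = frac \<one> \<one>"
    proof (subst frac_eq_iff)
      have "x \<otimes> (s \<otimes> b) \<otimes> \<one> \<ominus> \<one> \<otimes> (s \<otimes> (i \<oplus> x \<otimes> b)) = (\<ominus> s) \<otimes> i"
        using x(2,4) i(2) ic by algebra
      then show "x \<otimes> (s \<otimes> b) \<otimes> \<one> \<ominus> \<one> \<otimes> (s \<otimes> (i \<oplus> x \<otimes> b)) \<in> I"
        using I_l_closed[OF i(1), of "\<ominus> s"] x by simp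
    qed (use x i sos_units_mult sos_units_one in auto)
    then have "P \<otimes>\<^bsub>frac_ring\<^esub> frac (s \<otimes> b) (i \<oplus> x \<otimes> b) = \<one>\<^bsub>frac_ring\<^esub>"
      unfolding x(1) frac_one using x i by (simp add: frac_mult)
    then show "\<exists>Q\<in>carrier frac_ring. P \<otimes>\<^bsub>frac_ring\<^esub> Q = \<one>\<^bsub>frac_ring\<^esub>"
      using frac_carrier[of "s \<otimes> b" "i \<oplus> x \<otimes> b"] x i by (intro bexI[of _ "frac (s \<otimes> b) (i \<oplus> x \<otimes> b)"]) auto
  qed
qed

lemma frac_hom: "(\<lambda>x. frac x \<one>) \<in> ring_hom R frac_ring"
  by (rule ring_hom_memI)
    (use sos_units_one in \<open>auto simp: frac_mult frac_add frac_one intro!: frac_carrier\<close>)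

text \<open>Over a common denominator a sum of squares of fractions is u / s^2 with u a sum of
  squares in the ring. If this is -1, then s^2 + u lies in \<open>I\<close>; but it also lies in
  \<open>S\<close>, which is closed under adding sums of squares.\<close>

lemma frac_real: "\<ominus>\<^bsub>frac_ring\<^esub> \<one>\<^bsub>frac_ring\<^esub> \<notin> sos frac_ring"
proof
  interpret F: cring frac_ring by (rule frac_cring)
  interpret h: ring_hom_cring R frac_ring "\<lambda>x. frac x \<one>" by unfold_locales (rule frac_hom)
  have "\<exists>u\<in>sos R. \<exists>s\<in>S. P = frac u (s \<otimes> s)" if "P \<in> sos frac_ring" for P
    using that
  proof induction
    case sos_zero
    show ?case unfolding frac_zero
      using sos.sos_zero[of R] sos_units_one by (intro bexI[of _ \<zero>] bexI[of _ \<one>]) auto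
  next
    case (sos_step Q P)
    then obtain u s where u: "u \<in> sos R" "s \<in> S" "P = frac u (s \<otimes> s)" by blast
    obtain x t where x: "Q = frac x t" "x \<in> carrier R" "t \<in> S" "t \<in> carrier R" using fracE[OF sos_step.hyps(1)] .
    have c: "u \<in> carrier R" "s \<in> carrier R" using u sos_closed sos_units_closed by auto
    have S: "s \<otimes> s \<in> S" "t \<otimes> t \<in> S" "t \<otimes> s \<in> S" using u x sos_units_mult by auto
    have "Q \<otimes>\<^bsub>frac_ring\<^esub> Q \<oplus>\<^bsub>frac_ring\<^esub> P =
        frac (x \<otimes> x \<otimes> (s \<otimes> s) \<oplus> u \<otimes> (t \<otimes> t)) (t \<otimes> t \<otimes> (s \<otimes> s))"
      unfolding x(1) u(3) using x u c S by (simp add: frac_mult frac_add)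
    also have "x \<otimes> x \<otimes> (s \<otimes> s) \<oplus> u \<otimes> (t \<otimes> t) = (x \<otimes> s) \<otimes> (x \<otimes> s) \<oplus> t \<otimes> t \<otimes> u"
      using c x(2,4) by algebra
    also have "t \<otimes> t \<otimes> (s \<otimes> s) = (t \<otimes> s) \<otimes> (t \<otimes> s)" using c x(2,4) by algebra
    finally show ?case
      using sos.sos_step[of "x \<otimes> s" R "t \<otimes> t \<otimes> u"] sos_square_mult[OF u(1) x(4)] x c S(3) by auto
  qed
  moreover assume "\<ominus>\<^bsub>frac_ring\<^esub> \<one>\<^bsub>frac_ring\<^esub> \<in> sos frac_ring"
  ultimately obtain u s where u: "u \<in> sos R" "s \<in> S" "\<ominus>\<^bsub>frac_ring\<^esub> \<one>\<^bsub>frac_ring\<^esub> = frac u (s \<otimes> s)" by blast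
  have c: "u \<in> carrier R" "s \<in> carrier R" using u sos_closed sos_units_closed by auto
  have S: "s \<otimes> s \<in> S" using u sos_units_mult by auto
  have "frac (\<ominus> \<one>) \<one> = \<ominus>\<^bsub>frac_ring\<^esub> \<one>\<^bsub>frac_ring\<^esub>"
    unfolding frac_one by (rule h.hom_a_inv) (rule one_closed)
  then have "frac u (s \<otimes> s) = frac (\<ominus> \<one>) \<one>" unfolding u(3) by (rule sym)
  then have "u \<otimes> \<one> \<ominus> (\<ominus> \<one>) \<otimes> (s \<otimes> s) \<in> I"
    by (rule iffD1[OF frac_eq_iff[OF c(1) _ S sos_units_one], rotated]) simp
  moreover have "u \<otimes> \<one> \<ominus> (\<ominus> \<one>) \<otimes> (s \<otimes> s) = s \<otimes> s \<oplus> u" using c by algebra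
  ultimately show False using sos_units_add_sos[OF S u(1)] avoid by auto
qed

end

text \<open>\<open>F\<close> is the residue field of fractions; its elements are classes of pairs,
  whence the carrier type of sets of pairs.\<close>

theorem real_algebra_to_real_field:
  fixes R :: "('r, 'p) ring_scheme" and A :: "('r, 'a, 'q) module_scheme"
  assumes "field R" "algebra R A" "\<not> sum_of_squares A (\<ominus>\<^bsub>A\<^esub> \<one>\<^bsub>A\<^esub>)"
  shows "\<exists>F :: ('r, ('a \<times> 'a) set) module. field_extension R F \<and> real_field F \<and> algebra_hom R A F \<noteq> {}"
proof -
  interpret A: cring A using assms(2) by (rule algebra.axioms)
  have "\<ominus>\<^bsub>A\<^esub> \<one>\<^bsub>A\<^esub> \<notin> sos A" using assms(3) A.sum_of_squares_iff by blast
  then obtain I where I: "ideal I A" "I \<inter> A.sos_units = {}"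
    "\<forall>a\<in>carrier A. a \<notin> I \<longrightarrow> (\<exists>i\<in>I. \<exists>b\<in>carrier A. i \<oplus>\<^bsub>A\<^esub> a \<otimes>\<^bsub>A\<^esub> b \<in> A.sos_units)"
    using A.exists_maximal_avoiding_ideal by blast
  interpret ideal I A by fact
  interpret L: sos_avoiding_ideal A I by unfold_locales (use I in auto)
  define h where "h x = L.frac x \<one>\<^bsub>A\<^esub>" for x
  have h: "h \<in> ring_hom A L.frac_ring" unfolding h_def using L.frac_hom .
  have sm: "structure_map A \<in> ring_hom R A" using structure_map_hom[OF assms(2)] .
  define F where "F = hom_algebra (h \<circ> structure_map A) L.frac_ring"
  have Ff: "field F" unfolding F_def using hom_algebra_field[OF L.frac_field] .
  have "algebra R F"
    unfolding F_def using hom_algebra_algebra[OF fieldE(1)[OF assms(1)] L.frac_cring ring_hom_trans[OF sm h]] .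
  then have ext: "field_extension R F" using assms(1) Ff unfolding field_extension_def by blast
  have "id \<in> ring_hom F L.frac_ring" by (simp add: F_def ring_hom_def)
  then interpret idh: ring_hom_cring F L.frac_ring id
    using fieldE(1)[OF Ff] L.frac_cring by (intro ring_hom_cring.intro ring_hom_cring_axioms.intro)
  have "\<ominus>\<^bsub>F\<^esub> \<one>\<^bsub>F\<^esub> \<notin> sos F"
  proof
    assume "\<ominus>\<^bsub>F\<^esub> \<one>\<^bsub>F\<^esub> \<in> sos F"
    then have "id (\<ominus>\<^bsub>F\<^esub> \<one>\<^bsub>F\<^esub>) \<in> sos L.frac_ring"
      by (rule sos_hom[OF fieldE(1)[OF Ff] L.frac_cring idh.homh])
    then show False using L.frac_real idh.hom_a_inv[OF idh.R.one_closed] idh.hom_one by simp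
  qed
  then have real: "real_field F" using Ff by (simp add: real_field_iff)
  have "h \<in> algebra_hom R A F"
    unfolding algebra_hom_def
  proof (intro CollectI conjI ballI)
    show "h \<in> ring_hom A F" using h by (simp add: F_def ring_hom_def)
    fix c x assume c: "c \<in> carrier R" and x: "x \<in> carrier A"
    have "c \<odot>\<^bsub>A\<^esub> x = structure_map A c \<otimes>\<^bsub>A\<^esub> x"
      unfolding structure_map_def using c x using algebra.smult_assoc2[OF assms(2), of c "\<one>\<^bsub>A\<^esub>" x] by simp
    then have "h (c \<odot>\<^bsub>A\<^esub> x) = h (structure_map A c) \<otimes>\<^bsub>L.frac_ring\<^esub> h x"
      using ring_hom_mult[OF h, of "structure_map A c" x] ring_hom_closed[OF sm c] x by simp
    then show "h (c \<odot>\<^bsub>A\<^esub> x) = c \<odot>\<^bsub>F\<^esub> h x" by (simp add: F_def)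
  qed
  then show ?thesis using ext real by blast
qed

lemma special_extension_hom_not_sos:
  assumes "real_field R" "algebra R A" "special_extension R F" "algebra_hom R A F \<noteq> {}"
  shows "\<not> sum_of_squares A (\<ominus>\<^bsub>A\<^esub> \<one>\<^bsub>A\<^esub>)"
proof
  interpret A: cring A using assms(2) by (rule algebra.axioms)
  have F: "field F" "\<ominus>\<^bsub>F\<^esub> \<one>\<^bsub>F\<^esub> \<notin> sos F"
    using special_extension_real[OF assms(1,3)] by (auto simp: real_field_iff)
  interpret F: field F by (rule F(1))
  obtain h where h: "h \<in> ring_hom A F" using assms(4) unfolding algebra_hom_def by blast
  interpret h: ring_hom_cring A F h by unfold_locales (rule h)
  assume "sum_of_squares A (\<ominus>\<^bsub>A\<^esub> \<one>\<^bsub>A\<^esub>)"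
  then have "h (\<ominus>\<^bsub>A\<^esub> \<one>\<^bsub>A\<^esub>) \<in> sos F"
    using sos_hom[OF A.is_cring F.is_cring h] A.sum_of_squares_iff by blast
  then show False using F(2) by simp
qed

(* The existence of a special extension receiving a morphism from A is stated with carrier
  in the type of sets of pairs over the type of A, which contains a copy of the subfield generated
  by the image of any such morphism (an element q is represented by the set of all
  (x, y) with h x / h y = q). The second conjunct gives the forward direction for
  extensions with carrier in an arbitrary type. *)

theorem proposition4p20:
  fixes R :: "('r, 'p) ring_scheme" and A :: "('r, 'a, 'q) module_scheme"
  assumes "real_closed_field R" and "algebra R A"
  shows "((\<exists>F :: ('r, ('a \<times> 'a) set) module. special_extension R F \<and> algebra_hom R A F \<noteq> {})
            \<longleftrightarrow> \<not> sum_of_squares A (\<ominus>\<^bsub>A\<^esub> \<one>\<^bsub>A\<^esub>))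
       \<and> ((\<exists>F :: ('r, 'f, 's) module_scheme. special_extension R F \<and> algebra_hom R A F \<noteq> {})
            \<longrightarrow> \<not> sum_of_squares A (\<ominus>\<^bsub>A\<^esub> \<one>\<^bsub>A\<^esub>))
       \<and> (\<forall>L :: ('r, 'l, 't) module_scheme. field_extension R L \<longrightarrow>
            (special_extension R L \<longleftrightarrow> real_field L))"
proof -
  have R: "real_field R" using assms(1) unfolding real_closed_field_def by blast
  have "\<exists>F :: ('r, ('a \<times> 'a) set) module. special_extension R F \<and> algebra_hom R A F \<noteq> {}"
    if "\<not> sum_of_squares A (\<ominus>\<^bsub>A\<^esub> \<one>\<^bsub>A\<^esub>)"
    using real_algebra_to_real_field[OF _ assms(2) that] R real_extension_special[OF assms(1)]
    unfolding real_field_iff by blast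
  then have "(\<exists>F :: ('r, ('a \<times> 'a) set) module. special_extension R F \<and> algebra_hom R A F \<noteq> {})
      \<longleftrightarrow> \<not> sum_of_squares A (\<ominus>\<^bsub>A\<^esub> \<one>\<^bsub>A\<^esub>)"
    by (intro iffI) (elim exE conjE, rule special_extension_hom_not_sos[OF R assms(2)])
  moreover have "(\<exists>F :: ('r, 'f, 's) module_scheme. special_extension R F \<and> algebra_hom R A F \<noteq> {})
      \<longrightarrow> \<not> sum_of_squares A (\<ominus>\<^bsub>A\<^esub> \<one>\<^bsub>A\<^esub>)"
    by (intro impI) (elim exE conjE, rule special_extension_hom_not_sos[OF R assms(2)])
  moreover have "\<forall>L :: ('r, 'l, 't) module_scheme. field_extension R L \<longrightarrow>
      (special_extension R L \<longleftrightarrow> real_field L)"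
    using special_extension_real[OF R] real_extension_special[OF assms(1)] by (intro allI impI iffI)
  ultimately show ?thesis by (intro conjI)
qed

end
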